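(* Let $(R,{}^-)$ be a unital associative $\Bbbk$-superalgebra with superinvolution. Then the central extension $\psi\circ\psi':\mathfrak{uosp}_{1|2}(R,{}^-)\to\mathfrak{osp}_{1|2}(R,{}^-)$ is universal.
   Context: **Base conventions.** $\Bbbk$ is a unital commutative associative ring in which $2$ is invertible; all modules and (super)algebras are over $\Bbbk$. Superalgebras are $\mathbb{Z}/2\mathbb{Z}$-graded, $|x|$ is the degree of a homogeneous $x$, and formulas involving degrees are for homogeneous elements, extended linearly. A Lie superalgebra is a $\mathbb Z/2\mathbb Z$-graded module with an even bilinear bracket satisfying (only) $[x,y]=-(-1)^{|x||y|}[y,x]$ and $(-1)^{|x||z|}[[x,y],z]+(-1)^{|y||x|}[[y,z],x]+(-1)^{|z||y|}[[z,x],y]=0$; in particular $[[x,x],x]=0$ for odd $x$ is not an extra axiom. A superinvolution on $R$ is a degree-preserving $\Bbbk$-linear map $a\mapsto\bar a$ with $\overline{ab}=(-1)^{|a||b|}\bar b\bar a$, $\bar{\bar a}=a$. In $R$, $[a,b]=ab-(-1)^{|a||b|}ba$. Put $\rho(a)=(-1)^{|a|}a$, $a_+=a+\bar a$. **$\mathfrak{osp}_{1|2}(R,{}^-)$.** Give the algebra of $3\times3$ matrices over $R$ the grading $|e_{ij}(a)|=|i|+|j|+|a|$, $|1|=0$, $|2|=|3|=1$, and the superinvolution $$\begin{pmatrix}a&b_1&c_2\\ c_1&d_{11}&d_{12}\\ b_2&d_{21}&d_{22}\end{pmatrix}^{\mathrm{osp}}=\begin{pmatrix}\overline{a}&-\overline{\rho(b_2)}&\overline{\rho(c_1)}\\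 \overline{\rho(c_2)}&\overline{d_{22}}&-\overline{d_{12}}\\ -\overline{\rho(b_1)}&-\overline{d_{21}}&\overline{d_{11}}\end{pmatrix}.$$ $\mathfrak{osp}_{1|2}(R,{}^-)$ is the derived Lie superalgebra (for the supercommutator) of $\{X: X^{\mathrm{osp}}=-X\}$. It contains $v(a)=e_{23}(a_+)$, $w(a)=e_{32}(a_+)$, $f(a)=e_{12}(a)+e_{31}(\rho(\bar a))$, $g(a)=e_{21}(a)-e_{13}(\rho(\bar a))$. **$\widehat{\mathfrak{osp}}_{1|2}(R,{}^-)$.** The Lie superalgebra generated by $\mathbf v(a),\mathbf w(a)$ of degree $|a|$ and $\mathbf f(a),\mathbf g(a)$ of degree $1+|a|$ ($a\in R$ homogeneous), $\Bbbk$-linear in $a$, with relations $\mathbf v(\bar a)=\mathbf v(a)$, $\mathbf w(\bar a)=\mathbf w(a)$, $[\mathbf v(a),\mathbf v(b)]=[\mathbf w(a),\mathbf w(b)]=0$, $[\mathbf v(a),\mathbf g(b)]=0$, $[\mathbf f(a),\mathbf w(b)]=0$, $[\mathbf v(a),\mathbf f(b)]=(-1)^{|b|}\mathbf g(a_+\bar b)$, $[\mathbf g(a),\mathbf w(b)]=-(-1)^{|a|}\mathbf f(\bar ab_+)$, $[\mathbf f(a),\mathbf f(b)]=(-1)^{|a|}\mathbf w(\bar ab)$, $[\mathbf g(a),\mathbf g(b)]=-(-1)^{|b|}\mathbf v(a\bar b)$, $[[\mathbf f(a),\mathbf g(b)],\mathbf f(c)]=\mathbf f(abc-\overline{ab}c-(-1)^{|a||b|+|b||c|+|c||a|}cba)$,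 $[\mathbf g(a),[\mathbf f(b),\mathbf g(c)]]=\mathbf g(abc-a\overline{bc}-(-1)^{|a||b|+|b||c|+|c||a|}cba)$. Let $\psi:\widehat{\mathfrak{osp}}_{1|2}(R,{}^-)\to\mathfrak{osp}_{1|2}(R,{}^-)$ be the homomorphism with $\mathbf v(a)\mapsto v(a)$, $\mathbf w(a)\mapsto w(a)$, $\mathbf f(a)\mapsto f(a)$, $\mathbf g(a)\mapsto g(a)$. As a $\Bbbk$-module $\widehat{\mathfrak{osp}}_{1|2}(R,{}^-)$ is spanned by $\mathfrak B=\{\mathbf h(a,b),\mathbf v(a),\mathbf w(a),\mathbf f(a),\mathbf g(a)\}$, $a,b\in R$ homogeneous, where $\mathbf h(a,b)=[\mathbf f(a),\mathbf g(b)]$. **$\mathfrak{uosp}_{1|2}(R,{}^-)$.** Let $\mathcal I_3\subseteq R$ be the $\Bbbk$-submodule spanned by $3a$, $a-\bar a$, $([a,b]-\overline{[a,b]})c$, $a_+b_+c-(-1)^{|a||b|}b_+a_+c$, and $(-1)^{|a||c|}(a\bar bc+\bar ab\bar c)+(-1)^{|b||a|}(b\bar ca+\bar bc\bar a)+(-1)^{|c||b|}(c\bar ab+\bar ca\bar b)$ for homogeneous $a,b,c\in R$. Let $\mathfrak z=R/\mathcal I_3\oplus R/\mathcal I_3$, with $\boldsymbol\pi_1(a),\boldsymbol\pi_2(a)$ the classes of $a$ in the first and second summand, where $\boldsymbol\pi_i(a)$ is given degree $1+|a|$. There is a 2-cocycle (bilinear map) $\beta$ on $\widehat{\mathfrak{osp}}_{1|2}(R,{}^-)$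 with values in $\mathfrak z$ given by $\beta(\mathbf v(a),\mathbf g(b))=-(-1)^{|a|(1+|b|)}\beta(\mathbf g(b),\mathbf v(a))=\boldsymbol\pi_1(a_+b)$, $\beta(\mathbf f(a),\mathbf w(b))=-(-1)^{(1+|a|)|b|}\beta(\mathbf w(b),\mathbf f(a))=\boldsymbol\pi_2(ab_+)$, and $\beta(x,y)=0$ for all other pairs in $\mathfrak B\times\mathfrak B$. Then $\mathfrak{uosp}_{1|2}(R,{}^-)=\widehat{\mathfrak{osp}}_{1|2}(R,{}^-)\oplus\mathfrak z$ with bracket $[x\oplus c,y\oplus c']=[x,y]\oplus\beta(x,y)$, and $\psi'(x\oplus c)=x$. **Central extensions.** A central extension is a surjective homomorphism of Lie superalgebras whose kernel lies in the center of the source. A central extension $\psi:\mathfrak g\to L$ is universal if for every central extension $\varphi:\mathfrak E\to L$ there is a unique homomorphism $\varphi':\mathfrak g\to\mathfrak E$ with $\varphi\circ\varphi'=\psi$. *)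

theory Defs
  imports
    "HOL-Algebra.Module"
    "HOL-Algebra.AbelCoset"
    "HOL-Analysis.Cartesian_Space"
    "HOL-Library.Z2"
begin

section \<open>Graded modules over a type of scalars\<close>

text \<open>
  The base ring is a type \<open>'k\<close> of sort \<open>{comm_ring, monoid_mult}\<close> and the coordinate algebra
  a type \<open>'r\<close> of sort \<open>{ring, monoid_mult}\<close>.  These are \<open>comm_ring_1\<close> and \<open>ring_1\<close> without the
  axiom \<open>0 \<noteq> 1\<close>, so that the zero ring is not excluded.  Lie superalgebras have explicit
  carriers (submodules and quotients occur) and live in the module records of HOL-Algebra,
  with \<open>type_ring\<close> as ring of scalars.  Degrees are elements of \<^typ>\<open>bit\<close>, the field with two
  elements.
\<close>

definition type_ring :: "'k::{comm_ring,monoid_mult} ring"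
  where "type_ring = \<lparr>carrier = UNIV, monoid.mult = (*), one = 1, ring.zero = 0, add = (+)\<rparr>"

definition lin_span :: "('k::{comm_ring,monoid_mult}, 'a, 'm) module_scheme \<Rightarrow> 'a set \<Rightarrow> 'a set"
  where "lin_span M S = \<Inter>{N. submodule N type_ring M \<and> S \<subseteq> N}"

definition quot_module ::
    "('k::{comm_ring,monoid_mult}, 'a, 'm) module_scheme \<Rightarrow> 'a set \<Rightarrow> ('k, 'a set) module"
  where "quot_module M N =
    \<lparr>carrier = A_RCOSETS M N, monoid.mult = undefined, one = undefined, ring.zero = N,
     add = set_add M, smult = (\<lambda>c A. \<Union>a\<in>A. N +>\<^bsub>M\<^esub> (c \<odot>\<^bsub>M\<^esub> a))\<rparr>"

definition z2_graded ::
    "('k::{comm_ring,monoid_mult}, 'a, 'm) module_scheme \<Rightarrow> (bit \<Rightarrow> 'a set) \<Rightarrow> bool"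
  where "z2_graded M P \<longleftrightarrow>
    (\<forall>p. submodule (P p) type_ring M) \<and>
    (\<forall>x\<in>carrier M. \<exists>!yz. yz \<in> P 0 \<times> P 1 \<and> x = fst yz \<oplus>\<^bsub>M\<^esub> snd yz)"

text \<open>\<open>sg p a\<close> is \<open>(-1)\<^sup>p a\<close>; \<open>msg\<close> is the same for elements of a module record.\<close>

definition sg :: "bit \<Rightarrow> 'a::uminus \<Rightarrow> 'a"
  where "sg p a = (if p = 1 then - a else a)"

definition msg :: "('k, 'a, 'm) module_scheme \<Rightarrow> bit \<Rightarrow> 'a \<Rightarrow> 'a"
  where "msg M p x = (if p = 1 then \<ominus>\<^bsub>M\<^esub> x else x)"


section \<open>Lie superalgebras and central extensions\<close>

text \<open>
  The fields \<open>mult\<close> and \<open>one\<close> inherited from \<open>ring\<close> play no role; the product is \<open>bracket\<close>.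
\<close>

record ('k, 'a) lie_salg = "('k, 'a) module" +
  bracket :: "'a \<Rightarrow> 'a \<Rightarrow> 'a"
  part :: "bit \<Rightarrow> 'a set"

text \<open>Note that \<open>[[x,x],x] = 0\<close> for odd \<open>x\<close> is not imposed.\<close>

locale lie_superalgebra = Module.module type_ring L
  for L :: "('k::{comm_ring,monoid_mult}, 'a) lie_salg" (structure) +
  assumes graded: "z2_graded L (part L)"
    and bracket_closed: "\<lbrakk>x \<in> carrier L; y \<in> carrier L\<rbrakk> \<Longrightarrow> bracket L x y \<in> carrier L"
    and bracket_add_left: "\<lbrakk>x \<in> carrier L; y \<in> carrier L; z \<in> carrier L\<rbrakk> \<Longrightarrow>
      bracket L (x \<oplus> y) z = bracket L x z \<oplus> bracket L y z"
    and bracket_add_right: "\<lbrakk>x \<in> carrier L; y \<in> carrier L; z \<in> carrier L\<rbrakk> \<Longrightarrow>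
      bracket L x (y \<oplus> z) = bracket L x y \<oplus> bracket L x z"
    and bracket_smult_left: "\<lbrakk>x \<in> carrier L; y \<in> carrier L\<rbrakk> \<Longrightarrow>
      bracket L (c \<odot> x) y = c \<odot> bracket L x y"
    and bracket_smult_right: "\<lbrakk>x \<in> carrier L; y \<in> carrier L\<rbrakk> \<Longrightarrow>
      bracket L x (c \<odot> y) = c \<odot> bracket L x y"
    and bracket_even: "\<lbrakk>x \<in> part L p; y \<in> part L q\<rbrakk> \<Longrightarrow> bracket L x y \<in> part L (p + q)"
    and super_skew: "\<lbrakk>x \<in> part L p; y \<in> part L q\<rbrakk> \<Longrightarrow>
      bracket L x y = \<ominus> msg L (p * q) (bracket L y x)"
    and super_jacobi: "\<lbrakk>x \<in> part L p; y \<in> part L q; z \<in> part L r\<rbrakk> \<Longrightarrow>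
      msg L (p * r) (bracket L (bracket L x y) z) \<oplus>
      msg L (q * p) (bracket L (bracket L y z) x) \<oplus>
      msg L (r * q) (bracket L (bracket L z x) y) = \<zero>"

definition lie_hom ::
    "('k::{comm_ring,monoid_mult}, 'a) lie_salg \<Rightarrow> ('k, 'b) lie_salg \<Rightarrow> ('a \<Rightarrow> 'b) set"
  where "lie_hom L M = {\<phi> \<in> carrier L \<rightarrow> carrier M.
    (\<forall>x\<in>carrier L. \<forall>y\<in>carrier L. \<phi> (x \<oplus>\<^bsub>L\<^esub> y) = \<phi> x \<oplus>\<^bsub>M\<^esub> \<phi> y) \<and>
    (\<forall>c. \<forall>x\<in>carrier L. \<phi> (c \<odot>\<^bsub>L\<^esub> x) = c \<odot>\<^bsub>M\<^esub> \<phi> x) \<and>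
    (\<forall>x\<in>carrier L. \<forall>y\<in>carrier L. \<phi> (bracket L x y) = bracket M (\<phi> x) (\<phi> y)) \<and>
    (\<forall>p. \<forall>x\<in>part L p. \<phi> x \<in> part M p)}"

definition lie_center :: "('k::{comm_ring,monoid_mult}, 'a) lie_salg \<Rightarrow> 'a set"
  where "lie_center L = {z \<in> carrier L. \<forall>x\<in>carrier L. bracket L z x = \<zero>\<^bsub>L\<^esub>}"

definition central_extension ::
    "('k::{comm_ring,monoid_mult}, 'a) lie_salg \<Rightarrow> ('k, 'b) lie_salg \<Rightarrow> ('a \<Rightarrow> 'b) \<Rightarrow> bool"
  where "central_extension E L \<phi> \<longleftrightarrow>
    lie_superalgebra E \<and> lie_superalgebra L \<and> \<phi> \<in> lie_hom E L \<and>
    \<phi> ` carrier E = carrier L \<and>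
    {x \<in> carrier E. \<phi> x = \<zero>\<^bsub>L\<^esub>} \<subseteq> lie_center E"

text \<open>
  The competing central extensions range over all Lie superalgebras on subsets of a type \<open>'e\<close>;
  a theorem stated with a free type variable in place of \<open>'e\<close> covers all of them.  Maps are
  compared on carriers only, hence \<open>extensional\<close>.
\<close>

definition universal_central_extension ::
    "'e itself \<Rightarrow> ('k::{comm_ring,monoid_mult}, 'a) lie_salg \<Rightarrow> ('k, 'b) lie_salg \<Rightarrow>
     ('a \<Rightarrow> 'b) \<Rightarrow> bool"
  where "universal_central_extension _ G L \<psi> \<longleftrightarrow>
    central_extension G L \<psi> \<and>
    (\<forall>(E :: ('k, 'e) lie_salg) \<phi>. central_extension E L \<phi> \<longrightarrow>
      (\<exists>!\<phi>'. \<phi>' \<in> lie_hom G E \<and> \<phi>' \<in> extensional (carrier G) \<and>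
             (\<forall>x\<in>carrier G. \<phi> (\<phi>' x) = \<psi> x)))"


section \<open>Lie superalgebras given by generators and relations\<close>

datatype ('k, 'g) lie_term =
    Gen 'g
  | Zero
  | Add "('k, 'g) lie_term" "('k, 'g) lie_term"
  | Scale 'k "('k, 'g) lie_term"
  | Brk "('k, 'g) lie_term" "('k, 'g) lie_term"

definition tsg :: "bit \<Rightarrow> ('k::{comm_ring,monoid_mult}, 'g) lie_term \<Rightarrow> ('k, 'g) lie_term"
  where "tsg p t = (if p = 1 then Scale (- 1) t else t)"

text \<open>\<open>D p\<close> is the set of generators that are homogeneous of degree \<open>p\<close>.\<close>

inductive lie_deg :: "(bit \<Rightarrow> 'g set) \<Rightarrow> bit \<Rightarrow> ('k, 'g) lie_term \<Rightarrow> bool"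
  for D :: "bit \<Rightarrow> 'g set"
  where
    "g \<in> D p \<Longrightarrow> lie_deg D p (Gen g)"
  | "lie_deg D p Zero"
  | "\<lbrakk>lie_deg D p s; lie_deg D p t\<rbrakk> \<Longrightarrow> lie_deg D p (Add s t)"
  | "lie_deg D p t \<Longrightarrow> lie_deg D p (Scale c t)"
  | "\<lbrakk>lie_deg D p s; lie_deg D q t\<rbrakk> \<Longrightarrow> lie_deg D (p + q) (Brk s t)"

text \<open>
  The least congruence on terms that contains the relations \<open>Q\<close> and enforces the axioms of a
  Lie superalgebra.
\<close>

inductive lie_cong ::
    "(bit \<Rightarrow> 'g set) \<Rightarrow>
     (('k::{comm_ring,monoid_mult}, 'g) lie_term \<Rightarrow> ('k, 'g) lie_term \<Rightarrow> bool) \<Rightarrow>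
     ('k, 'g) lie_term \<Rightarrow> ('k, 'g) lie_term \<Rightarrow> bool"
  for D Q
  where
    rel: "Q s t \<Longrightarrow> lie_cong D Q s t"
  | refl: "lie_cong D Q t t"
  | sym: "lie_cong D Q s t \<Longrightarrow> lie_cong D Q t s"
  | trans: "\<lbrakk>lie_cong D Q s t; lie_cong D Q t u\<rbrakk> \<Longrightarrow> lie_cong D Q s u"
  | cong_Add: "\<lbrakk>lie_cong D Q s s'; lie_cong D Q t t'\<rbrakk> \<Longrightarrow> lie_cong D Q (Add s t) (Add s' t')"
  | cong_Scale: "lie_cong D Q t t' \<Longrightarrow> lie_cong D Q (Scale c t) (Scale c t')"
  | cong_Brk: "\<lbrakk>lie_cong D Q s s'; lie_cong D Q t t'\<rbrakk> \<Longrightarrow> lie_cong D Q (Brk s t) (Brk s' t')"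
  | add_assoc: "lie_cong D Q (Add (Add s t) u) (Add s (Add t u))"
  | add_comm: "lie_cong D Q (Add s t) (Add t s)"
  | add_zero: "lie_cong D Q (Add Zero t) t"
  | add_neg: "lie_cong D Q (Add t (Scale (- 1) t)) Zero"
  | scale_one: "lie_cong D Q (Scale 1 t) t"
  | scale_mult: "lie_cong D Q (Scale (c * d) t) (Scale c (Scale d t))"
  | scale_add_left: "lie_cong D Q (Scale (c + d) t) (Add (Scale c t) (Scale d t))"
  | scale_add_right: "lie_cong D Q (Scale c (Add s t)) (Add (Scale c s) (Scale c t))"
  | brk_add_left: "lie_cong D Q (Brk (Add s t) u) (Add (Brk s u) (Brk t u))"
  | brk_add_right: "lie_cong D Q (Brk s (Add t u)) (Add (Brk s t) (Brk s u))"
  | brk_scale_left: "lie_cong D Q (Brk (Scale c s) t) (Scale c (Brk s t))"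
  | brk_scale_right: "lie_cong D Q (Brk s (Scale c t)) (Scale c (Brk s t))"
  | skew: "\<lbrakk>lie_deg D p s; lie_deg D q t\<rbrakk> \<Longrightarrow>
      lie_cong D Q (Brk s t) (Scale (- 1) (tsg (p * q) (Brk t s)))"
  | jacobi: "\<lbrakk>lie_deg D p s; lie_deg D q t; lie_deg D r u\<rbrakk> \<Longrightarrow>
      lie_cong D Q
        (Add (Add (tsg (p * r) (Brk (Brk s t) u))
                  (tsg (q * p) (Brk (Brk t u) s)))
             (tsg (r * q) (Brk (Brk u s) t)))
        Zero"

definition lie_cls ::
    "(bit \<Rightarrow> 'g set) \<Rightarrow>
     (('k::{comm_ring,monoid_mult}, 'g) lie_term \<Rightarrow> ('k, 'g) lie_term \<Rightarrow> bool) \<Rightarrow>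
     ('k, 'g) lie_term \<Rightarrow> ('k, 'g) lie_term set"
  where "lie_cls D Q t = {s. lie_cong D Q t s}"

definition presented_lie_salg ::
    "(bit \<Rightarrow> 'g set) \<Rightarrow>
     (('k::{comm_ring,monoid_mult}, 'g) lie_term \<Rightarrow> ('k, 'g) lie_term \<Rightarrow> bool) \<Rightarrow>
     ('k, ('k, 'g) lie_term set) lie_salg"
  where "presented_lie_salg D Q =
    \<lparr>carrier = range (lie_cls D Q), monoid.mult = undefined, one = undefined,
     ring.zero = lie_cls D Q Zero,
     add = (\<lambda>A B. \<Union>s\<in>A. \<Union>t\<in>B. lie_cls D Q (Add s t)),
     smult = (\<lambda>c A. \<Union>s\<in>A. lie_cls D Q (Scale c s)),
     bracket = (\<lambda>A B. \<Union>s\<in>A. \<Union>t\<in>B. lie_cls D Q (Brk s t)),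
     part = (\<lambda>p. {lie_cls D Q t | t. lie_deg D p t})\<rparr>"


section \<open>Superalgebras with superinvolution\<close>

definition alg_module ::
    "('k::{comm_ring,monoid_mult} \<Rightarrow> 'r::{ring,monoid_mult} \<Rightarrow> 'r) \<Rightarrow> ('k, 'r) module"
  where "alg_module scl =
    \<lparr>carrier = UNIV, monoid.mult = (*), one = 1, ring.zero = 0, add = (+), smult = scl\<rparr>"

text \<open>
  \<open>scl\<close> is the scalar multiplication of \<open>R\<close>, \<open>H p\<close> the homogeneous part of degree \<open>p\<close>.
\<close>

locale superinvolution =
  fixes scl :: "'k::{comm_ring,monoid_mult} \<Rightarrow> 'r::{ring,monoid_mult} \<Rightarrow> 'r"
    and H :: "bit \<Rightarrow> 'r set"
    and bar :: "'r \<Rightarrow> 'r"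
  assumes alg_module: "Module.module type_ring (alg_module scl)"
    and scl_mult_left: "scl c a * b = scl c (a * b)"
    and scl_mult_right: "a * scl c b = scl c (a * b)"
    and graded: "z2_graded (alg_module scl) H"
    and mult_deg: "\<lbrakk>a \<in> H p; b \<in> H q\<rbrakk> \<Longrightarrow> a * b \<in> H (p + q)"
    and bar_add: "bar (a + b) = bar a + bar b"
    and bar_scl: "bar (scl c a) = scl c (bar a)"
    and bar_deg: "a \<in> H p \<Longrightarrow> bar a \<in> H p"
    and bar_mult: "\<lbrakk>a \<in> H p; b \<in> H q\<rbrakk> \<Longrightarrow> bar (a * b) = sg (p * q) (bar b * bar a)"
    and bar_bar: "bar (bar a) = a"
begin

definition hcomp :: "bit \<Rightarrow> 'r \<Rightarrow> 'r"
  where "hcomp p a = (THE b. b \<in> H p \<and> a - b \<in> H (p + 1))"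

definition rho :: "'r \<Rightarrow> 'r"
  where "rho a = hcomp 0 a - hcomp 1 a"

text \<open>\<open>tr a\<close> is \<open>a\<^sub>+\<close>.\<close>

definition tr :: "'r \<Rightarrow> 'r"
  where "tr a = a + bar a"


subsection \<open>The matrix Lie superalgebra\<close>

definition idx_deg :: "3 \<Rightarrow> bit"
  where "idx_deg i = (if i = 1 then 0 else 1)"

definition mat_part :: "bit \<Rightarrow> ('r^3^3) set"
  where "mat_part p = {X. \<forall>i j. X $ i $ j \<in> H (p + idx_deg i + idx_deg j)}"

definition mat_hcomp :: "bit \<Rightarrow> 'r^3^3 \<Rightarrow> 'r^3^3"
  where "mat_hcomp p X = (\<chi> i j. hcomp (p + idx_deg i + idx_deg j) (X $ i $ j))"

text \<open>The usual matrix product; the library's \<open>**\<close> would require \<open>0 \<noteq> 1\<close> in the entries.\<close>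

definition mat_mult :: "'r^3^3 \<Rightarrow> 'r^3^3 \<Rightarrow> 'r^3^3"
  where "mat_mult X Y = (\<chi> i j. \<Sum>k\<in>UNIV. X $ i $ k * Y $ k $ j)"

definition mat_bracket :: "'r^3^3 \<Rightarrow> 'r^3^3 \<Rightarrow> 'r^3^3"
  where "mat_bracket X Y = (\<Sum>p\<in>{0, 1}. \<Sum>q\<in>{0, 1}.
    mat_mult (mat_hcomp p X) (mat_hcomp q Y) - sg (p * q) (mat_mult (mat_hcomp q Y) (mat_hcomp p X)))"

definition mat_lie :: "('k, 'r^3^3) lie_salg"
  where "mat_lie =
    \<lparr>carrier = UNIV, monoid.mult = undefined, one = undefined, ring.zero = 0, add = (+),
     smult = (\<lambda>c X. \<chi> i j. scl c (X $ i $ j)), bracket = mat_bracket, part = mat_part\<rparr>"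

definition osp_inv :: "'r^3^3 \<Rightarrow> 'r^3^3"
  where "osp_inv X = vector [
    vector [bar (X$1$1), - bar (rho (X$3$1)), bar (rho (X$2$1))],
    vector [bar (rho (X$1$3)), bar (X$3$3), - bar (X$2$3)],
    vector [- bar (rho (X$1$2)), - bar (X$3$2), bar (X$2$2)]]"

definition osp_skew :: "('r^3^3) set"
  where "osp_skew = {X. osp_inv X = - X}"

definition osp :: "('k, 'r^3^3) lie_salg"
  where "osp = (let D = lin_span mat_lie {mat_bracket X Y | X Y. X \<in> osp_skew \<and> Y \<in> osp_skew}
    in mat_lie\<lparr>carrier := D, part := (\<lambda>p. mat_part p \<inter> D)\<rparr>)"

definition mat_unit :: "3 \<Rightarrow> 3 \<Rightarrow> 'r \<Rightarrow> 'r^3^3"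
  where "mat_unit i j a = (\<chi> k l. if k = i \<and> l = j then a else 0)"

definition osp_v :: "'r \<Rightarrow> 'r^3^3"
  where "osp_v a = mat_unit 2 3 (tr a)"

definition osp_w :: "'r \<Rightarrow> 'r^3^3"
  where "osp_w a = mat_unit 3 2 (tr a)"

definition osp_f :: "'r \<Rightarrow> 'r^3^3"
  where "osp_f a = mat_unit 1 2 a + mat_unit 3 1 (rho (bar a))"

definition osp_g :: "'r \<Rightarrow> 'r^3^3"
  where "osp_g a = mat_unit 2 1 a - mat_unit 1 3 (rho (bar a))"

end


subsection \<open>The Lie superalgebra given by generators and relations\<close>

text \<open>
  There is a symbol for every \<open>a \<in> R\<close>, homogeneous or not; by the linearity relations the
  symbols of homogeneous elements generate.
\<close>

datatype 'r osp_gen = GV 'r | GW 'r | GF 'r | GG 'r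

context superinvolution
begin

definition gen_part :: "bit \<Rightarrow> 'r osp_gen set"
  where "gen_part p = GV ` H p \<union> GW ` H p \<union> GF ` H (1 + p) \<union> GG ` H (1 + p)"

abbreviation tv :: "'r \<Rightarrow> ('k, 'r osp_gen) lie_term" where "tv a \<equiv> Gen (GV a)"
abbreviation tw :: "'r \<Rightarrow> ('k, 'r osp_gen) lie_term" where "tw a \<equiv> Gen (GW a)"
abbreviation tf :: "'r \<Rightarrow> ('k, 'r osp_gen) lie_term" where "tf a \<equiv> Gen (GF a)"
abbreviation tg :: "'r \<Rightarrow> ('k, 'r osp_gen) lie_term" where "tg a \<equiv> Gen (GG a)"

inductive osp_rel :: "('k, 'r osp_gen) lie_term \<Rightarrow> ('k, 'r osp_gen) lie_term \<Rightarrow> bool"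
  where
    gen_add: "X \<in> {GV, GW, GF, GG} \<Longrightarrow> osp_rel (Gen (X (a + b))) (Add (Gen (X a)) (Gen (X b)))"
  | gen_scale: "X \<in> {GV, GW, GF, GG} \<Longrightarrow> osp_rel (Gen (X (scl c a))) (Scale c (Gen (X a)))"
  | v_bar: "osp_rel (tv (bar a)) (tv a)"
  | w_bar: "osp_rel (tw (bar a)) (tw a)"
  | vv: "osp_rel (Brk (tv a) (tv b)) Zero"
  | ww: "osp_rel (Brk (tw a) (tw b)) Zero"
  | vg: "osp_rel (Brk (tv a) (tg b)) Zero"
  | fw: "osp_rel (Brk (tf a) (tw b)) Zero"
  | vf: "\<lbrakk>a \<in> H p; b \<in> H q\<rbrakk> \<Longrightarrow>
      osp_rel (Brk (tv a) (tf b)) (tg (sg q (tr a * bar b)))"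
  | gw: "\<lbrakk>a \<in> H p; b \<in> H q\<rbrakk> \<Longrightarrow>
      osp_rel (Brk (tg a) (tw b)) (tf (- sg p (bar a * tr b)))"
  | ff: "\<lbrakk>a \<in> H p; b \<in> H q\<rbrakk> \<Longrightarrow>
      osp_rel (Brk (tf a) (tf b)) (tw (sg p (bar a * b)))"
  | gg: "\<lbrakk>a \<in> H p; b \<in> H q\<rbrakk> \<Longrightarrow>
      osp_rel (Brk (tg a) (tg b)) (tv (- sg q (a * bar b)))"
  | fgf: "\<lbrakk>a \<in> H p; b \<in> H q; c \<in> H r\<rbrakk> \<Longrightarrow>
      osp_rel (Brk (Brk (tf a) (tg b)) (tf c))
        (tf (a * b * c - bar (a * b) * c - sg (p * q + q * r + r * p) (c * b * a)))"
  | gfg: "\<lbrakk>a \<in> H p; b \<in> H q; c \<in> H r\<rbrakk> \<Longrightarrow>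
      osp_rel (Brk (tg a) (Brk (tf b) (tg c)))
        (tg (a * b * c - a * bar (b * c) - sg (p * q + q * r + r * p) (c * b * a)))"

definition hat_osp :: "('k, ('k, 'r osp_gen) lie_term set) lie_salg"
  where "hat_osp = presented_lie_salg gen_part osp_rel"

definition hat_v :: "'r \<Rightarrow> ('k, 'r osp_gen) lie_term set"
  where "hat_v a = lie_cls gen_part osp_rel (tv a)"

definition hat_w :: "'r \<Rightarrow> ('k, 'r osp_gen) lie_term set"
  where "hat_w a = lie_cls gen_part osp_rel (tw a)"

definition hat_f :: "'r \<Rightarrow> ('k, 'r osp_gen) lie_term set"
  where "hat_f a = lie_cls gen_part osp_rel (tf a)"

definition hat_g :: "'r \<Rightarrow> ('k, 'r osp_gen) lie_term set"
  where "hat_g a = lie_cls gen_part osp_rel (tg a)"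

definition hat_h :: "'r \<Rightarrow> 'r \<Rightarrow> ('k, 'r osp_gen) lie_term set"
  where "hat_h a b = bracket hat_osp (hat_f a) (hat_g b)"

text \<open>
  The homomorphism below is determined on the carrier of \<open>hat_osp\<close>, since the symbols generate;
  its values elsewhere are irrelevant.
\<close>

definition psi :: "('k, 'r osp_gen) lie_term set \<Rightarrow> 'r^3^3"
  where "psi = (SOME \<psi>. \<psi> \<in> lie_hom hat_osp osp \<and>
    (\<forall>a. \<psi> (hat_v a) = osp_v a \<and> \<psi> (hat_w a) = osp_w a \<and>
         \<psi> (hat_f a) = osp_f a \<and> \<psi> (hat_g a) = osp_g a))"


subsection \<open>The universal central extension\<close>

inductive_set I3_gens :: "'r set"
  where
    three: "a \<in> H p \<Longrightarrow> a + a + a \<in> I3_gens"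
  | bar: "a \<in> H p \<Longrightarrow> a - bar a \<in> I3_gens"
  | comm: "\<lbrakk>a \<in> H p; b \<in> H q; c \<in> H r; d = a * b - sg (p * q) (b * a)\<rbrakk> \<Longrightarrow>
      (d - bar d) * c \<in> I3_gens"
  | tr_comm: "\<lbrakk>a \<in> H p; b \<in> H q; c \<in> H r\<rbrakk> \<Longrightarrow>
      tr a * tr b * c - sg (p * q) (tr b * tr a * c) \<in> I3_gens"
  | cyclic: "\<lbrakk>a \<in> H p; b \<in> H q; c \<in> H r\<rbrakk> \<Longrightarrow>
      sg (p * r) (a * bar b * c + bar a * b * bar c) +
      sg (q * p) (b * bar c * a + bar b * c * bar a) +
      sg (r * q) (c * bar a * b + bar c * a * bar b) \<in> I3_gens"

definition I3 :: "'r set"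
  where "I3 = lin_span (alg_module scl) I3_gens"

definition R_mod_I3 :: "('k, 'r set) module"
  where "R_mod_I3 = quot_module (alg_module scl) I3"

definition z_module :: "('k, 'r set \<times> 'r set) module"
  where "z_module =
    \<lparr>carrier = carrier R_mod_I3 \<times> carrier R_mod_I3, monoid.mult = undefined, one = undefined,
     ring.zero = (\<zero>\<^bsub>R_mod_I3\<^esub>, \<zero>\<^bsub>R_mod_I3\<^esub>),
     add = (\<lambda>(A, B) (A', B'). (A \<oplus>\<^bsub>R_mod_I3\<^esub> A', B \<oplus>\<^bsub>R_mod_I3\<^esub> B')),
     smult = (\<lambda>c (A, B). (c \<odot>\<^bsub>R_mod_I3\<^esub> A, c \<odot>\<^bsub>R_mod_I3\<^esub> B))\<rparr>"

definition pi1 :: "'r \<Rightarrow> 'r set \<times> 'r set"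
  where "pi1 a = (I3 +>\<^bsub>alg_module scl\<^esub> a, \<zero>\<^bsub>R_mod_I3\<^esub>)"

definition pi2 :: "'r \<Rightarrow> 'r set \<times> 'r set"
  where "pi2 a = (\<zero>\<^bsub>R_mod_I3\<^esub>, I3 +>\<^bsub>alg_module scl\<^esub> a)"

definition z_part :: "bit \<Rightarrow> ('r set \<times> 'r set) set"
  where "z_part p = {pi1 a \<oplus>\<^bsub>z_module\<^esub> pi2 b | a b. a \<in> H (1 + p) \<and> b \<in> H (1 + p)}"

end

datatype kind = KH | KV | KW | KF | KG

context superinvolution
begin

text \<open>The spanning set of \<open>hat_osp\<close>, sorted by the kind of its elements.\<close>

fun spanning :: "kind \<Rightarrow> ('k, 'r osp_gen) lie_term set set"
  where
    "spanning KH = {hat_h a b | a b p q. a \<in> H p \<and> b \<in> H q}"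
  | "spanning KV = {hat_v a | a p. a \<in> H p}"
  | "spanning KW = {hat_w a | a p. a \<in> H p}"
  | "spanning KF = {hat_f a | a p. a \<in> H p}"
  | "spanning KG = {hat_g a | a p. a \<in> H p}"

text \<open>
  A bilinear map with these values is unique on the carrier of \<open>hat_osp\<close>.  Neither its
  existence nor the cocycle identities are built into the definition.
\<close>

definition is_beta ::
    "(('k, 'r osp_gen) lie_term set \<Rightarrow> ('k, 'r osp_gen) lie_term set \<Rightarrow> 'r set \<times> 'r set) \<Rightarrow> bool"
  where "is_beta \<beta> \<longleftrightarrow>
    (\<forall>x\<in>carrier hat_osp. \<forall>y\<in>carrier hat_osp. \<beta> x y \<in> carrier z_module) \<and>
    (\<forall>x\<in>carrier hat_osp. \<forall>y\<in>carrier hat_osp. \<forall>z\<in>carrier hat_osp.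
       \<beta> (x \<oplus>\<^bsub>hat_osp\<^esub> y) z = \<beta> x z \<oplus>\<^bsub>z_module\<^esub> \<beta> y z \<and>
       \<beta> z (x \<oplus>\<^bsub>hat_osp\<^esub> y) = \<beta> z x \<oplus>\<^bsub>z_module\<^esub> \<beta> z y) \<and>
    (\<forall>c. \<forall>x\<in>carrier hat_osp. \<forall>y\<in>carrier hat_osp.
       \<beta> (c \<odot>\<^bsub>hat_osp\<^esub> x) y = c \<odot>\<^bsub>z_module\<^esub> \<beta> x y \<and>
       \<beta> x (c \<odot>\<^bsub>hat_osp\<^esub> y) = c \<odot>\<^bsub>z_module\<^esub> \<beta> x y) \<and>
    (\<forall>p q. \<forall>a\<in>H p. \<forall>b\<in>H q.
       \<beta> (hat_v a) (hat_g b) = pi1 (tr a * b) \<and>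
       \<beta> (hat_g b) (hat_v a) = \<ominus>\<^bsub>z_module\<^esub> msg z_module (p * (1 + q)) (pi1 (tr a * b)) \<and>
       \<beta> (hat_f a) (hat_w b) = pi2 (a * tr b) \<and>
       \<beta> (hat_w b) (hat_f a) = \<ominus>\<^bsub>z_module\<^esub> msg z_module ((1 + p) * q) (pi2 (a * tr b))) \<and>
    (\<forall>i j. (i, j) \<notin> {(KV, KG), (KG, KV), (KF, KW), (KW, KF)} \<longrightarrow>
       (\<forall>x\<in>spanning i. \<forall>y\<in>spanning j. \<beta> x y = \<zero>\<^bsub>z_module\<^esub>))"

definition beta ::
    "('k, 'r osp_gen) lie_term set \<Rightarrow> ('k, 'r osp_gen) lie_term set \<Rightarrow> 'r set \<times> 'r set"
  where "beta = (SOME \<beta>. is_beta \<beta>)"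

definition uosp :: "('k, ('k, 'r osp_gen) lie_term set \<times> ('r set \<times> 'r set)) lie_salg"
  where "uosp =
    \<lparr>carrier = carrier hat_osp \<times> carrier z_module, monoid.mult = undefined, one = undefined,
     ring.zero = (\<zero>\<^bsub>hat_osp\<^esub>, \<zero>\<^bsub>z_module\<^esub>),
     add = (\<lambda>(x, c) (y, d). (x \<oplus>\<^bsub>hat_osp\<^esub> y, c \<oplus>\<^bsub>z_module\<^esub> d)),
     smult = (\<lambda>k (x, c). (k \<odot>\<^bsub>hat_osp\<^esub> x, k \<odot>\<^bsub>z_module\<^esub> c)),
     bracket = (\<lambda>(x, c) (y, d). (bracket hat_osp x y, beta x y)),
     part = (\<lambda>p. part hat_osp p \<times> z_part p)\<rparr>"

definition psi' :: "('k, 'r osp_gen) lie_term set \<times> ('r set \<times> 'r set) \<Rightarrow>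
    ('k, 'r osp_gen) lie_term set"
  where "psi' = fst"

end

end

theory Submission
  imports Defs
begin

text \<open>
  The cocycle \<open>beta\<close> only depends on the matrices \<open>psi x\<close> and \<open>psi y\<close>, and can be computed on any central
  extension \<open>E\<close> of \<open>osp\<close>.  Let \<open>hh\<close> be an even lift of \<open>[f(1), g(1)]\<close> to \<open>E\<close>.  For \<open>v, w, f, g\<close> the operator
  \<open>ad hh\<close> has the invertible eigenvalues \<open>2, -2, -1, 1\<close>, so these elements have unique lifts to eigenvectors,
  and every defining relation of \<open>hat_osp\<close> whose weight is invertible automatically holds for the lifts.
  Only \<open>[v,g]\<close> and \<open>[f,w]\<close>, of weight \<open>\<plusminus>3\<close>, may fail; their central values define linear maps on the coordinate
  algebra which vanish on \<open>I3\<close> by the Jacobi identity.  After subtracting the corresponding pullback of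
  \<open>beta\<close> from the bracket of \<open>E\<close> all relations hold, so \<open>hat_osp\<close> maps to the modified algebra, and this lifts
  to a homomorphism from \<open>uosp\<close> to \<open>E\<close>.  It is unique because \<open>uosp\<close> is perfect.
\<close>

text \<open>The weights 1, 2 and 4 are units because 2 is one; 3 need not be. This is where
  \<open>three\<close> in \<open>I3_gens\<close> comes from, and if 3 is a unit then
  \<open>I3\<close> is everything and \<open>z_module\<close> vanishes. A homomorphism out of
  \<open>uosp\<close> cannot be prescribed directly, since only \<open>hat_osp\<close> has a
  presentation; hence the correction is made to the bracket of the target. The choice of
  \<open>I3\<close> is tested from two sides: \<open>chi_I3\<close> shows that it is not too large
  for any extension, \<open>raw1_cocycle\<close> that it is large enough for the cocycle identity.
  The second uses that the matrices come from the derived algebra: the supertrace of a bracket is a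
  sum of supercommutators, which ties the entry (1,1) to the entry (2,2) modulo \<open>T\<close>. As
  \<open>hat_osp\<close> consists of terms modulo a congruence, three facts about it need arguments
  of their own: its grading (a sign automorphism), its spanning set (stability of the span under
  brackets), and the centrality of the kernel of \<open>psi\<close> (comparison with
  matrices).\<close>

declare add_bit_eq_xor [simp del] mult_bit_eq_and [simp del]

section \<open>Modules over the ring of scalars\<close>

lemma bit_add_self [simp]: "p + p = (0::bit)" "p + (p + q) = (q::bit)"
  by (cases p; simp; cases q; simp)+

lemma bit_mult_self [simp]: "p * p = (p::bit)"
  by (cases p) simp_all

lemma cring_type_ring: "cring (type_ring :: 'k::{comm_ring,monoid_mult} ring)"
  unfolding type_ring_def
  by unfold_locales
    (auto simp: algebra_simps Units_def intro: exI[of _ "- x" for x] right_minus left_minus)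

lemma carrier_type_ring [simp]: "carrier type_ring = UNIV"
  by (simp add: type_ring_def)

text \<open>Restates the module laws with the type class operations on scalars in place of the
  fields of \<open>type_ring\<close>.\<close>

locale kmodule = Module.module type_ring M
  for M :: "('k::{comm_ring,monoid_mult}, 'a, 'm) module_scheme" (structure)
begin

lemma smult_in [simp, intro]: "x \<in> carrier M \<Longrightarrow> c \<odot> x \<in> carrier M"
  by (rule smult_closed) auto

lemma smult_add_l: "x \<in> carrier M \<Longrightarrow> (c + d) \<odot> x = c \<odot> x \<oplus> d \<odot> x"
  using smult_l_distr[of c d x] by (simp add: type_ring_def)

lemma smult_add_r:
  "\<lbrakk>x \<in> carrier M; y \<in> carrier M\<rbrakk> \<Longrightarrow> c \<odot> (x \<oplus> y) = c \<odot> x \<oplus> c \<odot> y"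
  using smult_r_distr[of c x y] by (simp add: type_ring_def)

lemma smult_mult: "x \<in> carrier M \<Longrightarrow> (c * d) \<odot> x = c \<odot> (d \<odot> x)"
  using smult_assoc1[of c d x] by (simp add: type_ring_def)

lemma smult_1 [simp]: "x \<in> carrier M \<Longrightarrow> 1 \<odot> x = x"
  using smult_one[of x] by (simp add: type_ring_def)

lemma smult_0 [simp]: "x \<in> carrier M \<Longrightarrow> 0 \<odot> x = \<zero>"
  using smult_l_null[of x] by (simp add: type_ring_def)

lemma smult_zero [simp]: "c \<odot> \<zero> = \<zero>"
  by (rule smult_r_null) simp

lemma smult_uminus: "x \<in> carrier M \<Longrightarrow> (- c) \<odot> x = \<ominus> (c \<odot> x)"
  using smult_add_l[of x "- c" c] by (intro M.minus_equality[symmetric]) auto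

lemma smult_minus1: "x \<in> carrier M \<Longrightarrow> (- 1) \<odot> x = \<ominus> x"
  by (simp add: smult_uminus)

lemma smult_neg: "x \<in> carrier M \<Longrightarrow> c \<odot> (\<ominus> x) = \<ominus> (c \<odot> x)"
  by (rule smult_r_minus) auto

text \<open>Scalars may have zero divisors, so cancellation goes through an explicit inverse
  \<open>u\<close>. It is applied to 2 and to the weights of \<open>ad hh\<close>.\<close>

lemma unit_smult_cancel:
  "\<lbrakk>u * c = 1; x \<in> carrier M; c \<odot> x = \<zero>\<rbrakk> \<Longrightarrow> x = \<zero>"
  by (metis smult_mult smult_1 smult_zero)

lemma msg_closed [simp, intro]: "x \<in> carrier M \<Longrightarrow> msg M p x \<in> carrier M"
  by (simp add: msg_def)

lemma msg_zero [simp]: "msg M p \<zero> = \<zero>"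
  by (simp add: msg_def)

lemma msg_smult: "x \<in> carrier M \<Longrightarrow> msg M p x = sg p 1 \<odot> x"
  by (simp add: msg_def sg_def smult_minus1)

lemma msg_add:
  "\<lbrakk>x \<in> carrier M; y \<in> carrier M\<rbrakk> \<Longrightarrow> msg M p (x \<oplus> y) = msg M p x \<oplus> msg M p y"
  by (simp add: msg_def M.minus_add)

lemma msg_neg: "x \<in> carrier M \<Longrightarrow> msg M p (\<ominus> x) = \<ominus> msg M p x"
  by (simp add: msg_def)

lemma msg_msg: "x \<in> carrier M \<Longrightarrow> msg M p (msg M q x) = msg M (p + q) x"
  by (cases p; cases q) (simp_all add: msg_def)

lemma msg_eq_zero: "x \<in> carrier M \<Longrightarrow> msg M p x = \<zero> \<longleftrightarrow> x = \<zero>"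
  by (simp add: msg_def) 

lemma lin_span_submodule:
  assumes "S \<subseteq> carrier M" shows "submodule (lin_span M S) type_ring M"
proof (rule submoduleI)
  have car: "submodule (carrier M) type_ring M" by (rule carrier_is_submodule)
  show "lin_span M S \<subseteq> carrier M" using assms car by (auto simp: lin_span_def)
  show "\<zero> \<in> lin_span M S"
    by (auto simp: lin_span_def) (metis submoduleE(2,3,5) M.r_neg submoduleE(1) ex_in_conv subsetD)
qed (auto simp: lin_span_def submoduleE)

lemma lin_span_incl: "x \<in> S \<Longrightarrow> x \<in> lin_span M S"
  by (auto simp: lin_span_def)

lemma lin_span_least: "\<lbrakk>submodule N type_ring M; S \<subseteq> N\<rbrakk> \<Longrightarrow> lin_span M S \<subseteq> N"
  by (auto simp: lin_span_def)

lemma submodule_zero: "submodule N type_ring M \<Longrightarrow> \<zero> \<in> N"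
  by (metis submoduleE(2,3,5) M.r_neg submoduleE(1) ex_in_conv subsetD)

lemma submoduleI':
  assumes "N \<subseteq> carrier M" "\<zero> \<in> N" "\<And>x y. \<lbrakk>x \<in> N; y \<in> N\<rbrakk> \<Longrightarrow> x \<oplus> y \<in> N"
    and sc: "\<And>c x. x \<in> N \<Longrightarrow> c \<odot> x \<in> N"
  shows "submodule N type_ring M"
  using assms(1) sc[of _ "- 1"] assms by (intro submoduleI) (auto simp: smult_minus1 subset_iff)

lemma lin_span_induct [consumes 2, case_names base zero add smult]:
  assumes "x \<in> lin_span M S" "S \<subseteq> carrier M"
    and "\<And>x. x \<in> S \<Longrightarrow> P x" "P \<zero>"
    and "\<And>x y. \<lbrakk>x \<in> carrier M; y \<in> carrier M; P x; P y\<rbrakk> \<Longrightarrow> P (x \<oplus> y)"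
    and "\<And>c x. \<lbrakk>x \<in> carrier M; P x\<rbrakk> \<Longrightarrow> P (c \<odot> x)"
  shows "P x"
proof -
  have "submodule {x \<in> carrier M. P x} type_ring M"
    by (rule submoduleI') (use assms in auto)
  from lin_span_least[OF this, of S] assms(1-3) show ?thesis by blast
qed

lemma graded_sum:
  assumes "z2_graded M P" "x \<in> carrier M"
  obtains x0 x1 where "x0 \<in> P 0" "x1 \<in> P 1" "x = x0 \<oplus> x1"
  using assms unfolding z2_graded_def by (metis mem_Times_iff)

lemma graded_carrier: "z2_graded M P \<Longrightarrow> x \<in> P p \<Longrightarrow> x \<in> carrier M"
  using submoduleE(1) unfolding z2_graded_def by blast

lemma graded_submodule: "z2_graded M P \<Longrightarrow> submodule (P p) type_ring M"
  unfolding z2_graded_def by blast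

lemma graded_inter:
  assumes P: "z2_graded M P" and x: "x \<in> P 0" "x \<in> P 1"
  shows "x = \<zero>"
proof -
  have c: "x \<in> carrier M" by (rule graded_carrier[OF P x(1)])
  then have u: "\<exists>!yz. yz \<in> P 0 \<times> P 1 \<and> x = fst yz \<oplus> snd yz"
    using P unfolding z2_graded_def by blast
  have "\<zero> \<in> P p" for p using submodule_zero[OF graded_submodule[OF P]] .
  then have "(x, \<zero>) \<in> P 0 \<times> P 1 \<and> x = fst (x, \<zero>) \<oplus> snd (x, \<zero>)"
    "(\<zero>, x) \<in> P 0 \<times> P 1 \<and> x = fst (\<zero>, x) \<oplus> snd (\<zero>, x)"
    using x c by auto
  with u have "(x, \<zero>) = (\<zero>, x)" by blast
  then show ?thesis by (rule Pair_inject)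
qed

text \<open>Two decompositions \<open>a + b = c + d\<close> give \<open>a - c = d - b\<close>, an
  element of both parts, so trivial intersection is all that uniqueness requires.\<close>

lemma z2_gradedI:
  assumes sub: "\<And>p. submodule (P p) type_ring M"
    and dec: "\<And>x. x \<in> carrier M \<Longrightarrow> \<exists>x0\<in>P 0. \<exists>x1\<in>P 1. x = x0 \<oplus> x1"
    and dis: "\<And>x. \<lbrakk>x \<in> P 0; x \<in> P 1\<rbrakk> \<Longrightarrow> x = \<zero>"
  shows "z2_graded M P"
  unfolding z2_graded_def
proof (intro conjI allI ballI sub)
  fix x assume x: "x \<in> carrier M"
  obtain a b where ab: "a \<in> P 0" "b \<in> P 1" "x = a \<oplus> b" using dec[OF x] by blast
  have car: "y \<in> P p \<Longrightarrow> y \<in> carrier M" for y p using submoduleE(1)[OF sub] by blast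
  show "\<exists>!yz. yz \<in> P 0 \<times> P 1 \<and> x = fst yz \<oplus> snd yz"
  proof (rule ex1I[of _ "(a, b)"])
    fix yz assume yz: "yz \<in> P 0 \<times> P 1 \<and> x = fst yz \<oplus> snd yz"
    obtain c d where cd: "yz = (c, d)" "c \<in> P 0" "d \<in> P 1" "x = c \<oplus> d" using yz by (cases yz) auto
    have c: "a \<in> carrier M" "b \<in> carrier M" "c \<in> carrier M" "d \<in> carrier M"
      using ab cd car by blast+
    have e: "a \<oplus> b = c \<oplus> d" using ab cd by simp
    have "a \<oplus> \<ominus> c = d \<oplus> \<ominus> b"
    proof -
      have "(a \<oplus> b) \<oplus> (\<ominus> c \<oplus> \<ominus> b) = (c \<oplus> d) \<oplus> (\<ominus> c \<oplus> \<ominus> b)" using e by simp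
      moreover have "(a \<oplus> b) \<oplus> (\<ominus> c \<oplus> \<ominus> b) = (a \<oplus> \<ominus> c) \<oplus> (b \<oplus> \<ominus> b)"
        using c by (simp add: M.a_ac)
      moreover have "(c \<oplus> d) \<oplus> (\<ominus> c \<oplus> \<ominus> b) = (d \<oplus> \<ominus> b) \<oplus> (c \<oplus> \<ominus> c)"
        using c by (simp add: M.a_ac)
      ultimately show ?thesis using c by (simp add: M.r_neg)
    qed
    moreover have "a \<oplus> \<ominus> c \<in> P 0" "d \<oplus> \<ominus> b \<in> P 1"
      using ab cd submoduleE(3,5)[OF sub] by blast+
    ultimately have "a \<oplus> \<ominus> c = \<zero>" "d \<oplus> \<ominus> b = \<zero>" using dis by metis+
    then have "a = c" "d = b" using c by (metis M.minus_equality M.minus_minus M.a_comm M.a_inv_closed)+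
    then show "yz = (a, b)" using cd by simp
  qed (use ab in auto)
qed

end

sublocale lie_superalgebra \<subseteq> kmodule L
  by unfold_locales

lemma (in kmodule) a_eq_iff_diff:
  "\<lbrakk>x \<in> carrier M; y \<in> carrier M\<rbrakk> \<Longrightarrow> x = y \<longleftrightarrow> x \<oplus> \<ominus> y = \<zero>"
  by (metis M.minus_equality M.minus_minus M.a_inv_closed M.r_neg)

text \<open>Additive inverses come from multiplication by \<open>- 1\<close>, so besides closure
  only equations remain, and these can be checked on representatives.\<close>

lemma kmoduleI:
  fixes M :: "('k::{comm_ring,monoid_mult}, 'a, 'm) module_scheme" (structure)
  assumes "\<zero> \<in> carrier M"
    "\<And>x y. \<lbrakk>x \<in> carrier M; y \<in> carrier M\<rbrakk> \<Longrightarrow> x \<oplus> y \<in> carrier M"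
    "\<And>c x. x \<in> carrier M \<Longrightarrow> c \<odot> x \<in> carrier M"
    "\<And>x y z. \<lbrakk>x \<in> carrier M; y \<in> carrier M; z \<in> carrier M\<rbrakk> \<Longrightarrow> (x \<oplus> y) \<oplus> z = x \<oplus> (y \<oplus> z)"
    "\<And>x y. \<lbrakk>x \<in> carrier M; y \<in> carrier M\<rbrakk> \<Longrightarrow> x \<oplus> y = y \<oplus> x"
    "\<And>x. x \<in> carrier M \<Longrightarrow> \<zero> \<oplus> x = x"
    "\<And>x. x \<in> carrier M \<Longrightarrow> x \<oplus> (- 1) \<odot> x = \<zero>"
    "\<And>x. x \<in> carrier M \<Longrightarrow> 1 \<odot> x = x"
    "\<And>c d x. x \<in> carrier M \<Longrightarrow> (c * d) \<odot> x = c \<odot> (d \<odot> x)"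
    "\<And>c d x. x \<in> carrier M \<Longrightarrow> (c + d) \<odot> x = c \<odot> x \<oplus> d \<odot> x"
    "\<And>c x y. \<lbrakk>x \<in> carrier M; y \<in> carrier M\<rbrakk> \<Longrightarrow> c \<odot> (x \<oplus> y) = c \<odot> x \<oplus> c \<odot> y"
  shows "Module.module type_ring M"
proof (rule moduleI)
  show "cring (type_ring :: 'k ring)" by (rule cring_type_ring)
  show "abelian_group M"
  proof (rule abelian_groupI)
    fix x assume "x \<in> carrier M"
    then show "\<exists>y\<in>carrier M. y \<oplus> x = \<zero>" using assms(3,5,7) by metis
  qed (use assms in auto)
qed (use assms in \<open>auto simp: type_ring_def\<close>)

subsection \<open>Lie superalgebras\<close>

context lie_superalgebra
begin

abbreviation br (\<open>\<lbrakk>_,_\<rbrakk>\<close>) where "br x y \<equiv> bracket L x y"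

lemma part_carrier: "x \<in> part L p \<Longrightarrow> x \<in> carrier L"
  by (rule graded_carrier[OF graded])

lemma part_submodule: "submodule (part L p) type_ring L"
  by (rule graded_submodule[OF graded])

lemma part_zero: "\<zero> \<in> part L p"
  and part_add: "\<lbrakk>x \<in> part L p; y \<in> part L p\<rbrakk> \<Longrightarrow> x \<oplus> y \<in> part L p"
  and part_smult: "x \<in> part L p \<Longrightarrow> c \<odot> x \<in> part L p"
  and part_neg: "x \<in> part L p \<Longrightarrow> \<ominus> x \<in> part L p"
  and part_msg: "x \<in> part L p \<Longrightarrow> msg L q x \<in> part L p"
  using submodule_zero[OF part_submodule] submoduleE(3-5)[OF part_submodule]
  by (auto simp: msg_def)

lemma part_sum:
  assumes "x \<in> carrier L"
  obtains x0 x1 where "x0 \<in> part L 0" "x1 \<in> part L 1" "x = x0 \<oplus> x1"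
  using graded_sum[OF graded assms] .

lemma part_inter: "\<lbrakk>x \<in> part L 0; x \<in> part L 1\<rbrakk> \<Longrightarrow> x = \<zero>"
  by (rule graded_inter[OF graded])

lemma homogeneous_induct [consumes 1, case_names homogeneous add]:
  assumes "x \<in> carrier L" "\<And>x p. x \<in> part L p \<Longrightarrow> P x"
    "\<And>x y. \<lbrakk>x \<in> carrier L; y \<in> carrier L; P x; P y\<rbrakk> \<Longrightarrow> P (x \<oplus> y)"
  shows "P x"
proof -
  obtain x0 x1 where "x0 \<in> part L 0" "x1 \<in> part L 1" "x = x0 \<oplus> x1" using part_sum[OF assms(1)] .
  then show ?thesis using assms(2,3) by (simp add: part_carrier)
qed

lemma br_zero [simp]:
  assumes "x \<in> carrier L"
  shows "\<lbrakk>x, \<zero>\<rbrakk> = \<zero>" "\<lbrakk>\<zero>, x\<rbrakk> = \<zero>"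
  using bracket_smult_right[OF assms M.zero_closed, of 0] bracket_smult_left[OF M.zero_closed assms, of 0]
  by (auto simp: bracket_closed assms)

lemma br_neg:
  assumes "x \<in> carrier L" "y \<in> carrier L"
  shows "\<lbrakk>x, \<ominus> y\<rbrakk> = \<ominus> \<lbrakk>x, y\<rbrakk>" "\<lbrakk>\<ominus> x, y\<rbrakk> = \<ominus> \<lbrakk>x, y\<rbrakk>"
  using assms bracket_smult_right[of x y "- 1"] bracket_smult_left[of x y "- 1"]
  by (auto simp: smult_minus1 bracket_closed)

lemma br_msg:
  assumes "x \<in> carrier L" "y \<in> carrier L"
  shows "\<lbrakk>x, msg L p y\<rbrakk> = msg L p \<lbrakk>x, y\<rbrakk>" "\<lbrakk>msg L p x, y\<rbrakk> = msg L p \<lbrakk>x, y\<rbrakk>"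
  using assms br_neg by (auto simp: msg_def)

text \<open>Skew-symmetry moves the outer \<open>x\<close> of the second Jacobi term and the outer
  \<open>y\<close> of the third to the left. The sign with exponent \<open>p * r\<close> is then
  common to all terms and cancels.\<close>

lemma leibniz:
  assumes "x \<in> part L p" "y \<in> part L q" "z \<in> part L r"
  shows "\<lbrakk>x, \<lbrakk>y, z\<rbrakk>\<rbrakk> = \<lbrakk>\<lbrakk>x, y\<rbrakk>, z\<rbrakk> \<oplus> msg L (p * q) \<lbrakk>y, \<lbrakk>x, z\<rbrakk>\<rbrakk>"
proof -
  note c = assms[THEN part_carrier]
  note h = bracket_even[OF assms(1,2)] bracket_even[OF assms(2,3)] bracket_even[OF assms(1,3)]
    bracket_even[OF assms(3,1)]
  define A where "A = \<lbrakk>\<lbrakk>x, y\<rbrakk>, z\<rbrakk>"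
  define B where "B = \<lbrakk>x, \<lbrakk>y, z\<rbrakk>\<rbrakk>"
  define C where "C = \<lbrakk>y, \<lbrakk>x, z\<rbrakk>\<rbrakk>"
  have car: "A \<in> carrier L" "B \<in> carrier L" "C \<in> carrier L"
    using c by (auto simp: A_def B_def C_def bracket_closed)
  have 1: "\<lbrakk>\<lbrakk>y, z\<rbrakk>, x\<rbrakk> = \<ominus> msg L ((q + r) * p) B"
    using super_skew[OF h(2) assms(1)] by (simp add: B_def)
  have "\<lbrakk>z, x\<rbrakk> = \<ominus> msg L (r * p) \<lbrakk>x, z\<rbrakk>" by (rule super_skew[OF assms(3,1)])
  then have "\<lbrakk>\<lbrakk>z, x\<rbrakk>, y\<rbrakk> = \<ominus> msg L (r * p) \<lbrakk>\<lbrakk>x, z\<rbrakk>, y\<rbrakk>"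
    using c by (simp add: br_neg br_msg bracket_closed)
  also have "\<lbrakk>\<lbrakk>x, z\<rbrakk>, y\<rbrakk> = \<ominus> msg L ((p + r) * q) C"
    using super_skew[OF h(3) assms(2)] by (simp add: C_def)
  finally have 2: "\<lbrakk>\<lbrakk>z, x\<rbrakk>, y\<rbrakk> = msg L (r * p + (p + r) * q) C"
    using car by (simp add: msg_neg msg_msg)
  have "msg L (p * r) A \<oplus> msg L (q * p) (\<ominus> msg L ((q + r) * p) B)
      \<oplus> msg L (r * q) (msg L (r * p + (p + r) * q) C) = \<zero>"
    using super_jacobi[OF assms] 1 2 by (simp add: A_def)
  then have "msg L (p * r) A \<oplus> \<ominus> msg L (p * r) B \<oplus> msg L (r * p + p * q) C = \<zero>"
    using car by (cases p; cases q; cases r) (simp_all add: msg_neg msg_msg)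
  then have "msg L (p * r) (A \<oplus> msg L (p * q) C \<oplus> \<ominus> B) = \<zero>"
    using car by (cases p; cases q; cases r) (simp_all add: msg_add msg_neg msg_msg M.a_ac)
  then have "A \<oplus> msg L (p * q) C \<oplus> \<ominus> B = \<zero>"
    using car by (simp add: msg_eq_zero)
  then have "A \<oplus> msg L (p * q) C = B" using car a_eq_iff_diff by simp
  then show ?thesis by (simp add: A_def B_def C_def)
qed

lemma centerI_left: "\<lbrakk>z \<in> lie_center L; x \<in> carrier L\<rbrakk> \<Longrightarrow> \<lbrakk>z, x\<rbrakk> = \<zero>"
  by (simp add: lie_center_def)

text \<open>\<open>lie_center\<close> only speaks of brackets with \<open>z\<close> on the left, and
  skew-symmetry is available for homogeneous elements only. For homogeneous \<open>x\<close> the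
  brackets of the two components of \<open>z\<close> with \<open>x\<close> have different degrees
  and sum to zero, so each of them vanishes.\<close>

lemma center_right:
  assumes "z \<in> lie_center L" "x \<in> carrier L" shows "\<lbrakk>x, z\<rbrakk> = \<zero>"
proof -
  have zc: "z \<in> carrier L" using assms by (simp add: lie_center_def)
  obtain z0 z1 where z: "z0 \<in> part L 0" "z1 \<in> part L 1" "z = z0 \<oplus> z1" using part_sum[OF zc] .
  have *: "\<lbrakk>x, z\<rbrakk> = \<zero>" if x: "x \<in> part L p" for x p
  proof -
    have c: "x \<in> carrier L" "z0 \<in> carrier L" "z1 \<in> carrier L" using x z by (auto intro: part_carrier)
    have s: "\<lbrakk>z0, x\<rbrakk> \<oplus> \<lbrakk>z1, x\<rbrakk> = \<zero>"
      using assms(1) c z(3) bracket_add_left[of z0 z1 x] by (simp add: lie_center_def)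
    have 0: "\<lbrakk>z0, x\<rbrakk> \<in> part L p" "\<lbrakk>z1, x\<rbrakk> \<in> part L (1 + p)"
      using bracket_even[OF z(1) x] bracket_even[OF z(2) x] by (cases p; simp)+
    have "\<lbrakk>z0, x\<rbrakk> = \<ominus> \<lbrakk>z1, x\<rbrakk>"
      using s c by (metis M.minus_equality bracket_closed)
    then have "\<lbrakk>z0, x\<rbrakk> \<in> part L (1 + p)" using 0 by (simp add: part_neg)
    with 0 have n: "\<lbrakk>z0, x\<rbrakk> = \<zero>" by (cases p) (auto intro: part_inter)
    then have n': "\<lbrakk>z1, x\<rbrakk> = \<zero>" using s c by (simp add: bracket_closed)
    have "\<lbrakk>x, z0\<rbrakk> = \<zero>" "\<lbrakk>x, z1\<rbrakk> = \<zero>"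
      using super_skew[OF x z(1)] super_skew[OF x z(2)] n n' by simp_all
    then show ?thesis using bracket_add_right[of x z0 z1] c z(3) by simp
  qed
  from assms(2) show ?thesis
    by (induction rule: homogeneous_induct) (use * zc in \<open>auto simp: bracket_add_left\<close>)
qed

end

text \<open>The cocycle takes values in \<open>L\<close> itself rather than in a new summand, which
  is why \<open>ann\<close> appears: values of \<alpha> are central and annihilated by \<alpha>, so
  the new double bracket is \<open>[[x,y],z] + \<alpha> [x,y] z\<close>. The new Jacobi identity is
  then the sum of the old one and the cocycle identity.\<close>

lemma (in lie_superalgebra) cocycle_bracket:
  assumes cl: "\<And>x y. \<lbrakk>x \<in> carrier L; y \<in> carrier L\<rbrakk> \<Longrightarrow> \<alpha> x y \<in> lie_center L"
    and add_l: "\<And>x y z. \<lbrakk>x \<in> carrier L; y \<in> carrier L; z \<in> carrier L\<rbrakk> \<Longrightarrow> \<alpha> (x \<oplus> y) z = \<alpha> x z \<oplus> \<alpha> y z"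
    and add_r: "\<And>x y z. \<lbrakk>x \<in> carrier L; y \<in> carrier L; z \<in> carrier L\<rbrakk> \<Longrightarrow> \<alpha> x (y \<oplus> z) = \<alpha> x y \<oplus> \<alpha> x z"
    and sm_l: "\<And>c x y. \<lbrakk>x \<in> carrier L; y \<in> carrier L\<rbrakk> \<Longrightarrow> \<alpha> (c \<odot> x) y = c \<odot> \<alpha> x y"
    and sm_r: "\<And>c x y. \<lbrakk>x \<in> carrier L; y \<in> carrier L\<rbrakk> \<Longrightarrow> \<alpha> x (c \<odot> y) = c \<odot> \<alpha> x y"
    and ev: "\<And>x y p q. \<lbrakk>x \<in> part L p; y \<in> part L q\<rbrakk> \<Longrightarrow> \<alpha> x y \<in> part L (p + q)"
    and sk: "\<And>x y p q. \<lbrakk>x \<in> part L p; y \<in> part L q\<rbrakk> \<Longrightarrow> \<alpha> x y = \<ominus> msg L (p * q) (\<alpha> y x)"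
    and co: "\<And>x y z p q r. \<lbrakk>x \<in> part L p; y \<in> part L q; z \<in> part L r\<rbrakk> \<Longrightarrow>
      msg L (p * r) (\<alpha> \<lbrakk>x, y\<rbrakk> z) \<oplus> msg L (q * p) (\<alpha> \<lbrakk>y, z\<rbrakk> x) \<oplus> msg L (r * q) (\<alpha> \<lbrakk>z, x\<rbrakk> y) = \<zero>"
    and ann: "\<And>x y z. \<lbrakk>x \<in> carrier L; y \<in> carrier L; z \<in> carrier L\<rbrakk> \<Longrightarrow> \<alpha> (\<alpha> x y) z = \<zero>"
  shows "lie_superalgebra (L\<lparr>bracket := \<lambda>x y. \<lbrakk>x, y\<rbrakk> \<oplus> \<alpha> x y\<rparr>)" (is "lie_superalgebra ?L")
proof -
  have clc: "\<lbrakk>x \<in> carrier L; y \<in> carrier L\<rbrakk> \<Longrightarrow> \<alpha> x y \<in> carrier L" for x y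
    using cl by (simp add: lie_center_def)
  have ainv: "a_inv ?L = a_inv L" by (simp add: a_inv_def m_inv_def fun_eq_iff)
  have m: "msg ?L = msg L" by (simp add: msg_def ainv fun_eq_iff)
  have mod: "Module.module type_ring ?L"
    by (rule kmoduleI) (auto simp: M.a_ac smult_mult smult_add_l smult_add_r smult_minus1 M.r_neg)
  interpret L': kmodule ?L using mod by (simp add: kmodule_def)
  have sub: "submodule (part L p) type_ring ?L" for p
    by (rule L'.submoduleI') (auto simp: part_carrier part_zero part_add part_smult)
  have gr: "z2_graded ?L (part ?L)"
    by (rule L'.z2_gradedI) (auto simp: sub part_inter elim!: part_sum)
  have 2: "bracket ?L (bracket ?L x y) z = \<lbrakk>\<lbrakk>x, y\<rbrakk>, z\<rbrakk> \<oplus> \<alpha> \<lbrakk>x, y\<rbrakk> z"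
    if "x \<in> carrier L" "y \<in> carrier L" "z \<in> carrier L" for x y z
    using that cl[of x y] by (simp add: bracket_add_left add_l bracket_closed clc ann centerI_left)
  show ?thesis
  proof (intro lie_superalgebra.intro lie_superalgebra_axioms.intro mod gr)
    fix x y z p q r assume xyz: "x \<in> part ?L p" "y \<in> part ?L q" "z \<in> part ?L r"
    then have xyz': "x \<in> part L p" "y \<in> part L q" "z \<in> part L r" by simp_all
    note c = xyz'[THEN part_carrier]
    define A where "A = \<lbrakk>\<lbrakk>x, y\<rbrakk>, z\<rbrakk>" define A' where "A' = \<alpha> \<lbrakk>x, y\<rbrakk> z"
    define B where "B = \<lbrakk>\<lbrakk>y, z\<rbrakk>, x\<rbrakk>" define B' where "B' = \<alpha> \<lbrakk>y, z\<rbrakk> x"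
    define C where "C = \<lbrakk>\<lbrakk>z, x\<rbrakk>, y\<rbrakk>" define C' where "C' = \<alpha> \<lbrakk>z, x\<rbrakk> y"
    have car: "A \<in> carrier L" "B \<in> carrier L" "C \<in> carrier L" "A' \<in> carrier L" "B' \<in> carrier L" "C' \<in> carrier L"
      using c by (auto simp: A_def B_def C_def A'_def B'_def C'_def bracket_closed clc)
    have J: "msg L (p * r) A \<oplus> msg L (q * p) B \<oplus> msg L (r * q) C = \<zero>"
      unfolding A_def B_def C_def by (rule super_jacobi[OF xyz'])
    have K: "msg L (p * r) A' \<oplus> msg L (q * p) B' \<oplus> msg L (r * q) C' = \<zero>"
      unfolding A'_def B'_def C'_def by (rule co[OF xyz'])
    have "msg L (p * r) (A \<oplus> A') \<oplus> msg L (q * p) (B \<oplus> B') \<oplus> msg L (r * q) (C \<oplus> C')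
      = (msg L (p * r) A \<oplus> msg L (q * p) B \<oplus> msg L (r * q) C) \<oplus>
        (msg L (p * r) A' \<oplus> msg L (q * p) B' \<oplus> msg L (r * q) C')"
      using car by (simp add: msg_add M.a_ac)
    also have "\<dots> = \<zero>" unfolding J K by simp
    finally have "msg L (p * r) (A \<oplus> A') \<oplus> msg L (q * p) (B \<oplus> B') \<oplus> msg L (r * q) (C \<oplus> C') = \<zero>" .
    then show "msg ?L (p * r) (bracket ?L (bracket ?L x y) z) \<oplus>\<^bsub>?L\<^esub>
      msg ?L (q * p) (bracket ?L (bracket ?L y z) x) \<oplus>\<^bsub>?L\<^esub>
      msg ?L (r * q) (bracket ?L (bracket ?L z x) y) = \<zero>\<^bsub>?L\<^esub>"
      unfolding m 2[OF c] 2[OF c(2,3,1)] 2[OF c(3,1,2)]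
      unfolding A_def B_def C_def A'_def B'_def C'_def by simp
  next
    fix x y p q assume xy: "x \<in> part ?L p" "y \<in> part ?L q"
    then have xy': "x \<in> part L p" "y \<in> part L q" by simp_all
    note c = xy'[THEN part_carrier]
    show "bracket ?L x y \<in> part ?L (p + q)"
      using bracket_even[OF xy'] ev[OF xy'] by (simp add: part_add)
    show "bracket ?L x y = \<ominus>\<^bsub>?L\<^esub> msg ?L (p * q) (bracket ?L y x)"
      unfolding m ainv using super_skew[OF xy'] sk[OF xy'] c
      by (simp add: msg_add bracket_closed clc M.minus_add)
  next
    fix x y z assume "x \<in> carrier ?L" "y \<in> carrier ?L" "z \<in> carrier ?L"
    then show "bracket ?L (x \<oplus>\<^bsub>?L\<^esub> y) z = bracket ?L x z \<oplus>\<^bsub>?L\<^esub> bracket ?L y z"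
      "bracket ?L x (y \<oplus>\<^bsub>?L\<^esub> z) = bracket ?L x y \<oplus>\<^bsub>?L\<^esub> bracket ?L x z"
      by (simp_all add: bracket_add_left bracket_add_right add_l add_r bracket_closed clc M.a_ac)
  qed (auto simp: bracket_closed clc bracket_smult_left bracket_smult_right sm_l sm_r smult_add_r)
qed

subsection \<open>Homomorphisms\<close>

lemma lie_homD:
  assumes "\<phi> \<in> lie_hom L M"
  shows "x \<in> carrier L \<Longrightarrow> \<phi> x \<in> carrier M"
    and "\<lbrakk>x \<in> carrier L; y \<in> carrier L\<rbrakk> \<Longrightarrow> \<phi> (x \<oplus>\<^bsub>L\<^esub> y) = \<phi> x \<oplus>\<^bsub>M\<^esub> \<phi> y"
    and "x \<in> carrier L \<Longrightarrow> \<phi> (c \<odot>\<^bsub>L\<^esub> x) = c \<odot>\<^bsub>M\<^esub> \<phi> x"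
    and "\<lbrakk>x \<in> carrier L; y \<in> carrier L\<rbrakk> \<Longrightarrow> \<phi> (bracket L x y) = bracket M (\<phi> x) (\<phi> y)"
    and "x \<in> part L p \<Longrightarrow> \<phi> x \<in> part M p"
  using assms unfolding lie_hom_def by auto

lemma lie_homI:
  assumes "\<And>x. x \<in> carrier L \<Longrightarrow> \<phi> x \<in> carrier M"
    and "\<And>x y. \<lbrakk>x \<in> carrier L; y \<in> carrier L\<rbrakk> \<Longrightarrow> \<phi> (x \<oplus>\<^bsub>L\<^esub> y) = \<phi> x \<oplus>\<^bsub>M\<^esub> \<phi> y"
    and "\<And>c x. x \<in> carrier L \<Longrightarrow> \<phi> (c \<odot>\<^bsub>L\<^esub> x) = c \<odot>\<^bsub>M\<^esub> \<phi> x"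
    and "\<And>x y. \<lbrakk>x \<in> carrier L; y \<in> carrier L\<rbrakk> \<Longrightarrow> \<phi> (bracket L x y) = bracket M (\<phi> x) (\<phi> y)"
    and "\<And>x p. x \<in> part L p \<Longrightarrow> \<phi> x \<in> part M p"
  shows "\<phi> \<in> lie_hom L M"
  using assms unfolding lie_hom_def by auto

lemma lie_hom_comp:
  "\<lbrakk>\<phi> \<in> lie_hom L M; \<psi> \<in> lie_hom M N\<rbrakk> \<Longrightarrow> \<psi> \<circ> \<phi> \<in> lie_hom L N"
  by (rule lie_homI) (simp_all add: lie_homD[of \<phi> L M] lie_homD[of \<psi> M N])

locale lie_homomorphism = L: lie_superalgebra L + M: lie_superalgebra M
  for L :: "('k::{comm_ring,monoid_mult}, 'a) lie_salg" and M :: "('k, 'b) lie_salg" +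
  fixes \<phi> assumes hom: "\<phi> \<in> lie_hom L M"
begin

lemmas hom_closed [simp, intro] = lie_homD(1)[OF hom]
lemmas hom_add = lie_homD(2)[OF hom]
lemmas hom_smult = lie_homD(3)[OF hom]
lemmas hom_bracket = lie_homD(4)[OF hom]
lemmas hom_part = lie_homD(5)[OF hom]

lemma hom_zero [simp]: "\<phi> \<zero>\<^bsub>L\<^esub> = \<zero>\<^bsub>M\<^esub>"
  using hom_smult[of "\<zero>\<^bsub>L\<^esub>" 0] by simp

lemma hom_neg: "x \<in> carrier L \<Longrightarrow> \<phi> (\<ominus>\<^bsub>L\<^esub> x) = \<ominus>\<^bsub>M\<^esub> \<phi> x"
  using hom_smult[of x "- 1"] by (simp add: L.smult_minus1 M.smult_minus1)

end

subsection \<open>Presentations\<close>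

lemma lie_cls_eq_iff: "lie_cls D Q s = lie_cls D Q t \<longleftrightarrow> lie_cong D Q s t"
  unfolding lie_cls_def by (blast intro: lie_cong.intros)

text \<open>The operations of a presented algebra are unions over all representatives; such a union
  collapses to one class as soon as \<open>f\<close> respects the congruence.\<close>

lemma lie_cls_UN1:
  assumes "\<And>s'. lie_cong D Q s s' \<Longrightarrow> lie_cong D Q (f s) (f s')"
  shows "(\<Union>s'\<in>lie_cls D Q s. lie_cls D Q (f s')) = lie_cls D Q (f s)"
proof -
  have "lie_cls D Q (f s') = lie_cls D Q (f s)" if "s' \<in> lie_cls D Q s" for s'
    using that assms by (subst lie_cls_eq_iff) (auto simp: lie_cls_def intro: lie_cong.sym)
  moreover have "s \<in> lie_cls D Q s" by (simp add: lie_cls_def lie_cong.refl)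
  ultimately show ?thesis by blast
qed

context
  fixes D :: "bit \<Rightarrow> 'g set" and Q :: "('k::{comm_ring,monoid_mult}, 'g) lie_term \<Rightarrow> ('k, 'g) lie_term \<Rightarrow> bool"
begin

private abbreviation (input) "cl \<equiv> lie_cls D Q"
private abbreviation (input) "P \<equiv> presented_lie_salg D Q"

lemma pres_carrier: "carrier P = range cl"
  and pres_zero: "\<zero>\<^bsub>P\<^esub> = cl Zero"
  and pres_part: "part P p = {cl t | t. lie_deg D p t}"
  by (simp_all add: presented_lie_salg_def)

lemma pres_add: "cl s \<oplus>\<^bsub>P\<^esub> cl t = cl (Add s t)"
proof -
  have "(\<Union>t'\<in>cl t. cl (Add s' t')) = cl (Add s' t)" for s'
    by (rule lie_cls_UN1) (auto intro: lie_cong.intros)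
  moreover have "(\<Union>s'\<in>cl s. cl (Add s' t)) = cl (Add s t)"
    by (rule lie_cls_UN1[where f="\<lambda>s. Add s t"]) (auto intro: lie_cong.intros)
  ultimately show ?thesis by (simp add: presented_lie_salg_def)
qed

lemma pres_bracket: "bracket P (cl s) (cl t) = cl (Brk s t)"
proof -
  have "(\<Union>t'\<in>cl t. cl (Brk s' t')) = cl (Brk s' t)" for s'
    by (rule lie_cls_UN1) (auto intro: lie_cong.intros)
  moreover have "(\<Union>s'\<in>cl s. cl (Brk s' t)) = cl (Brk s t)"
    by (rule lie_cls_UN1[where f="\<lambda>s. Brk s t"]) (auto intro: lie_cong.intros)
  ultimately show ?thesis by (simp add: presented_lie_salg_def)
qed

lemma pres_smult: "c \<odot>\<^bsub>P\<^esub> cl t = cl (Scale c t)"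
  using lie_cls_UN1[of D Q t "Scale c"]
  by (auto simp: presented_lie_salg_def intro: lie_cong.intros)

lemma pres_laws:
  "cl (Add (Add s t) u) = cl (Add s (Add t u))" "cl (Add s t) = cl (Add t s)"
  "cl (Add Zero t) = cl t" "cl (Add t (Scale (- 1) t)) = cl Zero" "cl (Scale 1 t) = cl t"
  "cl (Scale (c * d) t) = cl (Scale c (Scale d t))"
  "cl (Scale (c + d) t) = cl (Add (Scale c t) (Scale d t))"
  "cl (Scale c (Add s t)) = cl (Add (Scale c s) (Scale c t))"
  "cl (Brk (Add s t) u) = cl (Add (Brk s u) (Brk t u))"
  "cl (Brk s (Add t u)) = cl (Add (Brk s t) (Brk s u))"
  "cl (Brk (Scale c s) t) = cl (Scale c (Brk s t))"
  "cl (Brk s (Scale c t)) = cl (Scale c (Brk s t))"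
  unfolding lie_cls_eq_iff
  by (rule lie_cong.add_assoc lie_cong.add_comm lie_cong.add_zero lie_cong.add_neg lie_cong.scale_one
    lie_cong.scale_mult lie_cong.scale_add_left lie_cong.scale_add_right lie_cong.brk_add_left
    lie_cong.brk_add_right lie_cong.brk_scale_left lie_cong.brk_scale_right)+

lemma pres_module: "Module.module type_ring P"
  by (rule kmoduleI; unfold pres_carrier pres_zero; (elim rangeE)?; hypsubst?;
      simp only: pres_add pres_smult rangeI; rule pres_laws)

lemma pres_neg: "\<ominus>\<^bsub>P\<^esub> cl t = cl (Scale (- 1) t)"
proof -
  interpret kmodule P using pres_module by (simp add: kmodule_def)
  show ?thesis using smult_minus1[of "cl t"] by (simp add: pres_carrier pres_smult)
qed

lemma pres_msg: "msg P p (cl t) = cl (tsg p t)"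
  by (simp add: msg_def tsg_def pres_neg)

text \<open>The congruence enforces all identities but not the grading: for general \<open>D\<close>
  and \<open>Q\<close> a class may have representatives of both degrees, or no homogeneous
  decomposition at all.\<close>

lemma presented_lie_superalgebra:
  assumes "z2_graded P (part P)"
  shows "lie_superalgebra P"
proof (intro lie_superalgebra.intro lie_superalgebra_axioms.intro pres_module assms)
  fix x y z p q r assume "x \<in> part P p" "y \<in> part P q" "z \<in> part P r"
  then obtain s t u where "x = cl s" "y = cl t" "z = cl u" "lie_deg D p s" "lie_deg D q t" "lie_deg D r u"
    by (auto simp: pres_part)
  then show "msg P (p * r) (bracket P (bracket P x y) z) \<oplus>\<^bsub>P\<^esub>
      msg P (q * p) (bracket P (bracket P y z) x) \<oplus>\<^bsub>P\<^esub>
      msg P (r * q) (bracket P (bracket P z x) y) = \<zero>\<^bsub>P\<^esub>"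
    by (simp add: pres_bracket pres_msg pres_add pres_zero lie_cls_eq_iff lie_cong.jacobi)
next
  fix x y p q assume "x \<in> part P p" "y \<in> part P q"
  then obtain s t where st: "x = cl s" "y = cl t" "lie_deg D p s" "lie_deg D q t"
    by (auto simp: pres_part)
  then show "bracket P x y \<in> part P (p + q)"
    by (auto simp: pres_part pres_bracket intro: lie_deg.intros)
  show "bracket P x y = \<ominus>\<^bsub>P\<^esub> msg P (p * q) (bracket P y x)"
    using st by (simp add: pres_bracket pres_msg pres_neg lie_cls_eq_iff lie_cong.skew)
next
  fix x y z c assume "x \<in> carrier P" "y \<in> carrier P" "z \<in> carrier P"
  then obtain s t u where [simp]: "x = cl s" "y = cl t" "z = cl u" by (auto simp: pres_carrier)
  show "bracket P (x \<oplus>\<^bsub>P\<^esub> y) z = bracket P x z \<oplus>\<^bsub>P\<^esub> bracket P y z"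
    "bracket P x (y \<oplus>\<^bsub>P\<^esub> z) = bracket P x y \<oplus>\<^bsub>P\<^esub> bracket P x z"
    by (simp_all only: \<open>x = _\<close> \<open>y = _\<close> \<open>z = _\<close> pres_bracket pres_add pres_laws(9,10))
next
  fix x y c assume "x \<in> carrier P" "y \<in> carrier P"
  then obtain s t where [simp]: "x = cl s" "y = cl t" by (auto simp: pres_carrier)
  show "bracket P x y \<in> carrier P" "bracket P (c \<odot>\<^bsub>P\<^esub> x) y = c \<odot>\<^bsub>P\<^esub> bracket P x y"
    "bracket P x (c \<odot>\<^bsub>P\<^esub> y) = c \<odot>\<^bsub>P\<^esub> bracket P x y"
    by (simp_all only: \<open>x = _\<close> \<open>y = _\<close> pres_carrier rangeI pres_bracket pres_smult pres_laws(11,12))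
qed

end

context lie_superalgebra
begin

primrec term_val :: "('g \<Rightarrow> 'a) \<Rightarrow> ('k, 'g) lie_term \<Rightarrow> 'a"
  where
    "term_val \<gamma> (Gen g) = \<gamma> g"
  | "term_val \<gamma> Zero = \<zero>"
  | "term_val \<gamma> (Add s t) = term_val \<gamma> s \<oplus> term_val \<gamma> t"
  | "term_val \<gamma> (Scale c t) = c \<odot> term_val \<gamma> t"
  | "term_val \<gamma> (Brk s t) = \<lbrakk>term_val \<gamma> s, term_val \<gamma> t\<rbrakk>"

lemma term_val_closed: "(\<And>g. \<gamma> g \<in> carrier L) \<Longrightarrow> term_val \<gamma> t \<in> carrier L"
  by (induction t) (auto simp: bracket_closed)

lemma term_val_part:
  assumes "lie_deg D p t" "\<And>g p. g \<in> D p \<Longrightarrow> \<gamma> g \<in> part L p"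
  shows "term_val \<gamma> t \<in> part L p"
  using assms(1) by (induction rule: lie_deg.induct)
    (auto simp: assms(2) part_zero part_add part_smult bracket_even)

lemma term_val_tsg: "(\<And>g. \<gamma> g \<in> carrier L) \<Longrightarrow> term_val \<gamma> (tsg p t) = msg L p (term_val \<gamma> t)"
  by (simp add: tsg_def msg_def smult_minus1 term_val_closed)


lemma term_val_cong:
  assumes car: "\<And>g. \<gamma> g \<in> carrier L" and deg: "\<And>g p. g \<in> D p \<Longrightarrow> \<gamma> g \<in> part L p"
    and rel: "\<And>s t. Q s t \<Longrightarrow> term_val \<gamma> s = term_val \<gamma> t"
  shows "lie_cong D Q s t \<Longrightarrow> term_val \<gamma> s = term_val \<gamma> t"
proof (induction rule: lie_cong.induct)
  case (skew p s q t)
  then show ?case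
    using super_skew[OF skew[THEN term_val_part[OF _ deg]]]
    by (simp add: term_val_tsg car term_val_closed smult_minus1 bracket_closed)
next
  case (jacobi p s q t r u)
  then show ?case
    using super_jacobi[OF jacobi[THEN term_val_part[OF _ deg]]]
    by (simp add: term_val_tsg car)
next
  case (rel s t)
  then show ?case by (rule assms(3))
next
  case (add_comm s t)
  then show ?case by (simp add: M.a_comm term_val_closed car)
next
  case (add_assoc s t u)
  then show ?case by (simp add: M.a_assoc term_val_closed car)
qed (simp_all add: term_val_closed car bracket_closed M.r_neg smult_minus1 smult_mult
    smult_add_l smult_add_r bracket_add_left bracket_add_right bracket_smult_left bracket_smult_right)

text \<open>The universal property of a presentation. The value on a class is read off from an
  arbitrary representative, which is legitimate by \<open>term_val_cong\<close>.\<close>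

lemma presented_hom:
  assumes car: "\<And>g. \<gamma> g \<in> carrier L" and deg: "\<And>g p. g \<in> D p \<Longrightarrow> \<gamma> g \<in> part L p"
    and rel: "\<And>s t. Q s t \<Longrightarrow> term_val \<gamma> s = term_val \<gamma> t"
  obtains \<theta> where "\<theta> \<in> lie_hom (presented_lie_salg D Q) L" "\<And>t. \<theta> (lie_cls D Q t) = term_val \<gamma> t"
proof -
  define \<theta> where "\<theta> A = term_val \<gamma> (SOME t. t \<in> A)" for A
  have \<theta>: "\<theta> (lie_cls D Q t) = term_val \<gamma> t" for t
  proof -
    have "(SOME s. s \<in> lie_cls D Q t) \<in> lie_cls D Q t"
      by (rule someI[of _ t]) (simp add: lie_cls_def lie_cong.refl)
    then have "lie_cong D Q t (SOME s. s \<in> lie_cls D Q t)" by (simp add: lie_cls_def)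
    then have "term_val \<gamma> t = term_val \<gamma> (SOME s. s \<in> lie_cls D Q t)"
      by (rule term_val_cong[where \<gamma> = \<gamma> and D = D and Q = Q, rotated 3])
        (rule car | erule deg | erule rel)+
    then show ?thesis by (simp add: \<theta>_def)
  qed
  have "\<theta> \<in> lie_hom (presented_lie_salg D Q) L"
  proof (rule lie_homI)
    fix x p assume "x \<in> part (presented_lie_salg D Q) p"
    then show "\<theta> x \<in> part L p" by (auto simp: pres_part \<theta> intro: term_val_part[OF _ deg])
  qed (unfold pres_carrier; elim rangeE; simp add: pres_add pres_smult pres_bracket \<theta> term_val_closed car)+
  with \<theta> that show thesis by blast
qed

end

lemma presented_hom_unique:
  assumes "\<theta> \<in> lie_hom (presented_lie_salg D Q) L" "\<theta>' \<in> lie_hom (presented_lie_salg D Q) L"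
    and "\<And>g. \<theta> (lie_cls D Q (Gen g)) = \<theta>' (lie_cls D Q (Gen g))"
    and "\<theta> (lie_cls D Q Zero) = \<theta>' (lie_cls D Q Zero)"
    and "x \<in> carrier (presented_lie_salg D Q)"
  shows "\<theta> x = \<theta>' x"
proof -
  have "\<theta> (lie_cls D Q t) = \<theta>' (lie_cls D Q t)" for t
  proof (induction t)
    case (Add s t)
    show ?case
      unfolding pres_add[symmetric]
      using lie_homD(2)[OF assms(1), of "lie_cls D Q s" "lie_cls D Q t"]
        lie_homD(2)[OF assms(2), of "lie_cls D Q s" "lie_cls D Q t"] Add
      by (simp add: pres_carrier)
  next
    case (Scale c t)
    show ?case
      unfolding pres_smult[symmetric]
      using lie_homD(3)[OF assms(1), of "lie_cls D Q t" c]
        lie_homD(3)[OF assms(2), of "lie_cls D Q t" c] Scale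
      by (simp add: pres_carrier)
  next
    case (Brk s t)
    show ?case
      unfolding pres_bracket[symmetric]
      using lie_homD(4)[OF assms(1), of "lie_cls D Q s" "lie_cls D Q t"]
        lie_homD(4)[OF assms(2), of "lie_cls D Q s" "lie_cls D Q t"] Brk
      by (simp add: pres_carrier)
  next
    case (Gen g)
    show ?case by (rule assms(3))
  next
    case Zero
    show ?case by (rule assms(4))
  qed
  moreover obtain t where "x = lie_cls D Q t" using assms(5) unfolding pres_carrier by blast
  ultimately show ?thesis by (simp only:)
qed

lemma sg_simps [simp]: "sg 0 a = a" "sg 1 a = - a"
  by (simp_all add: sg_def)

lemma sg_zero [simp]: "sg p 0 = (0 :: 'a :: group_add)"
  by (simp add: sg_def)

text \<open>Only the existence of homogeneous components inside \<open>D\<close> is at stake; their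
  uniqueness is inherited from \<open>L\<close>.\<close>

lemma (in lie_superalgebra) subalgebra:
  assumes D: "submodule D type_ring L" and br: "\<And>x y. \<lbrakk>x \<in> D; y \<in> D\<rbrakk> \<Longrightarrow> \<lbrakk>x, y\<rbrakk> \<in> D"
    and dec: "\<And>x. x \<in> D \<Longrightarrow> \<exists>x0\<in>part L 0 \<inter> D. \<exists>x1\<in>part L 1 \<inter> D. x = x0 \<oplus> x1"
  shows "lie_superalgebra (L\<lparr>carrier := D, part := \<lambda>p. part L p \<inter> D\<rparr>)" (is "lie_superalgebra ?L")
proof -
  have DL: "x \<in> D \<Longrightarrow> x \<in> carrier L" for x using submoduleE(1)[OF D] by blast
  have "Module.module type_ring (L\<lparr>carrier := D\<rparr>)"
    by (rule submodule.submodule_is_module[OF D]) unfold_locales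
  then have mod: "Module.module type_ring ?L"
    by (intro kmoduleI) (use submoduleE[OF D] DL submodule_zero[OF D] in
      \<open>auto simp: M.a_ac smult_mult smult_add_l smult_add_r smult_minus1 M.r_neg\<close>)
  interpret L': kmodule ?L using mod by (simp add: kmodule_def)
  have ainv: "x \<in> D \<Longrightarrow> \<ominus>\<^bsub>?L\<^esub> x = \<ominus> x" for x
    using L'.smult_minus1[of x] by (simp add: smult_minus1 DL)
  then have m: "x \<in> D \<Longrightarrow> msg ?L p x = msg L p x" for p x by (simp add: msg_def)
  have mD: "x \<in> D \<Longrightarrow> msg L p x \<in> D" for p x using submoduleE(3)[OF D] by (simp add: msg_def)
  have sub: "submodule (part L p \<inter> D) type_ring ?L" for p
    by (rule L'.submoduleI') (auto simp: part_zero part_add part_smult submodule_zero[OF D] submoduleE[OF D])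
  have gr: "z2_graded ?L (part ?L)"
    by (rule L'.z2_gradedI) (use sub dec part_inter in auto)
  show ?thesis
  proof (intro lie_superalgebra.intro lie_superalgebra_axioms.intro mod gr)
    fix x y z p q r assume "x \<in> part ?L p" "y \<in> part ?L q" "z \<in> part ?L r"
    then have "x \<in> part L p" "y \<in> part L q" "z \<in> part L r" and "x \<in> D" "y \<in> D" "z \<in> D" by auto
    then show "msg ?L (p * r) (bracket ?L (bracket ?L x y) z) \<oplus>\<^bsub>?L\<^esub>
      msg ?L (q * p) (bracket ?L (bracket ?L y z) x) \<oplus>\<^bsub>?L\<^esub>
      msg ?L (r * q) (bracket ?L (bracket ?L z x) y) = \<zero>\<^bsub>?L\<^esub>"
      using super_jacobi[of x p y q z r] by (simp add: m br)
  next
    fix x y p q assume "x \<in> part ?L p" "y \<in> part ?L q"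
    then have xy: "x \<in> part L p" "y \<in> part L q" and "x \<in> D" "y \<in> D" by auto
    then show "bracket ?L x y \<in> part ?L (p + q)" by (auto simp: br bracket_even)
    show "bracket ?L x y = \<ominus>\<^bsub>?L\<^esub> msg ?L (p * q) (bracket ?L y x)"
      using super_skew[OF xy] \<open>x \<in> D\<close> \<open>y \<in> D\<close> by (simp add: m mD br ainv)
  qed (auto simp: br DL bracket_add_left bracket_add_right bracket_smult_left bracket_smult_right)
qed

section \<open>Arithmetic in a superalgebra with superinvolution and 1/2\<close>

locale superinvolution_half = superinvolution scl H bar
  for scl :: "'k::{comm_ring,monoid_mult} \<Rightarrow> 'r::{ring,monoid_mult} \<Rightarrow> 'r" and H bar +
  assumes half_ex: "\<exists>u::'k. (1 + 1) * u = 1"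
begin

sublocale A: kmodule "alg_module scl"
  using alg_module by (simp add: kmodule_def)

lemma alg_simps [simp]:
  "carrier (alg_module scl) = UNIV" "\<zero>\<^bsub>alg_module scl\<^esub> = 0" "a \<oplus>\<^bsub>alg_module scl\<^esub> b = a + b"
  "c \<odot>\<^bsub>alg_module scl\<^esub> a = scl c a"
  by (simp_all add: alg_module_def)

lemma alg_neg [simp]: "\<ominus>\<^bsub>alg_module scl\<^esub> a = - a"
  by (rule A.minus_equality) simp_all

lemma scl_simps:
  "scl (c + d) a = scl c a + scl d a" "scl c (a + b) = scl c a + scl c b"
  "scl (c * d) a = scl c (scl d a)"
  using A.smult_add_l[of a c d] A.smult_add_r[of a b c] A.smult_mult[of a c d] by simp_all

lemma scl_one [simp]: "scl 1 a = a" and scl_zero_left [simp]: "scl 0 a = 0"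
  and scl_zero [simp]: "scl c 0 = 0" and scl_minus1 [simp]: "scl (- 1) a = - a"
  and scl_neg: "scl c (- a) = - scl c a"
  using A.smult_1[of a] A.smult_0[of a] A.smult_zero[of c] A.smult_minus1[of a] A.smult_neg[of a c]
  by simp_all

lemma scl_diff: "scl c (a - b) = scl c a - scl c b"
  using scl_simps(2)[of c a "- b"] by (simp add: scl_neg)

definition hf :: 'k where "hf = (SOME u. (1 + 1) * u = 1)"

lemma hf: "(1 + 1) * hf = 1" "hf * (1 + 1) = 1" "hf + hf = 1"
proof -
  show 1: "(1 + 1) * hf = 1" unfolding hf_def by (rule someI_ex[OF half_ex])
  then show "hf * (1 + 1) = 1" "hf + hf = 1" by (simp_all add: algebra_simps)
qed

lemma scl_hf: "scl hf (a + a) = a" "scl hf a + scl hf a = a"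
proof -
  show "scl hf a + scl hf a = a" by (simp add: hf flip: scl_simps(1))
  then show "scl hf (a + a) = a" by (simp add: scl_simps(2))
qed

lemma submodule_algD:
  assumes "submodule N type_ring (alg_module scl)"
  shows "0 \<in> N" "\<lbrakk>a \<in> N; b \<in> N\<rbrakk> \<Longrightarrow> a + b \<in> N" "a \<in> N \<Longrightarrow> - a \<in> N"
    "\<lbrakk>a \<in> N; b \<in> N\<rbrakk> \<Longrightarrow> a - b \<in> N" "a \<in> N \<Longrightarrow> scl c a \<in> N" "a \<in> N \<Longrightarrow> sg p a \<in> N"
    "- a \<in> N \<longleftrightarrow> a \<in> N" "sg p a \<in> N \<longleftrightarrow> a \<in> N"
proof -
  show 1: "0 \<in> N" using A.submodule_zero[OF assms] by simp
  show 2: "\<lbrakk>a \<in> N; b \<in> N\<rbrakk> \<Longrightarrow> a + b \<in> N" for a b using A.submoduleE(5)[OF assms, of a b] by simp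
  show 3: "a \<in> N \<Longrightarrow> - a \<in> N" for a using A.submoduleE(3)[OF assms, of a] by simp
  show "\<lbrakk>a \<in> N; b \<in> N\<rbrakk> \<Longrightarrow> a - b \<in> N" using 2[of a "- b"] 3[of b] by simp
  show "a \<in> N \<Longrightarrow> scl c a \<in> N" using A.submoduleE(4)[OF assms, of c a] by simp
  show 4: "- a \<in> N \<longleftrightarrow> a \<in> N" for a using 3[of a] 3[of "- a"] by auto
  then show "a \<in> N \<Longrightarrow> sg p a \<in> N" "sg p a \<in> N \<longleftrightarrow> a \<in> N" by (auto simp: sg_def)
qed

lemma submodule_algI:
  assumes "0 \<in> N" "\<And>a b. \<lbrakk>a \<in> N; b \<in> N\<rbrakk> \<Longrightarrow> a + b \<in> N" "\<And>c a. a \<in> N \<Longrightarrow> scl c a \<in> N"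
  shows "submodule N type_ring (alg_module scl)"
  by (rule A.submoduleI') (use assms in simp_all)

lemma H_submodule: "submodule (H p) type_ring (alg_module scl)"
  by (rule A.graded_submodule[OF graded])

lemmas H_intros [intro] = submodule_algD(1-6)[OF H_submodule]
lemmas H_iffs [simp] = submodule_algD(1,7,8)[OF H_submodule]

lemma H_sum: obtains a0 a1 where "a0 \<in> H 0" "a1 \<in> H 1" "a = a0 + a1"
  using A.graded_sum[OF graded, of a] by auto

lemma H_inter: "\<lbrakk>a \<in> H 0; a \<in> H 1\<rbrakk> \<Longrightarrow> a = 0"
  using A.graded_inter[OF graded, of a] by simp

lemma H_inter': "\<lbrakk>a \<in> H p; a \<in> H (p + 1)\<rbrakk> \<Longrightarrow> a = 0"
  by (cases p) (auto intro: H_inter)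

lemma hcompI: "\<lbrakk>b \<in> H p; a - b \<in> H (p + 1)\<rbrakk> \<Longrightarrow> hcomp p a = b"
  unfolding hcomp_def
proof (rule the_equality, blast)
  fix c assume b: "b \<in> H p" "a - b \<in> H (p + 1)" and c: "c \<in> H p \<and> a - c \<in> H (p + 1)"
  have "(a - b) - (a - c) \<in> H (p + 1)" "c - b \<in> H p" using b c by blast+
  then have "c - b = 0" by (intro H_inter'[of _ p]) simp_all
  then show "c = b" by simp
qed

lemma hcomp_props: "hcomp p a \<in> H p" "a - hcomp p a \<in> H (p + 1)"
proof -
  obtain a0 a1 where a: "a0 \<in> H 0" "a1 \<in> H 1" "a = a0 + a1" by (rule H_sum)
  have "hcomp 0 a = a0" "hcomp 1 a = a1" by (rule hcompI; use a in simp)+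
  then show "hcomp p a \<in> H p" "a - hcomp p a \<in> H (p + 1)" using a by (cases p; simp)+
qed

lemmas hcomp_in [simp, intro] = hcomp_props(1)

lemma hcomp_sum: "hcomp 0 a + hcomp 1 a = a"
proof -
  have "hcomp 1 a = a - hcomp 0 a"
    by (rule hcompI) (use hcomp_props[where p = 0 and a = a] in simp_all)
  then show ?thesis by simp
qed

lemma hcomp_id [simp]: "a \<in> H p \<Longrightarrow> hcomp p a = a"
  by (rule hcompI) auto

lemma hcomp_other: "a \<in> H (p + 1) \<Longrightarrow> hcomp p a = 0"
  by (rule hcompI) auto

lemma hcomp_other' [simp]: "a \<in> H 1 \<Longrightarrow> hcomp 0 a = 0" "a \<in> H 0 \<Longrightarrow> hcomp 1 a = 0"
  by (rule hcomp_other; simp)+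

lemma hcomp_add: "hcomp p (a + b) = hcomp p a + hcomp p b"
  by (rule hcompI) (use hcomp_props in \<open>auto simp: add_diff_add\<close>)

lemma hcomp_scl: "hcomp p (scl c a) = scl c (hcomp p a)"
  by (rule hcompI) (use hcomp_props in \<open>auto simp flip: scl_diff\<close>)

lemma hcomp_neg: "hcomp p (- a) = - hcomp p a"
  using hcomp_scl[where p = p and c = "- 1" and a = a] by simp

lemma hcomp_diff: "hcomp p (a - b) = hcomp p a - hcomp p b"
  using hcomp_add[where p = p and a = a and b = "- b"] by (simp add: hcomp_neg)

lemma hcomp_zero [simp]: "hcomp p 0 = 0"
  by simp

lemma bar_zero [simp]: "bar 0 = 0" and bar_neg: "bar (- a) = - bar a"
  using bar_scl[of 0 0] bar_scl[of "- 1" a] by simp_all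

lemma bar_diff: "bar (a - b) = bar a - bar b"
  using bar_add[of a "- b"] by (simp add: bar_neg)

declare bar_bar [simp]

lemma bar_in_iff [simp]: "bar a \<in> H p \<longleftrightarrow> a \<in> H p"
  using bar_deg[of a p] bar_deg[of "bar a" p] by auto

lemma hcomp_bar: "hcomp p (bar a) = bar (hcomp p a)"
  by (rule hcompI) (use hcomp_props in \<open>auto simp flip: bar_diff\<close>)

lemma rho_homogeneous: "a \<in> H p \<Longrightarrow> rho a = sg p a"
  by (cases p) (simp_all add: rho_def)

lemma rho_simps:
  "rho (a + b) = rho a + rho b" "rho (scl c a) = scl c (rho a)" "rho (- a) = - rho a"
  "rho (a - b) = rho a - rho b" "rho 0 = 0" "bar (rho a) = rho (bar a)"
  by (simp_all add: rho_def hcomp_add hcomp_scl hcomp_neg hcomp_diff hcomp_bar bar_diff scl_diff)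

lemma hcomp_rho: "hcomp p (rho a) = sg p (hcomp p a)"
  by (cases p) (simp_all add: rho_def hcomp_diff)

lemma rho_rho [simp]: "rho (rho a) = a"
  using hcomp_sum[where a = a] by (simp add: rho_def[of "rho a"] hcomp_rho)

text \<open>With \<open>1 = u + v\<close> split into components, comparing degrees in
  \<open>v = u v + v v\<close> gives \<open>v v = 0\<close>, comparing them in
  \<open>u = u u + u v\<close> gives \<open>u v = 0\<close>, and so \<open>v = 0\<close>.\<close>

lemma one_H0 [simp, intro]: "1 \<in> H 0"
proof -
  define u where "u = hcomp 0 1" define v where "v = hcomp 1 1"
  have uv: "u \<in> H 0" "v \<in> H 1" "u + v = 1" by (simp_all add: u_def v_def hcomp_sum)
  have "v = u * v + v * v" by (metis uv(3) distrib_right mult_1_left)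
  moreover have "u * v \<in> H 1" "v * v \<in> H 0" using mult_deg[OF uv(1,2)] mult_deg[OF uv(2,2)] by simp_all
  ultimately have "v * v = v - u * v" "v - u * v \<in> H 1" using uv by (auto simp: algebra_simps)
  then have "v * v = 0" using \<open>v * v \<in> H 0\<close> H_inter by metis
  have "u = u * u + u * v" by (metis uv(3) distrib_left mult_1_right)
  moreover have "u * u \<in> H 0" using mult_deg[OF uv(1,1)] by simp
  ultimately have "u * v = u - u * u" "u - u * u \<in> H 0" using uv by (auto simp: algebra_simps)
  then have "u * v = 0" using \<open>u * v \<in> H 1\<close> H_inter by metis
  then have "v = 0" using \<open>v = u * v + v * v\<close> \<open>v * v = 0\<close> by simp
  then show ?thesis using uv by simp
qed

lemma bar_one [simp]: "bar 1 = 1"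
proof -
  have "bar (1 * bar 1) = bar (bar 1) * bar 1" using bar_mult[of 1 0 "bar 1" 0] by simp
  then show ?thesis by simp
qed

lemma tr_simps:
  "tr (a + b) = tr a + tr b" "tr (scl c a) = scl c (tr a)" "tr (- a) = - tr a" "tr 0 = 0"
  "tr (bar a) = tr a" "bar (tr a) = tr a" "tr (sg p a) = sg p (tr a)" "tr 1 = 1 + 1"
  by (simp_all add: tr_def bar_add bar_scl bar_neg scl_simps add.commute sg_def)

lemma tr_deg [intro]: "a \<in> H p \<Longrightarrow> tr a \<in> H p"
  by (auto simp: tr_def)

text \<open>Because of 1/2 every self-conjugate element is a trace, so the matrices
  \<open>osp_v\<close> and \<open>osp_w\<close> reach all entries (2,3) and (3,2) that occur in
  \<open>osp_skew\<close>.\<close>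

lemma tr_hf: "bar a = a \<Longrightarrow> tr (scl hf a) = a"
  by (simp add: tr_def bar_scl scl_hf)

lemma sg_in [intro]: "a \<in> H p \<Longrightarrow> sg q a \<in> H p"
  by simp

lemma H_cases_add:
  assumes "\<And>a p. a \<in> H p \<Longrightarrow> P a" "\<And>a b. \<lbrakk>P a; P b\<rbrakk> \<Longrightarrow> P (a + b)"
  shows "P a"
  using assms(2)[OF assms(1) assms(1), OF hcomp_in hcomp_in] hcomp_sum[where a = a] by metis

subsection \<open>Matrices\<close>

lemma idx_deg [simp]: "idx_deg 1 = 0" "idx_deg 2 = 1" "idx_deg 3 = 1"
  by (simp_all add: idx_deg_def)

lemma mat_eq_iff: "X = Y \<longleftrightarrow>
  X $ 1 $ 1 = Y $ 1 $ 1 \<and> X $ 1 $ 2 = Y $ 1 $ 2 \<and> X $ 1 $ 3 = Y $ 1 $ 3 \<and>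
  X $ 2 $ 1 = Y $ 2 $ 1 \<and> X $ 2 $ 2 = Y $ 2 $ 2 \<and> X $ 2 $ 3 = Y $ 2 $ 3 \<and>
  X $ 3 $ 1 = Y $ 3 $ 1 \<and> X $ 3 $ 2 = Y $ 3 $ 2 \<and> X $ 3 $ 3 = (Y :: 'r^3^3) $ 3 $ 3"
  by (simp add: vec_eq_iff forall_3)

lemma mat_mult_nth [simp]:
  "mat_mult X Y $ i $ j = X $ i $ 1 * Y $ 1 $ j + X $ i $ 2 * Y $ 2 $ j + X $ i $ 3 * Y $ 3 $ j"
  by (simp add: mat_mult_def sum_3)

lemma mat_mult_simps:
  "mat_mult (X + Y) Z = mat_mult X Z + mat_mult Y Z" "mat_mult Z (X + Y) = mat_mult Z X + mat_mult Z Y"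
  "mat_mult (- X) Z = - mat_mult X Z" "mat_mult Z (- X) = - mat_mult Z X"
  "mat_mult (X - Y) Z = mat_mult X Z - mat_mult Y Z" "mat_mult Z (X - Y) = mat_mult Z X - mat_mult Z Y"
  "mat_mult 0 Z = 0" "mat_mult Z 0 = 0"
  "mat_mult (mat_mult X Y) Z = mat_mult X (mat_mult Y Z)"
  by (simp_all add: mat_eq_iff algebra_simps)

lemma mat_lie_simps [simp]:
  "carrier mat_lie = UNIV" "\<zero>\<^bsub>mat_lie\<^esub> = 0" "X \<oplus>\<^bsub>mat_lie\<^esub> Y = X + Y"
  "bracket mat_lie = mat_bracket" "part mat_lie = mat_part"
  by (simp_all add: mat_lie_def)

lemma mat_smult_nth [simp]: "(c \<odot>\<^bsub>mat_lie\<^esub> X) $ i $ j = scl c (X $ i $ j)"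
  by (simp add: mat_lie_def)

lemma mat_module: "Module.module type_ring mat_lie"
  by (rule kmoduleI) (simp_all add: vec_eq_iff scl_simps algebra_simps)

sublocale M: kmodule mat_lie
  using mat_module by (simp add: kmodule_def)

lemma mat_neg [simp]: "\<ominus>\<^bsub>mat_lie\<^esub> X = - X"
  by (rule M.minus_equality) simp_all

lemma mat_msg [simp]: "msg mat_lie p X = sg p X"
  by (simp add: msg_def sg_def)

lemma mat_hcomp_nth [simp]: "mat_hcomp p X $ i $ j = hcomp (p + idx_deg i + idx_deg j) (X $ i $ j)"
  by (simp add: mat_hcomp_def)

lemma mat_partD: "X \<in> mat_part p \<Longrightarrow> X $ i $ j \<in> H (p + idx_deg i + idx_deg j)"
  by (simp add: mat_part_def)

lemma mat_part_iff: "X \<in> mat_part p \<longleftrightarrow>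
  X $ 1 $ 1 \<in> H p \<and> X $ 1 $ 2 \<in> H (p + 1) \<and> X $ 1 $ 3 \<in> H (p + 1) \<and>
  X $ 2 $ 1 \<in> H (p + 1) \<and> X $ 2 $ 2 \<in> H p \<and> X $ 2 $ 3 \<in> H p \<and>
  X $ 3 $ 1 \<in> H (p + 1) \<and> X $ 3 $ 2 \<in> H p \<and> X $ 3 $ 3 \<in> H p"
  by (cases p) (simp_all add: mat_part_def forall_3)

lemma mat_hcomp_in: "mat_hcomp p X \<in> mat_part p"
  by (simp add: mat_part_def)

lemma mat_hcomp_sum: "mat_hcomp 0 X + mat_hcomp 1 X = X"
proof -
  have "hcomp q a + hcomp (1 + q) a = a" for q a
    using hcomp_sum[where a = a] by (cases q) (simp_all add: add.commute)
  then show ?thesis by (simp add: vec_eq_iff add.assoc)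
qed

lemma mat_part_submodule: "submodule (mat_part p) type_ring mat_lie"
  by (rule M.submoduleI') (auto simp: mat_part_def)

lemma mat_graded: "z2_graded mat_lie mat_part"
proof (rule M.z2_gradedI)
  show "submodule (mat_part p) type_ring mat_lie" for p by (rule mat_part_submodule)
  show "\<exists>x0\<in>mat_part 0. \<exists>x1\<in>mat_part 1. X = x0 \<oplus>\<^bsub>mat_lie\<^esub> x1" for X
    using mat_hcomp_in[where p = 0 and X = X] mat_hcomp_in[where p = 1 and X = X] mat_hcomp_sum[of X] by (metis mat_lie_simps(3))
  show "X = \<zero>\<^bsub>mat_lie\<^esub>" if "X \<in> mat_part 0" "X \<in> mat_part 1" for X
    using that by (auto simp: mat_part_iff mat_eq_iff intro: H_inter)
qed

lemma mat_hcomp_id: "X \<in> mat_part p \<Longrightarrow> mat_hcomp p X = X"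
  by (simp add: vec_eq_iff mat_part_def)

lemma mat_hcomp_other: "X \<in> mat_part (p + 1) \<Longrightarrow> mat_hcomp p X = 0"
  by (simp add: vec_eq_iff mat_part_def hcomp_other add.commute add.left_commute)

lemma mat_hcomp_simps:
  "mat_hcomp p (X + Y) = mat_hcomp p X + mat_hcomp p Y"
  "mat_hcomp p (c \<odot>\<^bsub>mat_lie\<^esub> X) = c \<odot>\<^bsub>mat_lie\<^esub> mat_hcomp p X"
  by (simp_all add: vec_eq_iff hcomp_add hcomp_scl)

lemma mat_mult_smult:
  "mat_mult (c \<odot>\<^bsub>mat_lie\<^esub> X) Y = c \<odot>\<^bsub>mat_lie\<^esub> mat_mult X Y"
  "mat_mult X (c \<odot>\<^bsub>mat_lie\<^esub> Y) = c \<odot>\<^bsub>mat_lie\<^esub> mat_mult X Y"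
  by (simp_all add: vec_eq_iff scl_mult_left scl_mult_right scl_simps)

lemma mat_bracket_expand: "mat_bracket X Y =
    mat_mult (mat_hcomp 0 X) (mat_hcomp 0 Y) - mat_mult (mat_hcomp 0 Y) (mat_hcomp 0 X) +
    (mat_mult (mat_hcomp 0 X) (mat_hcomp 1 Y) - mat_mult (mat_hcomp 1 Y) (mat_hcomp 0 X)) +
    (mat_mult (mat_hcomp 1 X) (mat_hcomp 0 Y) - mat_mult (mat_hcomp 0 Y) (mat_hcomp 1 X) +
    (mat_mult (mat_hcomp 1 X) (mat_hcomp 1 Y) + mat_mult (mat_hcomp 1 Y) (mat_hcomp 1 X)))"
  by (simp add: mat_bracket_def)

lemma mat_bracket_homogeneous:
  assumes "X \<in> mat_part p" "Y \<in> mat_part q"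
  shows "mat_bracket X Y = mat_mult X Y - sg (p * q) (mat_mult Y X)"
  using assms mat_hcomp_other[of X "p + 1"] mat_hcomp_other[of Y "q + 1"]
  by (cases p; cases q) (simp_all add: mat_bracket_expand mat_hcomp_id mat_mult_simps)

lemma mat_bracket_add:
  "mat_bracket (X + Y) Z = mat_bracket X Z + mat_bracket Y Z"
  "mat_bracket Z (X + Y) = mat_bracket Z X + mat_bracket Z Y"
  by (simp_all add: mat_bracket_expand mat_hcomp_simps mat_mult_simps)

lemma mat_smult_simps:
  "c \<odot>\<^bsub>mat_lie\<^esub> (X + Y) = c \<odot>\<^bsub>mat_lie\<^esub> X + c \<odot>\<^bsub>mat_lie\<^esub> Y"
  "c \<odot>\<^bsub>mat_lie\<^esub> (X - Y) = c \<odot>\<^bsub>mat_lie\<^esub> X - c \<odot>\<^bsub>mat_lie\<^esub> Y"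
  "c \<odot>\<^bsub>mat_lie\<^esub> (- X) = - (c \<odot>\<^bsub>mat_lie\<^esub> X)"
  by (simp_all add: vec_eq_iff scl_simps scl_diff scl_neg)

lemma mat_bracket_smult:
  "mat_bracket (c \<odot>\<^bsub>mat_lie\<^esub> X) Y = c \<odot>\<^bsub>mat_lie\<^esub> mat_bracket X Y"
  "mat_bracket X (c \<odot>\<^bsub>mat_lie\<^esub> Y) = c \<odot>\<^bsub>mat_lie\<^esub> mat_bracket X Y"
  by (simp_all add: mat_bracket_expand mat_hcomp_simps mat_mult_smult mat_smult_simps)

lemma mat_mult_part:
  assumes "X \<in> mat_part p" "Y \<in> mat_part q"
  shows "mat_mult X Y \<in> mat_part (p + q)"
proof -
  have "X $ i $ k * Y $ k $ j \<in> H (p + q + idx_deg i + idx_deg j)" for i j k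
    using mult_deg[OF mat_partD[OF assms(1), of i k] mat_partD[OF assms(2), of k j]]
    by (simp add: add_ac)
  then show ?thesis unfolding mat_part_def by (auto intro!: H_intros)
qed

lemma mat_part_sg: "X \<in> mat_part p \<Longrightarrow> sg q X \<in> mat_part p"
  by (cases q) (auto simp: mat_part_def)

lemma mat_part_diff: "\<lbrakk>X \<in> mat_part p; Y \<in> mat_part p\<rbrakk> \<Longrightarrow> X - Y \<in> mat_part p"
  by (auto simp: mat_part_def)

lemma mat_bracket_part:
  assumes "X \<in> mat_part p" "Y \<in> mat_part q"
  shows "mat_bracket X Y \<in> mat_part (p + q)"
  using mat_mult_part[OF assms] mat_mult_part[OF assms(2,1)]
  by (simp add: mat_bracket_homogeneous[OF assms] mat_part_sg mat_part_diff add.commute)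

lemma mat_jacobi:
  assumes X: "X \<in> mat_part p" and Y: "Y \<in> mat_part q" and Z: "Z \<in> mat_part r"
  shows "sg (p * r) (mat_bracket (mat_bracket X Y) Z) + sg (q * p) (mat_bracket (mat_bracket Y Z) X)
    + sg (r * q) (mat_bracket (mat_bracket Z X) Y) = 0"
proof -
  note b = mat_bracket_homogeneous[OF X Y] mat_bracket_homogeneous[OF Y Z] mat_bracket_homogeneous[OF Z X]
  note e = mat_bracket_homogeneous[OF mat_bracket_part[OF X Y] Z]
    mat_bracket_homogeneous[OF mat_bracket_part[OF Y Z] X]
    mat_bracket_homogeneous[OF mat_bracket_part[OF Z X] Y]
  show ?thesis unfolding e unfolding b
    by (cases p; cases q; cases r) (simp_all add: mat_mult_simps algebra_simps)
qed

lemma mat_lie_superalgebra: "lie_superalgebra mat_lie"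
proof (intro lie_superalgebra.intro lie_superalgebra_axioms.intro mat_module)
  show "z2_graded mat_lie (part mat_lie)" by (simp add: mat_graded)
qed (simp_all add: mat_bracket_add mat_bracket_smult mat_bracket_part mat_jacobi mat_msg,
    auto simp: mat_bracket_homogeneous mult.commute sg_def split: if_splits)

sublocale M: lie_superalgebra mat_lie
  by (rule mat_lie_superalgebra)

subsection \<open>The orthosymplectic Lie superalgebra\<close>

text \<open>The conditions on mirror entries are equivalent to each other; both are listed so that
  \<open>bar\<close> of each of the nine entries can be rewritten.\<close>

lemma osp_skew_iff: "X \<in> osp_skew \<longleftrightarrow>
  bar (X $ 1 $ 1) = - X $ 1 $ 1 \<and> bar (X $ 1 $ 2) = rho (X $ 3 $ 1) \<and> bar (X $ 3 $ 1) = rho (X $ 1 $ 2) \<and>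
  bar (X $ 2 $ 1) = - rho (X $ 1 $ 3) \<and> bar (X $ 1 $ 3) = - rho (X $ 2 $ 1) \<and>
  bar (X $ 2 $ 2) = - X $ 3 $ 3 \<and> bar (X $ 3 $ 3) = - X $ 2 $ 2 \<and>
  bar (X $ 2 $ 3) = X $ 2 $ 3 \<and> bar (X $ 3 $ 2) = X $ 3 $ 2"
proof -
  have 1: "rho (bar a) = b \<longleftrightarrow> bar a = rho b" for a b using rho_rho by metis
  have 2: "- rho (bar a) = - b \<longleftrightarrow> bar a = rho b" "rho (bar a) = - b \<longleftrightarrow> bar a = - rho b" for a b
    using 1[of a b] 1[of a "- b"] by (simp_all add: rho_simps)
  show ?thesis
    unfolding osp_skew_def osp_inv_def mat_eq_iff mem_Collect_eq vector_3 vector_minus_component rho_simps(6) 2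
    by (auto simp: 1 2 rho_simps(3))
qed

lemma osp_skew_homogeneous:
  assumes "X \<in> mat_part p"
  shows "X \<in> osp_skew \<longleftrightarrow>
  bar (X $ 1 $ 1) = - X $ 1 $ 1 \<and> bar (X $ 1 $ 2) = sg (p + 1) (X $ 3 $ 1) \<and>
  bar (X $ 3 $ 1) = sg (p + 1) (X $ 1 $ 2) \<and>
  bar (X $ 2 $ 1) = - sg (p + 1) (X $ 1 $ 3) \<and> bar (X $ 1 $ 3) = - sg (p + 1) (X $ 2 $ 1) \<and>
  bar (X $ 2 $ 2) = - X $ 3 $ 3 \<and> bar (X $ 3 $ 3) = - X $ 2 $ 2 \<and>
  bar (X $ 2 $ 3) = X $ 2 $ 3 \<and> bar (X $ 3 $ 2) = X $ 3 $ 2"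
  using assms unfolding osp_skew_iff mat_part_iff
  by (elim conjE) (simp only: rho_homogeneous)

lemma osp_skew_submodule: "submodule osp_skew type_ring mat_lie"
  by (rule M.submoduleI') (auto simp: osp_skew_iff bar_add rho_simps bar_scl scl_neg)

lemma osp_skew_hcomp: "X \<in> osp_skew \<Longrightarrow> mat_hcomp p X \<in> osp_skew"
  unfolding osp_skew_iff by (cases p) (simp_all add: hcomp_neg hcomp_rho rho_homogeneous[OF hcomp_in] flip: hcomp_bar)

lemma bar_mat_mult:
  assumes "X \<in> mat_part p" "Y \<in> mat_part q"
  shows "bar (X $ i $ k * Y $ k $ j) =
    sg ((p + idx_deg i + idx_deg k) * (q + idx_deg k + idx_deg j)) (bar (Y $ k $ j) * bar (X $ i $ k))"
  by (rule bar_mult[OF mat_partD[OF assms(1)] mat_partD[OF assms(2)]])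

lemma osp_skew_bracket_homogeneous:
  assumes X: "X \<in> mat_part p" "X \<in> osp_skew" and Y: "Y \<in> mat_part q" "Y \<in> osp_skew"
  shows "mat_bracket X Y \<in> osp_skew"
proof -
  note e = X(2)[unfolded osp_skew_homogeneous[OF X(1)]] Y(2)[unfolded osp_skew_homogeneous[OF Y(1)]]
  show ?thesis
    unfolding osp_skew_homogeneous[OF mat_bracket_part[OF X(1) Y(1)]]
    unfolding mat_bracket_homogeneous[OF X(1) Y(1)]
    using e by (cases p; cases q)
      (simp_all add: bar_add bar_diff bar_neg bar_mat_mult[OF X(1) Y(1)] bar_mat_mult[OF Y(1) X(1)] algebra_simps)
qed

lemma osp_skew_bracket: "\<lbrakk>X \<in> osp_skew; Y \<in> osp_skew\<rbrakk> \<Longrightarrow> mat_bracket X Y \<in> osp_skew"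
proof -
  assume XY: "X \<in> osp_skew" "Y \<in> osp_skew"
  have "mat_bracket (mat_hcomp p X) (mat_hcomp q Y) \<in> osp_skew" for p q
    by (rule osp_skew_bracket_homogeneous[OF mat_hcomp_in _ mat_hcomp_in]; rule osp_skew_hcomp; fact)
  then have "mat_bracket (mat_hcomp 0 X + mat_hcomp 1 X) (mat_hcomp 0 Y + mat_hcomp 1 Y) \<in> osp_skew"
    using M.submoduleE(5)[OF osp_skew_submodule] by (simp add: mat_bracket_add)
  then show ?thesis by (simp add: mat_hcomp_sum)
qed

definition osp_set :: "('r^3^3) set"
  where "osp_set = lin_span mat_lie {mat_bracket X Y | X Y. X \<in> osp_skew \<and> Y \<in> osp_skew}"

lemma osp_set_submodule: "submodule osp_set type_ring mat_lie"
  unfolding osp_set_def by (rule M.lin_span_submodule) simp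

lemma osp_set_skew: "X \<in> osp_set \<Longrightarrow> X \<in> osp_skew"
  unfolding osp_set_def
  by (rule subsetD[OF M.lin_span_least[OF osp_skew_submodule]]) (auto simp: osp_skew_bracket)

lemma bracket_osp_set: "\<lbrakk>X \<in> osp_skew; Y \<in> osp_skew\<rbrakk> \<Longrightarrow> mat_bracket X Y \<in> osp_set"
  unfolding osp_set_def by (rule M.lin_span_incl) blast

lemma osp_set_induct [consumes 1, case_names bracket zero add smult]:
  assumes "X \<in> osp_set"
    and "\<And>X Y. \<lbrakk>X \<in> osp_skew; Y \<in> osp_skew\<rbrakk> \<Longrightarrow> P (mat_bracket X Y)" "P 0"
    and "\<And>X Y. \<lbrakk>P X; P Y\<rbrakk> \<Longrightarrow> P (X + Y)" "\<And>c X. P X \<Longrightarrow> P (c \<odot>\<^bsub>mat_lie\<^esub> X)"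
  shows "P X"
  using assms(1) unfolding osp_set_def
  by (rule M.lin_span_induct) (use assms(2-) in auto)

lemma mat_hcomp_zero [simp]: "mat_hcomp p 0 = 0"
  by (simp add: vec_eq_iff)

text \<open>The brackets spanning the derived algebra have arbitrary arguments. Since
  \<open>osp_skew\<close> contains the components of its elements, expanding both arguments writes
  such a bracket as a sum of homogeneous brackets of the same kind.\<close>

lemma osp_set_hcomp: "X \<in> osp_set \<Longrightarrow> mat_hcomp p X \<in> osp_set"
proof (induction rule: osp_set_induct)
  case (bracket X Y)
  define Z where "Z = mat_bracket X Y"
  have XY: "Z = mat_bracket X Y" "X \<in> osp_skew" "Y \<in> osp_skew" using bracket by (simp_all add: Z_def)
  let ?B = "\<lambda>p q. mat_bracket (mat_hcomp p X) (mat_hcomp q Y)"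
  have B: "?B q r \<in> mat_part (q + r)" "?B q r \<in> osp_set" for q r
    using XY by (auto intro: mat_bracket_part mat_hcomp_in bracket_osp_set osp_skew_hcomp)
  have "Z = ?B 0 0 + ?B 0 1 + (?B 1 0 + ?B 1 1)"
    unfolding XY(1) by (simp add: mat_hcomp_sum flip: mat_bracket_add)
  then have "mat_hcomp p Z = mat_hcomp p (?B 0 0) + mat_hcomp p (?B 0 1) + (mat_hcomp p (?B 1 0) + mat_hcomp p (?B 1 1))"
    by (simp add: mat_hcomp_simps)
  moreover have "mat_hcomp p (?B q r) \<in> osp_set" for q r
  proof (cases "p = q + r")
    case True then show ?thesis using B by (simp add: mat_hcomp_id)
  next
    case False
    then have "q + r = p + 1" by (cases p; cases "q + r") auto
    with B(1)[of q r] have "?B q r \<in> mat_part (p + 1)" by simp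
    from mat_hcomp_other[OF this] show ?thesis using M.submodule_zero[OF osp_set_submodule] by simp
  qed
  ultimately show ?case
    using M.submoduleE(5)[OF osp_set_submodule] unfolding XY(1)[symmetric] by simp
qed (use M.submodule_zero[OF osp_set_submodule] M.submoduleE(4,5)[OF osp_set_submodule] in
    \<open>simp_all add: mat_hcomp_simps\<close>)

lemma osp_eq: "osp = mat_lie\<lparr>carrier := osp_set, part := \<lambda>p. part mat_lie p \<inter> osp_set\<rparr>"
  by (simp add: osp_def osp_set_def Let_def)

lemma osp_lie_superalgebra: "lie_superalgebra osp"
  unfolding osp_eq
proof (rule M.subalgebra[OF osp_set_submodule])
  fix X Y assume "X \<in> osp_set" "Y \<in> osp_set"
  then show "bracket mat_lie X Y \<in> osp_set" by (simp add: bracket_osp_set osp_set_skew)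
next
  fix X assume "X \<in> osp_set"
  then show "\<exists>x0\<in>part mat_lie 0 \<inter> osp_set. \<exists>x1\<in>part mat_lie 1 \<inter> osp_set. X = x0 \<oplus>\<^bsub>mat_lie\<^esub> x1"
    by (intro bexI[of _ "mat_hcomp 0 X"] bexI[of _ "mat_hcomp 1 X"])
      (auto simp: mat_hcomp_sum mat_hcomp_in osp_set_hcomp)
qed

sublocale O: lie_superalgebra osp
  by (rule osp_lie_superalgebra)

lemma osp_simps [simp]:
  "carrier osp = osp_set" "\<zero>\<^bsub>osp\<^esub> = 0" "X \<oplus>\<^bsub>osp\<^esub> Y = X + Y" "bracket osp = mat_bracket"
  "part osp p = mat_part p \<inter> osp_set" "smult osp = smult mat_lie"
  by (simp_all add: osp_eq)

lemma osp_neg [simp]: "X \<in> osp_set \<Longrightarrow> \<ominus>\<^bsub>osp\<^esub> X = - X"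
  using O.smult_minus1[of X] M.smult_minus1[of X] by simp

lemma mat_unit_nth [simp]: "mat_unit i j a $ k $ l = (if k = i \<and> l = j then a else 0)"
  by (simp add: mat_unit_def)

lemma osp_gen_nth [simp]:
  "osp_v a $ i $ j = (if i = 2 \<and> j = 3 then tr a else 0)"
  "osp_w a $ i $ j = (if i = 3 \<and> j = 2 then tr a else 0)"
  "osp_f a $ i $ j = (if i = 1 \<and> j = 2 then a else if i = 3 \<and> j = 1 then rho (bar a) else 0)"
  "osp_g a $ i $ j = (if i = 2 \<and> j = 1 then a else if i = 1 \<and> j = 3 then - rho (bar a) else 0)"
  by (simp_all add: osp_v_def osp_w_def osp_f_def osp_g_def)

lemma osp_gen_linear:
  "osp_v (a + b) = osp_v a + osp_v b" "osp_w (a + b) = osp_w a + osp_w b"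
  "osp_f (a + b) = osp_f a + osp_f b" "osp_g (a + b) = osp_g a + osp_g b"
  "osp_v (scl c a) = c \<odot>\<^bsub>mat_lie\<^esub> osp_v a" "osp_w (scl c a) = c \<odot>\<^bsub>mat_lie\<^esub> osp_w a"
  "osp_f (scl c a) = c \<odot>\<^bsub>mat_lie\<^esub> osp_f a" "osp_g (scl c a) = c \<odot>\<^bsub>mat_lie\<^esub> osp_g a"
  "osp_v (bar a) = osp_v a" "osp_w (bar a) = osp_w a"
  by (simp_all add: mat_eq_iff tr_simps bar_add bar_scl rho_simps(1-5) scl_neg)

lemma osp_gen_neg:
  "osp_v (- a) = - osp_v a" "osp_w (- a) = - osp_w a" "osp_f (- a) = - osp_f a" "osp_g (- a) = - osp_g a"
  by (simp_all add: mat_eq_iff tr_simps bar_neg rho_simps(1-5))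

lemma osp_gen_part:
  assumes "a \<in> H p"
  shows "osp_v a \<in> mat_part p" "osp_w a \<in> mat_part p" "osp_f a \<in> mat_part (p + 1)" "osp_g a \<in> mat_part (p + 1)"
  using assms by (simp_all add: mat_part_iff tr_deg rho_homogeneous bar_deg add.assoc)

lemma osp_gen_skew: "osp_v a \<in> osp_skew" "osp_w a \<in> osp_skew" "osp_f a \<in> osp_skew" "osp_g a \<in> osp_skew"
  by (simp_all add: osp_skew_iff tr_simps rho_simps bar_neg)

lemma osp_rel_homogeneous:
  assumes a: "a \<in> H p" and b: "b \<in> H q"
  shows "mat_bracket (osp_v a) (osp_v b) = 0" "mat_bracket (osp_w a) (osp_w b) = 0"
    "mat_bracket (osp_v a) (osp_g b) = 0" "mat_bracket (osp_f a) (osp_w b) = 0"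
    "mat_bracket (osp_v a) (osp_f b) = osp_g (sg q (tr a * bar b))"
    "mat_bracket (osp_g a) (osp_w b) = osp_f (- sg p (bar a * tr b))"
    "mat_bracket (osp_f a) (osp_f b) = osp_w (sg p (bar a * b))"
    "mat_bracket (osp_g a) (osp_g b) = osp_v (- sg q (a * bar b))"
proof -
  note m = mat_bracket_homogeneous
  note da = osp_gen_part[OF a] and db = osp_gen_part[OF b]
  have r: "rho (bar a) = sg p (bar a)" "rho (bar b) = sg q (bar b)"
    using a b by (simp_all add: rho_homogeneous bar_deg)
  have t: "tr a \<in> H p" "tr b \<in> H q" "bar a \<in> H p" "bar b \<in> H q" using a b by auto
  have r': "rho (tr a * bar b) = sg (p + q) (tr a * bar b)" "rho (bar a * tr b) = sg (p + q) (bar a * tr b)"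
    using t by (simp_all add: rho_homogeneous mult_deg)
  have br: "bar (tr a * bar b) = sg (p * q) (b * tr a)" "bar (bar a * tr b) = sg (p * q) (tr b * a)"
    "bar (bar a * b) = sg (p * q) (bar b * a)" "bar (a * bar b) = sg (p * q) (b * bar a)"
    using bar_mult[OF t(1,4)] bar_mult[OF t(3,2)] bar_mult[OF t(3) b] bar_mult[OF a t(4)]
    by (simp_all add: tr_simps)
  have rb: "rho (b * tr a) = sg (p + q) (b * tr a)" "rho (tr b * a) = sg (p + q) (tr b * a)"
    using mult_deg[OF b t(1)] mult_deg[OF t(2) a] by (simp_all add: rho_homogeneous add.commute)
  show "mat_bracket (osp_v a) (osp_v b) = 0" "mat_bracket (osp_w a) (osp_w b) = 0"
    by (simp_all add: m[OF da(1) db(1)] m[OF da(2) db(2)] mat_eq_iff sg_def)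
  show "mat_bracket (osp_v a) (osp_g b) = 0" "mat_bracket (osp_f a) (osp_w b) = 0"
    by (simp_all add: m[OF da(1) db(4)] m[OF da(3) db(2)] mat_eq_iff sg_def)
  show "mat_bracket (osp_v a) (osp_f b) = osp_g (sg q (tr a * bar b))"
    by (cases p; cases q) (simp_all add: m[OF da(1) db(3)] mat_eq_iff r r' br rb bar_neg rho_simps(1-5))
  show "mat_bracket (osp_g a) (osp_w b) = osp_f (- sg p (bar a * tr b))"
    by (cases p; cases q) (simp_all add: m[OF da(4) db(2)] mat_eq_iff r r' br rb bar_neg rho_simps(1-5))
  show "mat_bracket (osp_f a) (osp_f b) = osp_w (sg p (bar a * b))"
    by (cases p; cases q) (simp_all add: m[OF da(3) db(3)] mat_eq_iff r br bar_neg tr_def)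
  show "mat_bracket (osp_g a) (osp_g b) = osp_v (- sg q (a * bar b))"
    by (cases p; cases q) (simp_all add: m[OF da(4) db(4)] mat_eq_iff r br bar_neg tr_def)
qed

text \<open>\<open>dg x y\<close> with \<open>bar x = - x\<close> is the diagonal part of an element of \<open>osp_skew\<close>.\<close>

definition dg :: "'r \<Rightarrow> 'r \<Rightarrow> 'r^3^3"
  where "dg x y = mat_unit 1 1 x + mat_unit 2 2 y - mat_unit 3 3 (bar y)"

lemma dg_nth [simp]:
  "dg x y $ i $ j = (if i = 1 \<and> j = 1 then x else if i = 2 \<and> j = 2 then y else if i = 3 \<and> j = 3 then - bar y else 0)"
  by (simp add: dg_def)

lemma dg_linear: "dg (x + x') (y + y') = dg x y + dg x' y'" "dg (x - x') (y - y') = dg x y - dg x' y'"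
  "dg (scl c x) (scl c y) = c \<odot>\<^bsub>mat_lie\<^esub> dg x y"
  by (simp_all add: mat_eq_iff bar_add bar_diff bar_scl scl_neg)

lemma dg_part: "\<lbrakk>x \<in> H p; y \<in> H p\<rbrakk> \<Longrightarrow> dg x y \<in> mat_part p"
  by (simp add: mat_part_iff bar_deg)

lemma osp_fg:
  assumes a: "a \<in> H p" and b: "b \<in> H q"
  shows "mat_bracket (osp_f a) (osp_g b) = dg (a * b - bar (a * b)) (sg (p * q + p + q) (b * a))"
proof -
  have r: "rho (bar a) = sg p (bar a)" "rho (bar b) = sg q (bar b)"
    using a b by (simp_all add: rho_homogeneous bar_deg)
  show ?thesis
    by (cases p; cases q)
      (simp_all add: mat_bracket_homogeneous[OF osp_gen_part(3)[OF a] osp_gen_part(4)[OF b]]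
        mat_eq_iff r bar_mult[OF a b] bar_mult[OF b a] bar_neg)
qed

lemma dg_bracket:
  assumes x: "x \<in> H n" and y: "y \<in> H n" and c: "c \<in> H r" and bx: "bar x = - x"
  shows "mat_bracket (dg x y) (osp_f c) = osp_f (x * c - sg (n * r + n) (c * y))"
    "mat_bracket (dg x y) (osp_g c) = osp_g (y * c - sg (n * r + n) (c * x))"
    "mat_bracket (dg x y) (osp_v c) = osp_v (y * tr c)"
proof -
  have r: "rho (bar c) = sg r (bar c)" using c by (simp add: rho_homogeneous bar_deg)
  have r2: "rho (bar c * x) = sg (n + r) (bar c * x)" "rho (bar y * bar c) = sg (n + r) (bar y * bar c)"
    "rho (bar c * bar y) = sg (n + r) (bar c * bar y)" "rho (x * bar c) = sg (n + r) (x * bar c)"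
    using mult_deg[OF x bar_deg[OF c]] mult_deg[OF bar_deg[OF c] x]
      mult_deg[OF bar_deg[OF c] bar_deg[OF y]] mult_deg[OF bar_deg[OF y] bar_deg[OF c]]
    by (simp_all add: rho_homogeneous add.commute)
  note b = bar_mult[OF x c] bar_mult[OF c y] bar_mult[OF y c] bar_mult[OF c x]
  note m = mat_bracket_homogeneous[OF dg_part[OF x y] osp_gen_part(3)[OF c]]
    mat_bracket_homogeneous[OF dg_part[OF x y] osp_gen_part(4)[OF c]]
    mat_bracket_homogeneous[OF dg_part[OF x y] osp_gen_part(1)[OF c]]
  show "mat_bracket (dg x y) (osp_f c) = osp_f (x * c - sg (n * r + n) (c * y))"
    by (cases n; cases r)
      (simp_all add: m mat_eq_iff r bar_diff bar_add rho_simps(1-5) r2 b bx bar_neg)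
  show "mat_bracket (dg x y) (osp_g c) = osp_g (y * c - sg (n * r + n) (c * x))"
    by (cases n; cases r)
      (simp_all add: m mat_eq_iff r bar_diff bar_add rho_simps(1-5) r2 b bx bar_neg)
  show "mat_bracket (dg x y) (osp_v c) = osp_v (y * tr c)"
    using bar_mult[OF y tr_deg[OF c]]
    by (cases n; cases r) (simp_all add: m mat_eq_iff tr_def[of "y * _"] tr_simps)
qed

lemma bar_anti_skew: "bar (x - bar x) = - (x - bar x)"
  by (simp add: bar_diff)

lemma osp_rel_triple:
  assumes a: "a \<in> H p" and b: "b \<in> H q" and c: "c \<in> H r"
  shows "mat_bracket (mat_bracket (osp_f a) (osp_g b)) (osp_f c) =
      osp_f (a * b * c - bar (a * b) * c - sg (p * q + q * r + r * p) (c * b * a))"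
    "mat_bracket (mat_bracket (osp_f a) (osp_g b)) (osp_g c) =
      osp_g (sg (p * q + p + q) (b * a) * c - sg ((p + q) * r + p + q) (c * (a * b - bar (a * b))))"
    "mat_bracket (mat_bracket (osp_f a) (osp_g b)) (osp_v c) = osp_v (sg (p * q + p + q) (b * a) * tr c)"
    "mat_bracket (osp_g c) (mat_bracket (osp_f a) (osp_g b)) =
      osp_g (c * a * b - c * bar (a * b) - sg (r * p + p * q + q * r) (b * a * c))"
proof -
  have x: "a * b - bar (a * b) \<in> H (p + q)" and y: "sg (p * q + p + q) (b * a) \<in> H (p + q)"
    using mult_deg[OF a b] mult_deg[OF b a] by (auto simp: add.commute)
  note d = dg_bracket[OF x y c bar_anti_skew]
  show "mat_bracket (mat_bracket (osp_f a) (osp_g b)) (osp_f c) =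
      osp_f (a * b * c - bar (a * b) * c - sg (p * q + q * r + r * p) (c * b * a))"
    using d(1) unfolding osp_fg[OF a b]
    by (cases p; cases q; cases r) (simp_all add: bar_anti_skew algebra_simps)
  show 2: "mat_bracket (mat_bracket (osp_f a) (osp_g b)) (osp_g c) =
      osp_g (sg (p * q + p + q) (b * a) * c - sg ((p + q) * r + p + q) (c * (a * b - bar (a * b))))"
    using d(2) unfolding osp_fg[OF a b] by (simp add: bar_anti_skew add.assoc)
  show "mat_bracket (mat_bracket (osp_f a) (osp_g b)) (osp_v c) = osp_v (sg (p * q + p + q) (b * a) * tr c)"
    using d(3) unfolding osp_fg[OF a b] .
  have h: "mat_bracket (osp_f a) (osp_g b) \<in> mat_part (p + q)"
    unfolding osp_fg[OF a b] by (rule dg_part[OF x y])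
  have "mat_bracket (osp_g c) (mat_bracket (osp_f a) (osp_g b)) =
      - sg ((r + 1) * (p + q)) (mat_bracket (mat_bracket (osp_f a) (osp_g b)) (osp_g c))"
    using M.super_skew[of "osp_g c" "r + 1" _ "p + q"] h osp_gen_part(4)[OF c] by simp
  then show "mat_bracket (osp_g c) (mat_bracket (osp_f a) (osp_g b)) =
      osp_g (c * a * b - c * bar (a * b) - sg (r * p + p * q + q * r) (b * a * c))"
    unfolding 2 by (cases p; cases q; cases r) (simp_all add: algebra_simps flip: osp_gen_neg)
qed

text \<open>The relations with right-hand side \<open>Zero\<close> are imposed on arbitrary
  elements, so the homogeneous computation is extended by additivity in each argument.\<close>

lemma osp_rel_zero:
  "mat_bracket (osp_v a) (osp_v b) = 0" "mat_bracket (osp_w a) (osp_w b) = 0"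
  "mat_bracket (osp_v a) (osp_g b) = 0" "mat_bracket (osp_f a) (osp_w b) = 0"
proof -
  have *: "mat_bracket (F a) (G b) = 0"
    if "\<And>a b p q. \<lbrakk>a \<in> H p; b \<in> H q\<rbrakk> \<Longrightarrow> mat_bracket (F a) (G b) = 0"
      "\<And>a b. F (a + b) = F a + F b" "\<And>a b. G (a + b) = G a + G b" for F G :: "'r \<Rightarrow> 'r^3^3"
  proof (rule H_cases_add[where a = a])
    fix a p assume a: "a \<in> H p"
    show "mat_bracket (F a) (G b) = 0"
      by (rule H_cases_add[where a = b]) (simp_all add: that(1)[OF a] that(3) mat_bracket_add)
  qed (simp_all add: that(2) mat_bracket_add)
  show "mat_bracket (osp_v a) (osp_v b) = 0" "mat_bracket (osp_w a) (osp_w b) = 0"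
    "mat_bracket (osp_v a) (osp_g b) = 0" "mat_bracket (osp_f a) (osp_w b) = 0"
    by (rule *; (rule osp_rel_homogeneous osp_gen_linear)?; assumption?)+
qed

text \<open>Written as a bracket, this element visibly lies in the derived algebra, and therefore
  has a lift to every central extension of \<open>osp\<close>.\<close>

definition h0 :: "'r^3^3" where "h0 = mat_bracket (osp_f 1) (osp_g 1)"

lemma h0_eq: "h0 = dg 0 1"
  unfolding h0_def osp_fg[OF one_H0 one_H0] by simp

lemma h0_nth [simp]: "h0 $ i $ j = (if i = 2 \<and> j = 2 then 1 else if i = 3 \<and> j = 3 then - 1 else 0)"
  by (auto simp: h0_eq)

lemma h0_part: "h0 \<in> mat_part 0"
  unfolding h0_eq by (rule dg_part) auto

lemma h0_skew: "h0 \<in> osp_skew"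
  unfolding h0_def by (intro osp_skew_bracket osp_gen_skew)

lemma h0_bracket: "mat_bracket h0 X = mat_mult h0 X - mat_mult X h0"
proof -
  have "mat_hcomp 0 h0 = h0" "mat_hcomp 1 h0 = 0"
    using h0_part by (simp_all add: mat_hcomp_id mat_hcomp_other)
  then have "mat_bracket h0 X = mat_mult h0 (mat_hcomp 0 X + mat_hcomp 1 X) - mat_mult (mat_hcomp 0 X + mat_hcomp 1 X) h0"
    by (simp add: mat_bracket_expand mat_mult_simps algebra_simps)
  then show ?thesis by (simp add: mat_hcomp_sum)
qed

lemma h0_gen:
  "mat_bracket h0 (osp_v a) = osp_v a + osp_v a" "mat_bracket h0 (osp_w a) = - (osp_w a + osp_w a)"
  "mat_bracket h0 (osp_f a) = - osp_f a" "mat_bracket h0 (osp_g a) = osp_g a"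
  by (simp_all add: h0_bracket mat_eq_iff)

lemma osp_setD:
  "0 \<in> osp_set" "\<lbrakk>X \<in> osp_set; Y \<in> osp_set\<rbrakk> \<Longrightarrow> X + Y \<in> osp_set"
  "X \<in> osp_set \<Longrightarrow> - X \<in> osp_set" "X \<in> osp_set \<Longrightarrow> c \<odot>\<^bsub>mat_lie\<^esub> X \<in> osp_set"
  using M.submodule_zero[OF osp_set_submodule] M.submoduleE(3-5)[OF osp_set_submodule] by auto

lemma mat_smult_hf: "hf \<odot>\<^bsub>mat_lie\<^esub> (X + X) = X"
  by (simp add: vec_eq_iff scl_hf)

text \<open>Bracketing with \<open>h0\<close> multiplies each of these matrices by a unit, so they
  are scalar multiples of brackets in \<open>osp_skew\<close>.\<close>

lemma osp_gen_in: "osp_v a \<in> osp_set" "osp_w a \<in> osp_set" "osp_f a \<in> osp_set" "osp_g a \<in> osp_set" "h0 \<in> osp_set"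
proof -
  have b: "mat_bracket h0 X \<in> osp_set" if "X \<in> osp_skew" for X
    by (rule bracket_osp_set[OF h0_skew that])
  show "osp_g a \<in> osp_set" using b[OF osp_gen_skew(4)[of a]] by (simp add: h0_gen)
  show "osp_f a \<in> osp_set" using osp_setD(3)[OF b[OF osp_gen_skew(3)[of a]]] by (simp add: h0_gen)
  show "osp_v a \<in> osp_set"
    using osp_setD(4)[OF b[OF osp_gen_skew(1)[of a]], of hf] by (simp add: h0_gen mat_smult_hf)
  show "osp_w a \<in> osp_set"
    using osp_setD(4)[OF osp_setD(3)[OF b[OF osp_gen_skew(2)[of a]]], of hf]
    by (simp only: h0_gen minus_minus mat_smult_hf)
  show "h0 \<in> osp_set" unfolding h0_def by (intro bracket_osp_set osp_gen_skew)
qed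

subsection \<open>The matrices generated by the \<open>f\<close> and \<open>g\<close>\<close>

text \<open>
  \<open>T\<close> measures how far \<open>osp\<close> is from all of \<open>osp_skew\<close>: an element \<open>X\<close> of \<open>osp_skew\<close> lies in \<open>osp\<close>
  if and only if \<open>X\<^sub>1\<^sub>1 - rho (X\<^sub>2\<^sub>2 - bar X\<^sub>2\<^sub>2)\<close> lies in \<open>T\<close>.  The sign \<open>rho\<close> comes from the parity of
  the index \<open>2\<close>.
\<close>

definition com :: "bit \<Rightarrow> 'r \<Rightarrow> 'r \<Rightarrow> 'r" where "com e a b = a * b - sg e (b * a)"

definition T :: "'r set"
  where "T = lin_span (alg_module scl) {d - bar d | a b p q d. a \<in> H p \<and> b \<in> H q \<and> d = com (p * q) a b}"

lemma T_submodule: "submodule T type_ring (alg_module scl)"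
  unfolding T_def by (rule A.lin_span_submodule) simp

lemmas T_intros = submodule_algD(1-6)[OF T_submodule]

lemma com_T: "\<lbrakk>a \<in> H p; b \<in> H q; e = p * q\<rbrakk> \<Longrightarrow> com e a b - bar (com e a b) \<in> T"
  unfolding T_def by (rule A.lin_span_incl) blast

text \<open>For a skew commutator \<open>d\<close> the generator \<open>d - bar d\<close> of
  \<open>T\<close> equals \<open>2 d\<close>, and 2 is a unit.\<close>

lemma com_T_skew: "\<lbrakk>a \<in> H p; b \<in> H q; e = p * q; bar (com e a b) = - com e a b\<rbrakk> \<Longrightarrow> com e a b \<in> T"
  using T_intros(5)[OF com_T[of a p b q e], of hf] by (simp add: scl_hf)

lemma T_induct [consumes 1, case_names com zero add smult]:
  assumes "x \<in> T"
    "\<And>a b p q. \<lbrakk>a \<in> H p; b \<in> H q\<rbrakk> \<Longrightarrow> P (com (p * q) a b - bar (com (p * q) a b))"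
    "P 0" "\<And>x y. \<lbrakk>P x; P y\<rbrakk> \<Longrightarrow> P (x + y)" "\<And>c x. P x \<Longrightarrow> P (scl c x)"
  shows "P x"
  using assms(1) unfolding T_def by (rule A.lin_span_induct) (use assms(2-) in auto)

text \<open>Since \<open>Z $ 3 $ 3 = - bar (Z $ 2 $ 2)\<close>, the expression is the supertrace of
  \<open>Z\<close>. In the supertrace of a bracket the products of entries pair up to
  supercommutators, and the skew-symmetry of \<open>X\<close> and \<open>Y\<close> brings these into
  the form required by \<open>T\<close>.\<close>

lemma osp_bracket_T_homogeneous:
  assumes X: "X \<in> mat_part p" "X \<in> osp_skew" and Y: "Y \<in> mat_part q" "Y \<in> osp_skew"
  defines "Z \<equiv> mat_bracket X Y"
  shows "Z $ 1 $ 1 - sg (p + q) (Z $ 2 $ 2 - bar (Z $ 2 $ 2)) \<in> T"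
proof -
  note e = X(2)[unfolded osp_skew_homogeneous[OF X(1)]] Y(2)[unfolded osp_skew_homogeneous[OF Y(1)]]
  note dX = X(1)[unfolded mat_part_iff] and dY = Y(1)[unfolded mat_part_iff]
  note bm = bar_mat_mult[OF X(1) Y(1)] bar_mat_mult[OF Y(1) X(1)]
  have z: "Z = mat_mult X Y - sg (p * q) (mat_mult Y X)"
    unfolding Z_def by (rule mat_bracket_homogeneous[OF X(1) Y(1)])
  \<comment> \<open>One product of each commutator comes from \<open>mat_mult X Y\<close>, the other
    from \<open>mat_mult Y X\<close>. Entries such as \<open>X $ 1 $ 3\<close> and
    \<open>Y $ 3 $ 1\<close> are, up to sign, conjugates of \<open>X $ 2 $ 1\<close> and
    \<open>Y $ 1 $ 2\<close>; this is how \<open>d6\<close> enters.\<close>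
  define d1 where "d1 = com (p * q) (X $ 1 $ 1) (Y $ 1 $ 1)"
  define d2 where "d2 = com ((p + 1) * (q + 1)) (X $ 1 $ 2) (Y $ 2 $ 1)"
  define d3 where "d3 = com (p * q) (X $ 2 $ 2) (Y $ 2 $ 2)"
  define d4 where "d4 = com (p * q) (X $ 2 $ 3) (Y $ 3 $ 2)"
  define d5 where "d5 = com (q * p) (Y $ 2 $ 3) (X $ 3 $ 2)"
  define d6 where "d6 = com ((q + 1) * (p + 1)) (Y $ 1 $ 2) (X $ 2 $ 1)"
  have "bar d1 = - d1" "bar d4 = - d4" "bar d5 = - d5"
    unfolding d1_def d4_def d5_def com_def
    by (cases p; cases q; use e in \<open>simp add: bar_diff bar_add bm\<close>)+
  then have "d1 \<in> T" "d4 \<in> T" "d5 \<in> T"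
    unfolding d1_def d4_def d5_def using dX dY by (auto intro: com_T_skew)
  moreover have "d2 - bar d2 \<in> T" "d3 - bar d3 \<in> T" "d6 - bar d6 \<in> T"
    unfolding d2_def d3_def d6_def using dX dY by (auto intro: com_T)
  ultimately have "d1 + (d2 - bar d2) - sg (p * q) (d6 - bar d6)
      - sg (p + q) (d3 - bar d3 + d4 - sg (p * q) d5) \<in> T"
    by (blast intro: T_intros(4)[OF T_intros(4)[OF T_intros(2) T_intros(6)]
          T_intros(6)[OF T_intros(4)[OF T_intros(2) T_intros(6)]]])
  also have "d1 + (d2 - bar d2) - sg (p * q) (d6 - bar d6) - sg (p + q) (d3 - bar d3 + d4 - sg (p * q) d5)
      = Z $ 1 $ 1 - sg (p + q) (Z $ 2 $ 2 - bar (Z $ 2 $ 2))"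
    unfolding z d1_def d2_def d3_def d4_def d5_def d6_def com_def using e
    by (cases p; cases q) (simp_all add: bar_add bar_diff bar_neg bm algebra_simps)
  finally show ?thesis .
qed

lemma osp_bracket_T:
  assumes "X \<in> osp_skew" "Y \<in> osp_skew"
  shows "mat_bracket X Y $ 1 $ 1 - rho (mat_bracket X Y $ 2 $ 2 - bar (mat_bracket X Y $ 2 $ 2)) \<in> T"
proof -
  let ?P = "\<lambda>Z :: 'r^3^3. Z $ 1 $ 1 - rho (Z $ 2 $ 2 - bar (Z $ 2 $ 2)) \<in> T"
  have add: "?P (Z + Z')" if "?P Z" "?P Z'" for Z Z'
    using T_intros(2)[OF that] by (simp add: bar_add rho_simps algebra_simps)
  have "?P (mat_bracket (mat_hcomp p X) (mat_hcomp q Y))" for p q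
  proof -
    note h = mat_hcomp_in[of p X] osp_skew_hcomp[OF assms(1), of p] mat_hcomp_in[of q Y] osp_skew_hcomp[OF assms(2), of q]
    let ?Z = "mat_bracket (mat_hcomp p X) (mat_hcomp q Y)"
    have "?Z \<in> mat_part (p + q)" by (rule mat_bracket_part[OF h(1,3)])
    then have "?Z $ 2 $ 2 - bar (?Z $ 2 $ 2) \<in> H (p + q)" by (auto simp: mat_part_iff)
    then show ?thesis using osp_bracket_T_homogeneous[OF h] by (simp add: rho_homogeneous)
  qed
  then have "?P (mat_bracket (mat_hcomp 0 X + mat_hcomp 1 X) (mat_hcomp 0 Y + mat_hcomp 1 Y))"
    unfolding mat_bracket_add by (intro add)
  then show ?thesis by (simp add: mat_hcomp_sum)
qed

lemma osp_set_T: "X \<in> osp_set \<Longrightarrow> X $ 1 $ 1 - rho (X $ 2 $ 2 - bar (X $ 2 $ 2)) \<in> T"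
proof (induction rule: osp_set_induct)
  case (bracket X Y)
  then show ?case by (rule osp_bracket_T)
next
  case (add X Y)
  then show ?case using T_intros(2)[OF add] by (simp add: bar_add rho_simps algebra_simps)
next
  case (smult c X)
  then show ?case using T_intros(5)[OF smult, of c]
    by (simp add: bar_scl rho_simps(2) flip: scl_diff)
qed (simp_all add: T_intros rho_simps)

text \<open>With \<open>a = 1\<close> the matrices \<open>[f(a), g(b)]\<close> realise every entry
  at (2,2), together with a definite entry at (1,1). By \<open>osp_set_T\<close> the actual entry at
  (1,1) differs from it by an element of \<open>T\<close>, which is supplied by differences of such
  brackets. The result gives the surjectivity of \<open>psi\<close>.\<close>

lemma osp_set_generated:
  assumes N: "submodule N type_ring mat_lie"
    and g: "\<And>a. osp_v a \<in> N" "\<And>a. osp_w a \<in> N" "\<And>a. osp_f a \<in> N" "\<And>a. osp_g a \<in> N"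
    and h: "\<And>a b p q. \<lbrakk>a \<in> H p; b \<in> H q\<rbrakk> \<Longrightarrow> mat_bracket (osp_f a) (osp_g b) \<in> N"
    and X: "X \<in> osp_set"
  shows "X \<in> N"
proof -
  have N0: "0 \<in> N" and Na: "\<And>X Y. \<lbrakk>X \<in> N; Y \<in> N\<rbrakk> \<Longrightarrow> X + Y \<in> N" and Nn: "\<And>X. X \<in> N \<Longrightarrow> - X \<in> N"
    and Ns: "\<And>c X. X \<in> N \<Longrightarrow> c \<odot>\<^bsub>mat_lie\<^esub> X \<in> N"
    using M.submodule_zero[OF N] M.submoduleE(3-5)[OF N] by auto
  have 1: "dg (b - bar b) (rho b) \<in> N" for b
  proof (rule H_cases_add[where a = b])
    fix b q assume b: "b \<in> H q"
    show "dg (b - bar b) (rho b) \<in> N"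
      using h[OF one_H0 b] osp_fg[OF one_H0 b] by (simp add: rho_homogeneous[OF b])
  next
    fix a b assume "dg (a - bar a) (rho a) \<in> N" "dg (b - bar b) (rho b) \<in> N"
    from Na[OF this] show "dg (a + b - bar (a + b)) (rho (a + b)) \<in> N"
      by (simp add: bar_add rho_simps algebra_simps flip: dg_linear)
  qed
  have 2: "dg t 0 \<in> N" if "t \<in> T" for t
    using that
  proof (induction rule: T_induct)
    case (com a b p q)
    have c: "sg (p * q) (b * a) \<in> H (p + q)" using mult_deg[OF com(2,1)] by (simp add: add.commute)
    have "dg (a * b - bar (a * b)) (sg (p * q + p + q) (b * a)) \<in> N"
      using h[OF com] osp_fg[OF com] by simp
    \<comment> \<open>Both matrices have the same entry at (2,2), so only \<open>d - bar d\<close>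
      with \<open>d = com (p * q) a b\<close> survives, at (1,1).\<close>
    from Na[OF this Nn[OF 1[of "sg (p * q) (b * a)"]]]
    show ?case unfolding rho_homogeneous[OF c]
      by (cases p; cases q) (simp_all add: com_def bar_diff bar_add bar_neg algebra_simps flip: dg_linear)
  next
    case (add x y)
    from Na[OF this] show ?case by (simp flip: dg_linear)
  next
    case (smult c x)
    from Ns[OF this, of c] show ?case by (simp flip: dg_linear)
  next
    case zero
    have "dg 0 0 = 0" by (simp add: mat_eq_iff)
    then show ?case using N0 by simp
  qed
  let ?a = "X $ 1 $ 1" and ?d = "X $ 2 $ 2"
  \<comment> \<open>Statement \<open>1\<close> is used at \<open>rho ?d\<close>, because it places
    \<open>rho\<close> of its argument at (2,2) and \<open>rho\<close> is an involution.\<close>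
  have "dg (?a - rho (?d - bar ?d)) 0 + dg (rho ?d - bar (rho ?d)) (rho (rho ?d)) \<in> N"
    using Na[OF 2[OF osp_set_T[OF X]] 1[of "rho ?d"]] .
  then have d: "dg ?a ?d \<in> N" by (simp add: rho_simps algebra_simps flip: dg_linear)
  have "X = osp_v (scl hf (X $ 2 $ 3)) + osp_w (scl hf (X $ 3 $ 2)) + osp_f (X $ 1 $ 2) + osp_g (X $ 2 $ 1) + dg ?a ?d"
  proof -
    note e = osp_set_skew[OF X, unfolded osp_skew_iff]
    have "rho (bar (X $ 1 $ 2)) = X $ 3 $ 1" "- rho (bar (X $ 2 $ 1)) = X $ 1 $ 3" "- bar (X $ 2 $ 2) = X $ 3 $ 3"
      using e by (simp_all add: rho_simps(3))
    then show ?thesis using e by (simp add: mat_eq_iff tr_hf)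
  qed
  then show ?thesis using g d Na by metis
qed


subsection \<open>The submodule \<open>I3\<close>\<close>

lemma I3_submodule: "submodule I3 type_ring (alg_module scl)"
  unfolding I3_def by (rule A.lin_span_submodule) simp

lemmas I3D = submodule_algD[OF I3_submodule]

lemma I3_gen: "a \<in> I3_gens \<Longrightarrow> a \<in> I3"
  unfolding I3_def by (rule A.lin_span_incl)

lemma I3_induct [consumes 1, case_names gen zero add smult]:
  assumes "x \<in> I3" "\<And>x. x \<in> I3_gens \<Longrightarrow> P x"
    "P 0" "\<And>x y. \<lbrakk>P x; P y\<rbrakk> \<Longrightarrow> P (x + y)" "\<And>c x. P x \<Longrightarrow> P (scl c x)"
  shows "P x"
  using assms(1) unfolding I3_def by (rule A.lin_span_induct) (use assms(2-) in auto)

lemma I3_three: "a + a + a \<in> I3"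
proof (rule H_cases_add[where a = a])
  fix a b assume "a + a + a \<in> I3" "b + b + b \<in> I3"
  from I3D(2)[OF this] show "(a + b) + (a + b) + (a + b) \<in> I3" by (simp add: algebra_simps)
qed (auto intro: I3_gen I3_gens.three)

lemma I3_bar: "a - bar a \<in> I3"
proof (rule H_cases_add[where a = a])
  fix a b assume "a - bar a \<in> I3" "b - bar b \<in> I3"
  from I3D(2)[OF this] show "(a + b) - bar (a + b) \<in> I3" by (simp add: algebra_simps bar_add)
qed (auto intro: I3_gen I3_gens.bar)

lemma I3_bar_in: "a \<in> I3 \<Longrightarrow> bar a \<in> I3"
  using I3D(4)[OF _ I3_bar[of a], of a] by simp

lemma bar_mult3:
  assumes "a \<in> H p" "b \<in> H q" "c \<in> H r"
  shows "bar (a * b * c) = sg (p * q + p * r + q * r) (bar c * bar b * bar a)"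
  using bar_mult[OF mult_deg[OF assms(1,2)] assms(3)] bar_mult[OF assms(1,2)]
  by (cases p; cases q; cases r) (simp_all add: mult.assoc)

lemma mult_deg3: "\<lbrakk>a \<in> H p; b \<in> H q; c \<in> H r; e = p + q + r\<rbrakk> \<Longrightarrow> a * b * c \<in> H e"
  by (auto intro: mult_deg)

lemma I3_gens_homogeneous: "a \<in> I3_gens \<Longrightarrow> \<exists>p. a \<in> H p"
proof (induction rule: I3_gens.induct)
  case (comm a p b q c r d)
  then have "d \<in> H (p + q)" using mult_deg[OF comm(1,2)] mult_deg[OF comm(2,1)] by (auto simp: add.commute)
  then have "(d - bar d) * c \<in> H (p + q + r)" using comm by (intro mult_deg) auto
  then show ?case by blast
next
  case (tr_comm a p b q c r)
  then have "tr a * tr b * c - sg (p * q) (tr b * tr a * c) \<in> H (p + q + r)"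
    by (auto intro!: H_intros(4,6) mult_deg3[OF tr_deg tr_deg] simp: add_ac)
  then show ?case by blast
next
  case (cyclic a p b q c r)
  have "a * bar b * c \<in> H (p + q + r)" "bar a * b * bar c \<in> H (p + q + r)"
    "b * bar c * a \<in> H (p + q + r)" "bar b * c * bar a \<in> H (p + q + r)"
    "c * bar a * b \<in> H (p + q + r)" "bar c * a * bar b \<in> H (p + q + r)"
    using cyclic mult_deg3[of _ p _ q _ r "p + q + r"] mult_deg3[of _ q _ r _ p "p + q + r"]
      mult_deg3[of _ r _ p _ q "p + q + r"] by (simp_all add: add_ac)
  then have "sg (p * r) (a * bar b * c + bar a * b * bar c) + sg (q * p) (b * bar c * a + bar b * c * bar a) +
    sg (r * q) (c * bar a * b + bar c * a * bar b) \<in> H (p + q + r)"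
    by (intro H_intros(2) H_intros(6))
  then show ?case by blast
next
  case (bar a p)
  then have "a - bar a \<in> H p" by auto
  then show ?case by blast
qed auto

lemma I3_hcomp: "a \<in> I3 \<Longrightarrow> hcomp p a \<in> I3"
proof (induction rule: I3_induct)
  case (gen x)
  then obtain q where q: "x \<in> H q" using I3_gens_homogeneous by blast
  show ?case
  proof (cases "p = q")
    case True then show ?thesis using q gen by (simp add: I3_gen)
  next
    case False
    then have "q = p + 1" by (cases p; cases q) auto
    then show ?thesis using hcomp_other[of x p] q by (simp add: I3D)
  qed
qed (auto simp: hcomp_add hcomp_scl I3D)

lemma I3_rho: "a \<in> I3 \<Longrightarrow> rho a \<in> I3"
  unfolding rho_def by (intro I3D(4) I3_hcomp)

text \<open>The generators \<open>comm\<close> of \<open>I3\<close> are those of \<open>T\<close>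
  times a homogeneous element.\<close>

lemma T_mult_I3: "t \<in> T \<Longrightarrow> t * c \<in> I3"
proof (induction rule: T_induct)
  case (com a b p q)
  show ?case
  proof (rule H_cases_add[where a = c])
    fix c r assume "c \<in> H r"
    from I3_gens.comm[OF com this HOL.refl] show "(com (p * q) a b - bar (com (p * q) a b)) * c \<in> I3"
      unfolding com_def by (rule I3_gen)
  qed (auto simp: distrib_left intro: I3D)
qed (auto simp: distrib_right scl_mult_left intro: I3D)

text \<open>It suffices to treat the skew and the symmetric half of \<open>c\<close>. For skew
  \<open>u\<close> the generator \<open>cyclic\<close> with third argument 1 contains
  \<open>t u\<close> with coefficient -2, which \<open>3 t u\<close> turns into 1. For symmetric
  \<open>u\<close> the element is \<open>t u - bar (t u)\<close>.\<close>

lemma I3_anti: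
  assumes t: "t \<in> H p" "bar t = - t" and c: "c \<in> H q"
  shows "t * c + sg (p * q) (c * t) \<in> I3"
proof -
  have skew: "t * u + sg (p * q) (u * t) \<in> I3" if b: "b \<in> H q" and u: "u = b - bar b" for b u
  proof -
    have "t * bar b - t * b + sg (q * p) (b * t - bar b * t) + (t * bar b - t * b) \<in> I3"
      using I3_gen[OF I3_gens.cyclic[OF t(1) b one_H0]] t(2)
      by (cases p; cases q) (simp_all add: algebra_simps)
    from I3D(2)[OF this I3_three[of "t * u"]] show ?thesis
      unfolding u by (cases p; cases q) (simp_all add: algebra_simps)
  qed
  have sym: "t * u + sg (p * q) (u * t) \<in> I3" if b: "b \<in> H q" and u: "u = b + bar b" for b u
  proof -
    have "u \<in> H q" "bar u = u" using b u by (auto simp: bar_add)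
    then show ?thesis using I3_bar[of "t * u"] bar_mult[OF t(1), of u q] t(2)
      by (cases p; cases q) simp_all
  qed
  have ch: "scl hf c \<in> H q" using c by auto
  define u v where "u = scl hf c - bar (scl hf c)" and "v = scl hf c + bar (scl hf c)"
  have "c = u + v" by (simp add: u_def v_def scl_hf)
  then show ?thesis using I3D(2)[OF skew[OF ch u_def] sym[OF ch v_def]]
    by (cases p; cases q) (simp_all add: algebra_simps)
qed

lemma I3_tr_comm:
  assumes "s \<in> H p" "bar s = s" "t \<in> H q" "bar t = t" "c \<in> H r"
  shows "s * t * c - sg (p * q) (t * s * c) \<in> I3"
  using I3_gen[OF I3_gens.tr_comm[of "scl hf s" p "scl hf t" q c r]] assms
  by (simp add: tr_hf H_intros(5))

text \<open>The form in which the condition \<open>cyclic\<close> arises from the Jacobi identity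
  for three elements \<open>g\<close>. The two forms differ by elements \<open>x - bar x\<close> for
  three triple products \<open>x\<close>.\<close>

lemma I3_G:
  assumes a: "a \<in> H p" and b: "b \<in> H q" and c: "c \<in> H r"
  shows "sg (p * r) ((a * bar b + sg (p * q) (b * bar a)) * c) +
    sg (q * p) ((b * bar c + sg (q * r) (c * bar b)) * a) +
    sg (r * q) ((c * bar a + sg (r * p) (a * bar c)) * b) \<in> I3"
proof -
  note d = a[THEN bar_deg] b[THEN bar_deg] c[THEN bar_deg]
  have x: "b * bar a * c - sg (p * q + p * r + q * r) (bar c * a * bar b) \<in> I3"
    using I3_bar[of "b * bar a * c"] bar_mult3[OF b d(1) c] by (simp add: mult.commute add_ac)
  have y: "c * bar b * a - sg (p * q + p * r + q * r) (bar a * b * bar c) \<in> I3"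
    using I3_bar[of "c * bar b * a"] bar_mult3[OF c d(2) a] by (simp add: mult.commute add_ac)
  have z: "a * bar c * b - sg (p * q + p * r + q * r) (bar b * c * bar a) \<in> I3"
    using I3_bar[of "a * bar c * b"] bar_mult3[OF a d(3) b] by (simp add: mult.commute add_ac)
  show ?thesis
    using I3D(2)[OF I3_gen[OF I3_gens.cyclic[OF a b c]] I3D(2)[OF I3D(6)[OF x, of "p * r + p * q"]
        I3D(2)[OF I3D(6)[OF y, of "q * p + q * r"] I3D(6)[OF z, of "r * q + r * p"]]]]
    by (cases p; cases q; cases r) (simp_all add: algebra_simps)
qed

text \<open>Modulo \<open>I3\<close> everything becomes a multiple of \<open>y s c\<close>:
  \<open>I3_anti\<close> carries \<open>x\<close> to the front, the condition on \<open>x\<close>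
  replaces it by \<open>y - bar y\<close> up to sign, and \<open>I3_tr_comm\<close> carries
  \<open>tr y\<close> past \<open>s\<close>. What is left is
  \<open>y + (y + bar y) + (y - bar y) = 3 y\<close> in front of \<open>s c\<close>.\<close>

lemma I3_W:
  assumes y: "y \<in> H n" and x: "x \<in> H n" "bar x = - x" "x - sg n (y - bar y) \<in> T"
    and s: "s \<in> H r" "bar s = s" and c: "c \<in> H m"
  shows "(y * s + sg (n * r) (s * bar y)) * c + sg (n * r) (s * (y * c - sg (n + n * m) (c * x))) \<in> I3"
proof -
  have 1: "x * (s * c) + sg (n * (r + m)) ((s * c) * x) \<in> I3"
    by (rule I3_anti[OF x(1,2) mult_deg[OF s(1) c]])
  have 2: "(x - sg n (y - bar y)) * (s * c) \<in> I3" by (rule T_mult_I3[OF x(3)])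
  have 3: "tr y * s * c - sg (n * r) (s * tr y * c) \<in> I3"
    by (rule I3_tr_comm) (use y s c in \<open>auto simp: tr_simps\<close>)
  from I3D(2)[OF I3D(2)[OF I3D(6)[OF I3D(3)[OF 1], of n] I3D(6)[OF 2, of n]]
      I3D(2)[OF I3D(3)[OF 3] I3_three[of "y * s * c"]]]
  show ?thesis
    by (cases n; cases r; cases m) (simp_all add: algebra_simps tr_def)
qed

text \<open>
  The premises are the instances of the Jacobi identity that hold in a central extension, with
  \<open>K\<close> the kernel of the map \<open>chi\<close> defined there.
\<close>

lemma I3_subset:
  assumes K: "submodule K type_ring (alg_module scl)"
    and three: "\<And>a p. a \<in> H p \<Longrightarrow> a + a + a \<in> K"
    and trc: "\<And>a b c p q r. \<lbrakk>a \<in> H p; b \<in> H q; c \<in> H r\<rbrakk> \<Longrightarrow> tr a * tr b * c - sg (p * q) (tr b * tr a * c) \<in> K"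
    and G: "\<And>a b c p q r. \<lbrakk>a \<in> H p; b \<in> H q; c \<in> H r\<rbrakk> \<Longrightarrow>
      sg (p * r) ((a * bar b + sg (p * q) (b * bar a)) * c) +
      sg (q * p) ((b * bar c + sg (q * r) (c * bar b)) * a) +
      sg (r * q) ((c * bar a + sg (r * p) (a * bar c)) * b) \<in> K"
    and W: "\<And>a b c p q r. \<lbrakk>a \<in> H p; b \<in> H q; c \<in> H r\<rbrakk> \<Longrightarrow>
      tr (sg (p * q + p + q) (b * a)) * c + (sg (p * q + p + q) (b * a) * c
        - sg ((p + q) * r + p + q) (c * (a * b - bar (a * b)))) \<in> K"
  shows "I3 \<subseteq> K"
proof -
  note KD = submodule_algD[OF K]
  have bar1: "a - bar a \<in> K" if a: "a \<in> H p" for a p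
  proof -
    \<comment> \<open>\<open>G\<close> with two arguments equal to 1 reads
      \<open>4 a + 2 bar a\<close>; subtracting \<open>3 tr a\<close> leaves
      \<open>a - bar a\<close>.\<close>
    have "(a + bar a + (a + a) + (bar a + a)) - (tr a + tr a + tr a) \<in> K"
      using KD(4)[OF G[OF a one_H0 one_H0] three[OF tr_deg[OF a]]] by (simp add: algebra_simps)
    then show ?thesis by (simp add: tr_def algebra_simps)
  qed
  have "x \<in> K" if "x \<in> I3_gens" for x
    using that
  proof (induction rule: I3_gens.induct)
    case (three a p) then show ?case by (rule assms(2))
  next
    case (bar a p) then show ?case by (rule bar1)
  next
    case (tr_comm a p b q c r) then show ?case by (rule trc)
  next
    case (comm a p b q c r d)
    let ?t = "d - bar d"
    have d: "d \<in> H (p + q)" using comm mult_deg[OF comm(1,2)] mult_deg[OF comm(2,1)] by (auto simp: add.commute)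
    then have t: "?t \<in> H (p + q)" "bar ?t = - ?t" by (auto simp: bar_diff)
    have ba: "sg (p * q) (b * a) \<in> H (p + q)" using mult_deg[OF comm(2,1)] by (simp add: add.commute)
    \<comment> \<open>An instance of \<open>W\<close> depends on the product \<open>b * a\<close>
      with its sign and on \<open>a * b - bar (a * b)\<close>. Replacing the pair by 1 and the
      signed product \<open>b * a\<close> keeps the former, so in the difference only the commutator
      remains. It stands to the right of the third argument, which is therefore taken to be
      \<open>bar c\<close>.\<close>
    define w where "w a b e f = tr (sg (f + e) (b * a)) * bar c + (sg (f + e) (b * a) * bar c
      - sg (e * r + e) (bar c * (a * b - bar (a * b))))" for a b e f
    have "w a b (p + q) (p * q) \<in> K" "w 1 (sg (p * q) (b * a)) (p + q) 0 \<in> K"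
      using W[OF comm(1,2) bar_deg[OF comm(3)]] W[OF one_H0 ba bar_deg[OF comm(3)]]
      unfolding w_def by (simp_all add: add.assoc)
    then have "w a b (p + q) (p * q) - w 1 (sg (p * q) (b * a)) (p + q) 0 \<in> K" by (rule KD(4))
    also have "w a b (p + q) (p * q) - w 1 (sg (p * q) (b * a)) (p + q) 0
        = - sg ((p + q) * r + p + q) (bar c * ?t)"
      unfolding comm(4) w_def
      by (cases p; cases q; cases r) (simp_all add: algebra_simps bar_diff bar_add bar_neg)
    finally have "bar c * ?t \<in> K" unfolding KD(7,8) .
    \<comment> \<open>Conjugation is harmless modulo \<open>K\<close> and brings \<open>c\<close> to
      the right of the commutator.\<close>
    from KD(4)[OF this bar1[OF mult_deg[OF bar_deg[OF comm(3)] t(1)]]]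
    have "bar (bar c * ?t) \<in> K" by simp
    moreover have "bar (bar c * ?t) = sg (r * (p + q) + 1) (?t * c)"
      using bar_mult[OF bar_deg[OF comm(3)] t(1)] unfolding t(2)
      by (cases p; cases q; cases r) (simp_all add: algebra_simps)
    ultimately show ?case by (simp only: KD(8))
  next
    case (cyclic a p b q c r)
    note a = cyclic(1) and b = cyclic(2) and c = cyclic(3)
    note d = a[THEN bar_deg] b[THEN bar_deg] c[THEN bar_deg]
    have x: "b * bar a * c - sg (p * q + p * r + q * r) (bar c * a * bar b) \<in> K"
      using bar1[OF mult_deg3[OF b d(1) c HOL.refl]] bar_mult3[OF b d(1) c] by (simp add: mult.commute add_ac)
    have y: "c * bar b * a - sg (p * q + p * r + q * r) (bar a * b * bar c) \<in> K"
      using bar1[OF mult_deg3[OF c d(2) a HOL.refl]] bar_mult3[OF c d(2) a] by (simp add: mult.commute add_ac)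
    have z: "a * bar c * b - sg (p * q + p * r + q * r) (bar b * c * bar a) \<in> K"
      using bar1[OF mult_deg3[OF a d(3) b HOL.refl]] bar_mult3[OF a d(3) b] by (simp add: mult.commute add_ac)
    show ?case
      using KD(4)[OF G[OF a b c] KD(2)[OF KD(6)[OF x, of "p * r + p * q"]
        KD(2)[OF KD(6)[OF y, of "q * p + q * r"] KD(6)[OF z, of "r * q + r * p"]]]]
      by (cases p; cases q; cases r) (simp_all add: algebra_simps)
  qed
  then show ?thesis
    using A.lin_span_least[OF K] unfolding I3_def by blast
qed

subsection \<open>The cocycle on matrices\<close>

text \<open>
  \<open>raw1\<close> is the \<open>pi1\<close>-component of \<open>beta\<close> before passing to the quotient by \<open>I3\<close>, read off from matrices.
  This makes the existence of \<open>beta\<close> evident.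
\<close>

definition m1 :: "'r^3^3 \<Rightarrow> 'r^3^3 \<Rightarrow> 'r" where "m1 X Y = X $ 2 $ 3 * Y $ 2 $ 1"

definition raw1 :: "'r^3^3 \<Rightarrow> 'r^3^3 \<Rightarrow> 'r"
  where "raw1 X Y = (\<Sum>p\<in>{0, 1}. \<Sum>q\<in>{0, 1}.
    m1 (mat_hcomp p X) (mat_hcomp q Y) - sg (p * q) (m1 (mat_hcomp q Y) (mat_hcomp p X)))"

lemma raw1_homogeneous:
  assumes "X \<in> mat_part p" "Y \<in> mat_part q"
  shows "raw1 X Y = X $ 2 $ 3 * Y $ 2 $ 1 - sg (p * q) (Y $ 2 $ 3 * X $ 2 $ 1)"
  using assms mat_hcomp_other[of X "p + 1"] mat_hcomp_other[of Y "q + 1"]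
  by (cases p; cases q) (simp_all add: raw1_def mat_hcomp_id m1_def del: mat_hcomp_nth)

lemma raw1_add: "raw1 (X + Y) Z = raw1 X Z + raw1 Y Z" "raw1 Z (X + Y) = raw1 Z X + raw1 Z Y"
  by (simp_all add: raw1_def m1_def hcomp_add algebra_simps)

lemma raw1_smult:
  "raw1 (c \<odot>\<^bsub>mat_lie\<^esub> X) Y = scl c (raw1 X Y)" "raw1 X (c \<odot>\<^bsub>mat_lie\<^esub> Y) = scl c (raw1 X Y)"
  by (simp_all add: raw1_def m1_def hcomp_scl scl_mult_left scl_mult_right scl_diff scl_simps(2))

lemma raw1_deg:
  assumes "X \<in> mat_part p" "Y \<in> mat_part q"
  shows "raw1 X Y \<in> H (1 + (p + q))"
proof -
  have "X $ 2 $ 3 * Y $ 2 $ 1 \<in> H (1 + (p + q))" "Y $ 2 $ 3 * X $ 2 $ 1 \<in> H (1 + (p + q))"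
    using assms mult_deg[of "X $ 2 $ 3" p "Y $ 2 $ 1" "q + 1"] mult_deg[of "Y $ 2 $ 3" q "X $ 2 $ 1" "p + 1"]
    by (simp_all add: mat_part_iff add_ac)
  then show ?thesis unfolding raw1_homogeneous[OF assms] by blast
qed

lemma raw1_skew:
  assumes "X \<in> mat_part p" "Y \<in> mat_part q"
  shows "raw1 X Y = - sg (p * q) (raw1 Y X)"
  unfolding raw1_homogeneous[OF assms] raw1_homogeneous[OF assms(2,1)]
  by (cases p; cases q) simp_all

text \<open>\<open>raw1\<close> pairs weight 2 with weight 1, so each product of three entries, one
  from each matrix, has total weight 3. The possible weights are 1+1+1, 2+2-1 and 2+1+0, that is
  \<open>ggg\<close>, \<open>vvf\<close> and \<open>vg\<close> with a diagonal entry. These groups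
  are \<open>?G\<close>, \<open>?V\<close> and \<open>?W\<close>, and each lies in \<open>I3\<close>
  separately.\<close>

lemma raw1_cocycle:
  assumes X: "X \<in> mat_part p" "X \<in> osp_set" and Y: "Y \<in> mat_part q" "Y \<in> osp_set"
    and Z: "Z \<in> mat_part r" "Z \<in> osp_set"
  shows "sg (p * r) (raw1 (mat_bracket X Y) Z) + sg (q * p) (raw1 (mat_bracket Y Z) X)
    + sg (r * q) (raw1 (mat_bracket Z X) Y) \<in> I3"
proof -
  note eX = osp_set_skew[OF X(2), unfolded osp_skew_homogeneous[OF X(1)]]
  note eY = osp_set_skew[OF Y(2), unfolded osp_skew_homogeneous[OF Y(1)]]
  note eZ = osp_set_skew[OF Z(2), unfolded osp_skew_homogeneous[OF Z(1)]]
  note dX = X(1)[unfolded mat_part_iff] and dY = Y(1)[unfolded mat_part_iff] and dZ = Z(1)[unfolded mat_part_iff]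
  have T: "U $ 1 $ 1 - sg n (U $ 2 $ 2 - bar (U $ 2 $ 2)) \<in> T" if "U \<in> mat_part n" "U \<in> osp_set" for U n
  proof -
    have "U $ 2 $ 2 - bar (U $ 2 $ 2) \<in> H n" using that(1) by (auto simp: mat_part_iff)
    then show ?thesis using osp_set_T[OF that(2)] by (simp add: rho_homogeneous)
  qed
  let ?G = "\<lambda>p q r a b c. sg (p * r) ((a * bar b + sg (p * q) (b * bar a)) * c) +
    sg (q * p) ((b * bar c + sg (q * r) (c * bar b)) * a) +
    sg (r * q) ((c * bar a + sg (r * p) (a * bar c)) * b)"
  let ?V = "\<lambda>p q s t c. s * t * c - sg (p * q) (t * s * c)"
  let ?W = "\<lambda>n r m y x s c. (y * s + sg (n * r) (s * bar y)) * c + sg (n * r) (s * (y * c - sg (n + n * m) (c * x)))"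
  have G: "?G (p+1) (q+1) (r+1) (X$2$1) (Y$2$1) (Z$2$1) \<in> I3"
    using dX dY dZ by (intro I3_G) auto
  have V: "?V p q (X$2$3) (Y$2$3) (Z$3$1) \<in> I3" "?V q r (Y$2$3) (Z$2$3) (X$3$1) \<in> I3"
    "?V r p (Z$2$3) (X$2$3) (Y$3$1) \<in> I3"
    using dX dY dZ eX eY eZ I3_tr_comm by blast+
  have W': "?W n m (k + 1) (A$2$2) (A$1$1) (B$2$3) (C$2$1) \<in> I3"
    if A: "A \<in> mat_part n" "A \<in> osp_set" and B: "B \<in> mat_part m" "B \<in> osp_set"
      and C: "C \<in> mat_part k" for A B C :: "'r^3^3" and n m k
    using osp_set_skew[OF A(2), unfolded osp_skew_homogeneous[OF A(1)]] osp_set_skew[OF B(2), unfolded osp_skew_homogeneous[OF B(1)]]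
      A(1)[unfolded mat_part_iff] B(1)[unfolded mat_part_iff] C[unfolded mat_part_iff]
    by (intro I3_W T A) simp_all
  note W = W'[OF X Y Z(1)] W'[OF Y Z X(1)] W'[OF Z X Y(1)] W'[OF X Z Y(1)] W'[OF Y X Z(1)] W'[OF Z Y X(1)]
  have e: "X$1$3 = - sg (p+1) (bar (X$2$1))" "Y$1$3 = - sg (q+1) (bar (Y$2$1))" "Z$1$3 = - sg (r+1) (bar (Z$2$1))"
    "X$3$3 = - bar (X$2$2)" "Y$3$3 = - bar (Y$2$2)" "Z$3$3 = - bar (Z$2$2)"
    using eX eY eZ by (simp_all add: sg_def)
  note b = mat_bracket_homogeneous[OF X(1) Y(1)] mat_bracket_homogeneous[OF Y(1) Z(1)] mat_bracket_homogeneous[OF Z(1) X(1)]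
  note r = raw1_homogeneous[OF mat_bracket_part[OF X(1) Y(1)] Z(1)]
    raw1_homogeneous[OF mat_bracket_part[OF Y(1) Z(1)] X(1)]
    raw1_homogeneous[OF mat_bracket_part[OF Z(1) X(1)] Y(1)]
  have "sg (p * r) (raw1 (mat_bracket X Y) Z) + sg (q * p) (raw1 (mat_bracket Y Z) X)
    + sg (r * q) (raw1 (mat_bracket Z X) Y) =
    sg (p + q + r + 1) (?G (p+1) (q+1) (r+1) (X$2$1) (Y$2$1) (Z$2$1))
    - (sg (r * p) (?V p q (X$2$3) (Y$2$3) (Z$3$1)) + sg (p * q) (?V q r (Y$2$3) (Z$2$3) (X$3$1))
       + sg (q * r) (?V r p (Z$2$3) (X$2$3) (Y$3$1)))
    + (sg (p * r) (?W p q (r+1) (X$2$2) (X$1$1) (Y$2$3) (Z$2$1))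
     + sg (q * p) (?W q r (p+1) (Y$2$2) (Y$1$1) (Z$2$3) (X$2$1))
     + sg (r * q) (?W r p (q+1) (Z$2$2) (Z$1$1) (X$2$3) (Y$2$1))
     - sg (r * q + r * p) (?W p r (q+1) (X$2$2) (X$1$1) (Z$2$3) (Y$2$1))
     - sg (p * r + p * q) (?W q p (r+1) (Y$2$2) (Y$1$1) (X$2$3) (Z$2$1))
     - sg (q * p + q * r) (?W r q (p+1) (Z$2$2) (Z$1$1) (Y$2$3) (X$2$1)))"
    unfolding r unfolding b
    by (cases p; cases q; cases r) (simp_all add: e algebra_simps)
  also have "\<dots> \<in> I3"
    by (intro I3D(2) I3D(4) I3D(6) G V W)
  finally show ?thesis .
qed

text \<open>
  \<open>tau\<close> is conjugation by \<open>e\<^sub>1\<^sub>1 + e\<^sub>2\<^sub>3 - e\<^sub>3\<^sub>2\<close>.  It exchanges \<open>v, g\<close> with \<open>w, f\<close>, so that the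
  component of the cocycle on \<open>(f, w)\<close> need not be treated separately from the one on \<open>(v, g)\<close>.
\<close>

definition tau :: "'r^3^3 \<Rightarrow> 'r^3^3"
  where "tau X = vector [
    vector [X$1$1, X$1$3, - X$1$2],
    vector [X$3$1, X$3$3, - X$3$2],
    vector [- X$2$1, - X$2$3, X$2$2]]"

lemma tau_nth [simp]:
  "tau X $ 1 $ 1 = X $ 1 $ 1" "tau X $ 1 $ 2 = X $ 1 $ 3" "tau X $ 1 $ 3 = - X $ 1 $ 2"
  "tau X $ 2 $ 1 = X $ 3 $ 1" "tau X $ 2 $ 2 = X $ 3 $ 3" "tau X $ 2 $ 3 = - X $ 3 $ 2"
  "tau X $ 3 $ 1 = - X $ 2 $ 1" "tau X $ 3 $ 2 = - X $ 2 $ 3" "tau X $ 3 $ 3 = X $ 2 $ 2"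
  by (simp_all add: tau_def)

lemma tau_linear: "tau (X + Y) = tau X + tau Y" "tau (c \<odot>\<^bsub>mat_lie\<^esub> X) = c \<odot>\<^bsub>mat_lie\<^esub> tau X"
  "tau (- X) = - tau X" "tau 0 = 0" "tau (X - Y) = tau X - tau Y"
  by (simp_all add: mat_eq_iff scl_neg)

lemma tau4: "tau (tau (tau (tau X))) = X"
  by (simp add: mat_eq_iff)

lemma tau_mult: "tau (mat_mult X Y) = mat_mult (tau X) (tau Y)"
  by (simp add: mat_eq_iff algebra_simps)

lemma tau_part: "X \<in> mat_part p \<Longrightarrow> tau X \<in> mat_part p"
  by (simp add: mat_part_iff)

lemma tau_hcomp: "tau (mat_hcomp p X) = mat_hcomp p (tau X)"
  by (simp add: mat_eq_iff hcomp_neg)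

lemma tau_bracket: "tau (mat_bracket X Y) = mat_bracket (tau X) (tau Y)"
  by (simp add: mat_bracket_expand tau_linear tau_mult tau_hcomp)

lemma tau_skew: "X \<in> osp_skew \<Longrightarrow> tau X \<in> osp_skew"
  by (simp add: osp_skew_iff bar_neg rho_simps)

lemma tau_osp_set: "X \<in> osp_set \<Longrightarrow> tau X \<in> osp_set"
  by (induction rule: osp_set_induct) (simp_all add: tau_bracket bracket_osp_set tau_skew tau_linear osp_setD)

lemma tau_gen:
  "tau (osp_v a) = - osp_w a" "tau (osp_w a) = - osp_v a"
  "tau (osp_f a) = osp_g (rho (bar a))" "tau (osp_g a) = osp_f (- rho (bar a))" "tau h0 = - h0"
  by (simp_all add: mat_eq_iff rho_simps bar_neg)

text \<open>After \<open>tau\<close> the product of the parameters of \<open>f(a)\<close> and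
  \<open>w(b)\<close> appears conjugated and in the opposite order, as
  \<open>tr b * rho (bar a)\<close> up to sign. The outer \<open>bar\<close> and \<open>rho\<close>
  restore the value \<open>a * tr b\<close> of the cocycle.\<close>

definition raw2 :: "'r^3^3 \<Rightarrow> 'r^3^3 \<Rightarrow> 'r"
  where "raw2 X Y = bar (rho (raw1 (tau X) (tau Y)))"

lemma raw2_add: "raw2 (X + Y) Z = raw2 X Z + raw2 Y Z" "raw2 Z (X + Y) = raw2 Z X + raw2 Z Y"
  by (simp_all add: raw2_def tau_linear raw1_add rho_simps bar_add)

lemma raw2_smult:
  "raw2 (c \<odot>\<^bsub>mat_lie\<^esub> X) Y = scl c (raw2 X Y)" "raw2 X (c \<odot>\<^bsub>mat_lie\<^esub> Y) = scl c (raw2 X Y)"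
  by (simp_all add: raw2_def tau_linear raw1_smult rho_simps bar_scl)

lemma raw2_deg:
  assumes "X \<in> mat_part p" "Y \<in> mat_part q"
  shows "raw2 X Y \<in> H (1 + (p + q))"
  using raw1_deg[OF assms[THEN tau_part]]
  unfolding raw2_def by (simp add: rho_homogeneous)

lemma raw2_skew:
  assumes "X \<in> mat_part p" "Y \<in> mat_part q"
  shows "raw2 X Y = - sg (p * q) (raw2 Y X)"
  using raw1_skew[OF assms[THEN tau_part]]
  unfolding raw2_def by (cases p; cases q) (simp_all add: rho_simps bar_neg)

lemma raw2_cocycle:
  assumes "X \<in> mat_part p" "X \<in> osp_set" "Y \<in> mat_part q" "Y \<in> osp_set" "Z \<in> mat_part r" "Z \<in> osp_set"
  shows "sg (p * r) (raw2 (mat_bracket X Y) Z) + sg (q * p) (raw2 (mat_bracket Y Z) X)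
    + sg (r * q) (raw2 (mat_bracket Z X) Y) \<in> I3"
  using I3_bar_in[OF I3_rho[OF raw1_cocycle[OF tau_part tau_osp_set tau_part tau_osp_set tau_part tau_osp_set, OF assms]]]
  unfolding raw2_def by (cases p; cases q; cases r)
    (simp_all add: tau_bracket rho_simps(1-5) bar_add bar_neg bar_diff algebra_simps)

lemma raw1_gen:
  assumes a: "a \<in> H p" and b: "b \<in> H q"
  shows "raw1 (osp_v a) (osp_g b) = tr a * b" "raw2 (osp_f a) (osp_w b) = a * tr b"
    "raw2 (osp_v a) (osp_g b) = 0" "raw1 (osp_f a) (osp_w b) = 0"
proof -
  note da = osp_gen_part[OF a] and db = osp_gen_part[OF b]
  show "raw1 (osp_v a) (osp_g b) = tr a * b"
    by (simp add: raw1_homogeneous[OF da(1) db(4)])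
  show "raw1 (osp_f a) (osp_w b) = 0"
    by (simp add: raw1_homogeneous[OF da(3) db(2)])
  show "raw2 (osp_v a) (osp_g b) = 0"
    by (simp add: raw2_def raw1_homogeneous[OF tau_part[OF da(1)] tau_part[OF db(4)]] rho_simps)
  have 1: "tr b * bar a \<in> H (p + q)" using mult_deg[OF tr_deg[OF b] bar_deg[OF a]] by (simp add: add.commute)
  have 2: "rho (tr b * bar a) = sg (p + q) (tr b * bar a)" by (rule rho_homogeneous[OF 1])
  have 3: "rho (bar a) = sg p (bar a)" using a by (simp add: rho_homogeneous bar_deg)
  have 4: "bar (tr b * bar a) = sg (p * q) (a * tr b)"
    using bar_mult[OF tr_deg[OF b] bar_deg[OF a]] by (simp add: tr_simps mult.commute)
  show "raw2 (osp_f a) (osp_w b) = a * tr b"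
    by (cases p; cases q) (simp_all add: raw2_def raw1_homogeneous[OF tau_part[OF da(3)] tau_part[OF db(2)]]
      3 rho_simps(1-5) 2 bar_neg 4)
qed


subsection \<open>The Lie superalgebra given by generators and relations\<close>

abbreviation (input) "cl \<equiv> lie_cls gen_part osp_rel"

sublocale Hat: kmodule hat_osp
  unfolding hat_osp_def kmodule_def by (rule pres_module)

lemmas hat_ops = pres_carrier[where D = gen_part and Q = osp_rel, folded hat_osp_def]
  pres_zero[where D = gen_part and Q = osp_rel, folded hat_osp_def] pres_part[where D = gen_part and Q = osp_rel, folded hat_osp_def]
  pres_add[where D = gen_part and Q = osp_rel, folded hat_osp_def] pres_bracket[where D = gen_part and Q = osp_rel, folded hat_osp_def]
  pres_smult[where D = gen_part and Q = osp_rel, folded hat_osp_def] pres_neg[where D = gen_part and Q = osp_rel, folded hat_osp_def]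
  pres_msg[where D = gen_part and Q = osp_rel, folded hat_osp_def]

lemma cl_carrier [simp]: "cl t \<in> carrier hat_osp"
  by (simp add: hat_ops)

lemma cl_rel: "osp_rel s t \<Longrightarrow> cl s = cl t"
  unfolding lie_cls_eq_iff by (rule lie_cong.rel)

section \<open>The grading of \<open>hat_osp\<close>\<close>

lemma lie_deg_gens:
  "a \<in> H p \<Longrightarrow> lie_deg gen_part p (tv a)" "a \<in> H p \<Longrightarrow> lie_deg gen_part p (tw a)"
  "a \<in> H (1 + p) \<Longrightarrow> lie_deg gen_part p (tf a)" "a \<in> H (1 + p) \<Longrightarrow> lie_deg gen_part p (tg a)"
  by (rule lie_deg.intros, simp add: gen_part_def)+

text \<open>For \<open>a\<close> of degree \<open>p\<close> the symbols \<open>GF a\<close> and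
  \<open>GG a\<close> have degree \<open>1 + p\<close>, whence their additional sign.\<close>

fun flip :: "'r osp_gen \<Rightarrow> 'r osp_gen"
  where "flip (GV a) = GV (rho a)" | "flip (GW a) = GW (rho a)"
  | "flip (GF a) = GF (- rho a)" | "flip (GG a) = GG (- rho a)"

text \<open>
  \<open>twist\<close> acts as \<open>(-1)\<^sup>p\<close> on terms of degree \<open>p\<close>.  Since \<open>2\<close> is invertible, this shows that
  the two homogeneous parts of \<open>hat_osp\<close> intersect trivially.
\<close>

abbreviation "twist \<equiv> map_lie_term (\<lambda>c :: 'k. c) flip"

lemma gen_sg:
  "X \<in> {GV, GW, GF, GG} \<Longrightarrow> cl (Gen (X (sg p a))) = msg hat_osp p (cl (Gen (X a)))"
  using cl_rel[OF osp_rel.gen_scale[of X "- 1" a]]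
  by (cases p) (simp_all add: msg_def hat_ops)

lemma twist_deg:
  "lie_deg gen_part p t \<Longrightarrow> lie_deg gen_part p (twist t) \<and> cl (twist t) = msg hat_osp p (cl t)"
proof (induction rule: lie_deg.induct)
  case (1 g p)
  have e: "rho a = sg p a" if "a \<in> H p" for a using that by (rule rho_homogeneous)
  have e': "- rho a = sg p a" if "a \<in> H (1 + p)" for a
    unfolding rho_homogeneous[OF that] by (cases p) simp_all
  from 1 consider (V) a where "a \<in> H p" "g = GV a" | (W) a where "a \<in> H p" "g = GW a"
    | (F) a where "a \<in> H (1 + p)" "g = GF a" | (G) a where "a \<in> H (1 + p)" "g = GG a"
    unfolding gen_part_def by blast
  then show ?case
    by cases (simp_all add: e e' lie_deg_gens gen_sg)
next
  case (2 p)
  then show ?case by (simp add: lie_deg.intros flip: hat_ops(2))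
next
  case (3 p s t)
  then show ?case by (simp add: lie_deg.intros Hat.msg_add flip: hat_ops(4))
next
  case (4 p t c)
  then show ?case by (simp add: lie_deg.intros Hat.msg_smult Hat.smult_mult[symmetric] mult.commute flip: hat_ops(6))
next
  case (5 p s q t)
  have "cl (Brk (twist s) (twist t)) = cl (Brk (tsg p s) (tsg q t))"
    using 5(3,4) by (simp add: hat_ops(8) flip: hat_ops(5))
  also have "\<dots> = msg hat_osp (p + q) (cl (Brk s t))"
    by (cases p; cases q) (simp_all add: tsg_def msg_def pres_laws(11,12) Hat.smult_minus1
        flip: hat_ops(6))
  finally show ?case using 5(3,4) by (simp add: lie_deg.intros)
qed

text \<open>Where both sides of a relation are homogeneous of the same degree, \<open>twist\<close>
  multiplies them by the same sign. Only the relations stated for arbitrary elements have to be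
  checked individually.\<close>

lemma twist_rel: "osp_rel s t \<Longrightarrow> cl (twist s) = cl (twist t)"
proof -
  assume r: "osp_rel s t"
  have hom: "cl (twist s) = cl (twist t)" if "lie_deg gen_part p s" "lie_deg gen_part p t" for p
    using twist_deg[OF that(1)] twist_deg[OF that(2)] cl_rel[OF r] by simp
  have d: "lie_deg gen_part p (Brk s t)" if "lie_deg gen_part q s" "lie_deg gen_part r t" "p = q + r" for p q r s t
    using that lie_deg.intros(5) by blast
  from r show ?thesis
  proof cases
    case (gen_add X a b)
    then show ?thesis
      using cl_rel[OF osp_rel.gen_add[of X "rho a" "rho b"]] cl_rel[OF osp_rel.gen_add[of X "- rho a" "- rho b"]]
      by (elim insertE emptyE) (simp_all add: rho_simps)
  next
    case (gen_scale X c a)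
    then show ?thesis
      using cl_rel[OF osp_rel.gen_scale[of X c "rho a"]] cl_rel[OF osp_rel.gen_scale[of X c "- rho a"]]
      by (elim insertE emptyE) (simp_all add: rho_simps scl_neg)
  next
    case (v_bar a)
    then show ?thesis by (auto simp: rho_simps(6)[symmetric] intro!: cl_rel osp_rel.v_bar)
  next
    case (w_bar a)
    then show ?thesis by (auto simp: rho_simps(6)[symmetric] intro!: cl_rel osp_rel.w_bar)
  next
    case (vf a p b q)
    show ?thesis
      by (rule hom[of "p + (1 + q)"]) (use vf in \<open>auto intro!: d[of p _ "1 + q"] lie_deg_gens mult_deg simp: add_ac\<close>)
  next
    case (gw a p b q)
    show ?thesis
      by (rule hom[of "1 + p + q"]) (use gw in \<open>auto intro!: d[of "1 + p" _ q] lie_deg_gens mult_deg simp: add_ac\<close>)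
  next
    case (ff a p b q)
    show ?thesis
      by (rule hom[of "p + q"]) (use ff in \<open>auto intro!: d[of "1 + p" _ "1 + q"] lie_deg_gens mult_deg simp: add_ac\<close>)
  next
    case (gg a p b q)
    show ?thesis
      by (rule hom[of "p + q"]) (use gg in \<open>auto intro!: d[of "1 + p" _ "1 + q"] lie_deg_gens mult_deg simp: add_ac\<close>)
  next
    case (fgf a p b q c r)
    have *: "a * b * c - bar (a * b) * c - sg (p * q + q * r + r * p) (c * b * a) \<in> H (p + q + r)"
      using fgf mult_deg3[of c r b q a p "p + q + r"] mult_deg[OF bar_deg[OF mult_deg[of a p b q]], of c r] mult_deg3[of a p b q c r "p + q + r"]
      by (auto simp: add_ac)
    show ?thesis
    proof (rule hom)
      show "lie_deg gen_part ((1 + p) + (1 + q) + (1 + r)) s"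
        unfolding fgf(1) by (intro lie_deg.intros(5) lie_deg_gens) (use fgf in simp_all)
      have e: "1 + ((1 + p) + (1 + q) + (1 + r)) = p + q + r" by (cases p; cases q; cases r) simp_all
      show "lie_deg gen_part ((1 + p) + (1 + q) + (1 + r)) t"
        unfolding fgf(2) by (rule lie_deg_gens(3)) (use * in \<open>simp only: e\<close>)
    qed
  next
    case (gfg a p b q c r)
    have *: "a * b * c - a * bar (b * c) - sg (p * q + q * r + r * p) (c * b * a) \<in> H (p + q + r)"
      using gfg mult_deg3[of c r b q a p "p + q + r"] mult_deg[OF _ bar_deg[OF mult_deg[of b q c r]], of a p] mult_deg3[of a p b q c r "p + q + r"]
      by (auto simp: add_ac)
    show ?thesis
    proof (rule hom)
      show "lie_deg gen_part ((1 + p) + ((1 + q) + (1 + r))) s"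
        unfolding gfg(1) by (intro lie_deg.intros(5) lie_deg_gens) (use gfg in simp_all)
      have e: "1 + ((1 + p) + ((1 + q) + (1 + r))) = p + q + r" by (cases p; cases q; cases r) simp_all
      show "lie_deg gen_part ((1 + p) + ((1 + q) + (1 + r))) t"
        unfolding gfg(2) by (rule lie_deg_gens(4)) (use * in \<open>simp only: e\<close>)
    qed
  qed (auto intro!: cl_rel osp_rel.intros)
qed

lemma twist_tsg: "twist (tsg p t) = tsg p (twist t)"
  by (simp add: tsg_def)

lemma twist_cong: "lie_cong gen_part osp_rel s t \<Longrightarrow> lie_cong gen_part osp_rel (twist s) (twist t)"
proof (induction rule: lie_cong.induct)
  case (rel s t)
  then show ?case using twist_rel[of s t] unfolding lie_cls_eq_iff by blast
next
  case (skew p s q t)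
  then show ?case using twist_deg by (simp add: twist_tsg lie_cong.skew)
next
  case (jacobi p s q t r u)
  then show ?case using twist_deg by (simp add: twist_tsg lie_cong.jacobi)
next
  case (sym s t)
  then show ?case by (blast intro: lie_cong.sym)
next
  case (trans s t u)
  then show ?case by (blast intro: lie_cong.trans)
qed (simp_all, (blast intro: lie_cong.refl lie_cong.cong_Add lie_cong.cong_Scale lie_cong.cong_Brk
    lie_cong.add_assoc lie_cong.add_comm lie_cong.add_zero lie_cong.add_neg lie_cong.scale_one
    lie_cong.scale_mult lie_cong.scale_add_left lie_cong.scale_add_right lie_cong.brk_add_left
    lie_cong.brk_add_right lie_cong.brk_scale_left lie_cong.brk_scale_right)+)

lemma hat_part_submodule: "submodule (part hat_osp p) type_ring hat_osp"
proof (rule Hat.submoduleI')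
  fix x y assume "x \<in> part hat_osp p" "y \<in> part hat_osp p"
  then show "x \<oplus>\<^bsub>hat_osp\<^esub> y \<in> part hat_osp p"
    unfolding hat_ops(3) by (auto simp: hat_ops(4) intro: lie_deg.intros)
next
  fix x c assume "x \<in> part hat_osp p"
  then show "c \<odot>\<^bsub>hat_osp\<^esub> x \<in> part hat_osp p"
    unfolding hat_ops(3) by (auto simp: hat_ops(6) intro: lie_deg.intros)
next
  show "\<zero>\<^bsub>hat_osp\<^esub> \<in> part hat_osp p"
    unfolding hat_ops(2,3) by (auto intro: lie_deg.intros)
qed (auto simp: hat_ops(1,3))

lemma hat_graded: "z2_graded hat_osp (part hat_osp)"
proof (rule Hat.z2_gradedI)
  fix x assume "x \<in> carrier hat_osp"
  then obtain t where t: "x = cl t" by (auto simp: hat_ops(1))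
  \<comment> \<open>\<open>e\<close> is the degree of the symbol of an even element: 0 for
    \<open>GV\<close> and \<open>GW\<close>, 1 for \<open>GF\<close> and \<open>GG\<close>, where
    the two components trade places.\<close>
  have g: "\<exists>s0 s1. lie_deg gen_part 0 s0 \<and> lie_deg gen_part 1 s1 \<and> cl (Gen (X a)) = cl (Add s0 s1)"
    if "X \<in> {GV, GW, GF, GG}" "\<And>b q. b \<in> H q \<Longrightarrow> lie_deg gen_part (e + q) (Gen (X b) :: ('k, 'r osp_gen) lie_term)" for X a e
  proof -
    have *: "cl (Gen (X a)) = cl (Add (Gen (X (hcomp 0 a))) (Gen (X (hcomp 1 a))))"
      using cl_rel[OF osp_rel.gen_add[OF that(1), of "hcomp 0 a" "hcomp 1 a"]] by (simp add: hcomp_sum)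
    have "lie_deg gen_part (e + q) (Gen (X (hcomp q a)) :: ('k, 'r osp_gen) lie_term)" for q by (rule that(2)) simp
    note d = this[of 0] this[of 1]
    show ?thesis
    proof (cases "e = 0")
      case True
      then show ?thesis using * d by auto
    next
      case False
      then have "e = 1" by simp
      then show ?thesis using d *[unfolded pres_laws(2)[where D = gen_part and Q = osp_rel and s = "Gen (X (hcomp 0 a))"]]
        by auto
    qed
  qed
  have "\<exists>s0 s1. lie_deg gen_part 0 s0 \<and> lie_deg gen_part 1 s1 \<and> cl t = cl (Add s0 s1)"
  proof (induction t)
    case (Gen h)
    show ?case
    proof (cases h)
      case (GV a) then show ?thesis using g[of GV 0 a] by (simp add: lie_deg_gens)
    next
      case (GW a) then show ?thesis using g[of GW 0 a] by (simp add: lie_deg_gens)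
    next
      case (GF a) then show ?thesis using g[of GF 1 a] by (simp add: lie_deg_gens)
    next
      case (GG a) then show ?thesis using g[of GG 1 a] by (simp add: lie_deg_gens)
    qed
  next
    case Zero
    show ?case using pres_laws(3)[where D = gen_part and Q = osp_rel and t = Zero] lie_deg.intros(2)[of gen_part] by metis
  next
    case (Add s t)
    then obtain s0 s1 t0 t1 where st: "lie_deg gen_part 0 s0" "lie_deg gen_part 1 s1" "lie_deg gen_part 0 t0" "lie_deg gen_part 1 t1"
      "cl s = cl (Add s0 s1)" "cl t = cl (Add t0 t1)" by blast
    have "cl (Add s t) = cl (Add (Add s0 t0) (Add s1 t1))"
      using st(5,6) by (simp add: Hat.M.a_ac flip: hat_ops(4))
    then show ?case using lie_deg.intros(3)[OF st(1,3)] lie_deg.intros(3)[OF st(2,4)] by blast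
  next
    case (Scale c t)
    then obtain t0 t1 where st: "lie_deg gen_part 0 t0" "lie_deg gen_part 1 t1" "cl t = cl (Add t0 t1)" by blast
    have "cl (Scale c t) = cl (Add (Scale c t0) (Scale c t1))"
      using st(3) by (simp add: Hat.smult_add_r flip: hat_ops(4,6))
    then show ?case using lie_deg.intros(4)[OF st(1)] lie_deg.intros(4)[OF st(2)] by blast
  next
    case (Brk s t)
    then obtain s0 s1 t0 t1 where st: "lie_deg gen_part 0 s0" "lie_deg gen_part 1 s1" "lie_deg gen_part 0 t0" "lie_deg gen_part 1 t1"
      "cl s = cl (Add s0 s1)" "cl t = cl (Add t0 t1)" by blast
    have "cl (Brk s t) = cl (Brk (Add s0 s1) (Add t0 t1))"
      using st(5,6) by (simp flip: hat_ops(5))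
    also have "\<dots> = cl (Add (Add (Brk s0 t0) (Brk s1 t1)) (Add (Brk s0 t1) (Brk s1 t0)))"
      by (simp add: pres_laws(9,10) Hat.M.a_ac flip: hat_ops(4))
    finally have *: "cl (Brk s t) = \<dots>" .
    have d: "lie_deg gen_part 0 (Brk s0 t0)" "lie_deg gen_part 0 (Brk s1 t1)" "lie_deg gen_part 1 (Brk s0 t1)" "lie_deg gen_part 1 (Brk s1 t0)"
      using lie_deg.intros(5)[OF st(1,3)] lie_deg.intros(5)[OF st(2,4)] lie_deg.intros(5)[OF st(1,4)] lie_deg.intros(5)[OF st(2,3)] by simp_all
    show ?case using * lie_deg.intros(3)[OF d(1,2)] lie_deg.intros(3)[OF d(3,4)] by blast
  qed
  then show "\<exists>x0\<in>part hat_osp 0. \<exists>x1\<in>part hat_osp 1. x = x0 \<oplus>\<^bsub>hat_osp\<^esub> x1"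
    unfolding t hat_ops(3) by (fastforce simp: hat_ops(4))
next
  fix x assume x: "x \<in> part hat_osp 0" "x \<in> part hat_osp 1"
  then obtain s t where st: "x = cl s" "x = cl t" "lie_deg gen_part 0 s" "lie_deg gen_part 1 t"
    by (auto simp: hat_ops(3))
  have c: "x \<in> carrier hat_osp" using st by simp
  have "lie_cong gen_part osp_rel (twist s) (twist t)"
    by (rule twist_cong) (use st in \<open>simp flip: lie_cls_eq_iff\<close>)
  then have "cl (twist s) = cl (twist t)" by (simp add: lie_cls_eq_iff)
  then have "x = \<ominus>\<^bsub>hat_osp\<^esub> x" using twist_deg[OF st(3)] twist_deg[OF st(4)] st(1,2) by (simp add: msg_def)
  then have "x \<oplus>\<^bsub>hat_osp\<^esub> x = \<zero>\<^bsub>hat_osp\<^esub>" using c by (metis Hat.M.r_neg)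
  then have "(1 + 1) \<odot>\<^bsub>hat_osp\<^esub> x = \<zero>\<^bsub>hat_osp\<^esub>" using c by (simp add: Hat.smult_add_l)
  then show "x = \<zero>\<^bsub>hat_osp\<^esub>" using Hat.unit_smult_cancel[OF hf(2) c] by blast
qed (rule hat_part_submodule)

lemma hat_lie_superalgebra: "lie_superalgebra hat_osp"
  using hat_graded unfolding hat_osp_def by (rule presented_lie_superalgebra)

sublocale Hat: lie_superalgebra hat_osp
  by (rule hat_lie_superalgebra)

lemma hat_gen_carrier [simp]:
  "hat_v a \<in> carrier hat_osp" "hat_w a \<in> carrier hat_osp" "hat_f a \<in> carrier hat_osp" "hat_g a \<in> carrier hat_osp"
  "hat_h a b \<in> carrier hat_osp"
  by (simp_all add: hat_v_def hat_w_def hat_f_def hat_g_def hat_h_def Hat.bracket_closed)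

lemma hat_gen_part:
  assumes "a \<in> H p"
  shows "hat_v a \<in> part hat_osp p" "hat_w a \<in> part hat_osp p" "hat_f a \<in> part hat_osp (1 + p)" "hat_g a \<in> part hat_osp (1 + p)"
  using assms lie_deg_gens[of a p] lie_deg_gens[of a "1 + p"]
  by (auto simp: hat_v_def hat_w_def hat_f_def hat_g_def hat_ops(3))

lemma gen_part_cases [consumes 1]:
  assumes "g \<in> gen_part p"
  obtains (V) a where "a \<in> H p" "cl (Gen g) = hat_v a" | (W) a where "a \<in> H p" "cl (Gen g) = hat_w a"
    | (F) a where "a \<in> H (1 + p)" "cl (Gen g) = hat_f a" | (G) a where "a \<in> H (1 + p)" "cl (Gen g) = hat_g a"
  using assms unfolding gen_part_def hat_v_def hat_w_def hat_f_def hat_g_def by blast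

lemma hat_h_part: "\<lbrakk>a \<in> H p; b \<in> H q\<rbrakk> \<Longrightarrow> hat_h a b \<in> part hat_osp (p + q)"
  unfolding hat_h_def using Hat.bracket_even[OF hat_gen_part(3,4), of a p b q] by (simp add: add_ac)

lemma hat_add:
  "hat_v (a + b) = hat_v a \<oplus>\<^bsub>hat_osp\<^esub> hat_v b" "hat_w (a + b) = hat_w a \<oplus>\<^bsub>hat_osp\<^esub> hat_w b"
  "hat_f (a + b) = hat_f a \<oplus>\<^bsub>hat_osp\<^esub> hat_f b" "hat_g (a + b) = hat_g a \<oplus>\<^bsub>hat_osp\<^esub> hat_g b"
  unfolding hat_v_def hat_w_def hat_f_def hat_g_def hat_ops(4)
  by (rule cl_rel, rule osp_rel.gen_add, simp)+

lemma hat_scl: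
  "hat_v (scl c a) = c \<odot>\<^bsub>hat_osp\<^esub> hat_v a" "hat_w (scl c a) = c \<odot>\<^bsub>hat_osp\<^esub> hat_w a"
  "hat_f (scl c a) = c \<odot>\<^bsub>hat_osp\<^esub> hat_f a" "hat_g (scl c a) = c \<odot>\<^bsub>hat_osp\<^esub> hat_g a"
  unfolding hat_v_def hat_w_def hat_f_def hat_g_def hat_ops(6)
  by (rule cl_rel, rule osp_rel.gen_scale, simp)+

lemma hat_zero [simp]: "hat_v 0 = \<zero>\<^bsub>hat_osp\<^esub>" "hat_w 0 = \<zero>\<^bsub>hat_osp\<^esub>" "hat_f 0 = \<zero>\<^bsub>hat_osp\<^esub>" "hat_g 0 = \<zero>\<^bsub>hat_osp\<^esub>"
  using hat_scl[of 0 0] by simp_all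

lemma hat_neg:
  "hat_v (- a) = \<ominus>\<^bsub>hat_osp\<^esub> hat_v a" "hat_w (- a) = \<ominus>\<^bsub>hat_osp\<^esub> hat_w a"
  "hat_f (- a) = \<ominus>\<^bsub>hat_osp\<^esub> hat_f a" "hat_g (- a) = \<ominus>\<^bsub>hat_osp\<^esub> hat_g a"
  using hat_scl[of "- 1" a] by (simp_all add: Hat.smult_minus1)

lemma hat_relations:
  "bracket hat_osp (hat_v a) (hat_g b) = \<zero>\<^bsub>hat_osp\<^esub>" "bracket hat_osp (hat_f a) (hat_w b) = \<zero>\<^bsub>hat_osp\<^esub>"
  "\<lbrakk>a \<in> H p; b \<in> H q\<rbrakk> \<Longrightarrow> bracket hat_osp (hat_v a) (hat_f b) = hat_g (sg q (tr a * bar b))"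
  "\<lbrakk>a \<in> H p; b \<in> H q\<rbrakk> \<Longrightarrow> bracket hat_osp (hat_g a) (hat_w b) = hat_f (- sg p (bar a * tr b))"
  "\<lbrakk>a \<in> H p; b \<in> H q\<rbrakk> \<Longrightarrow> bracket hat_osp (hat_f a) (hat_f b) = hat_w (sg p (bar a * b))"
  "\<lbrakk>a \<in> H p; b \<in> H q\<rbrakk> \<Longrightarrow> bracket hat_osp (hat_g a) (hat_g b) = hat_v (- sg q (a * bar b))"
  "\<lbrakk>a \<in> H p; b \<in> H q; c \<in> H r\<rbrakk> \<Longrightarrow> bracket hat_osp (hat_h a b) (hat_f c) =
    hat_f (a * b * c - bar (a * b) * c - sg (p * q + q * r + r * p) (c * b * a))"
  "\<lbrakk>a \<in> H p; b \<in> H q; c \<in> H r\<rbrakk> \<Longrightarrow> bracket hat_osp (hat_g a) (hat_h b c) =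
    hat_g (a * b * c - a * bar (b * c) - sg (p * q + q * r + r * p) (c * b * a))"
  "hat_v (bar a) = hat_v a" "hat_w (bar a) = hat_w a"
  unfolding hat_h_def hat_v_def hat_w_def hat_f_def hat_g_def hat_ops(5) hat_ops(2)
  by (rule cl_rel, rule osp_rel.intros; assumption)+

text \<open>Together with the corresponding formula for \<open>hat_v\<close> this shows that the
  elements \<open>hat_f\<close> and \<open>hat_g\<close> generate, so properties inherited by
  brackets need only be verified on them.\<close>

lemma hat_w_eq: "a \<in> H p \<Longrightarrow> hat_w a = bracket hat_osp (hat_f 1) (hat_f a)"
  using hat_relations(5)[OF one_H0, of a p] by simp

lemma hat_v_eq: "a \<in> H p \<Longrightarrow> hat_v a = bracket hat_osp (hat_g (- a)) (hat_g 1)"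
  using hat_relations(6)[OF _ one_H0, of "- a" p] by simp

subsection \<open>The homomorphism onto matrices\<close>

lemma psi_exists: "\<exists>\<psi>. \<psi> \<in> lie_hom hat_osp osp \<and>
    (\<forall>a. \<psi> (hat_v a) = osp_v a \<and> \<psi> (hat_w a) = osp_w a \<and>
         \<psi> (hat_f a) = osp_f a \<and> \<psi> (hat_g a) = osp_g a)"
proof -
  define \<gamma> where "\<gamma> h = (case h of GV a \<Rightarrow> osp_v a | GW a \<Rightarrow> osp_w a | GF a \<Rightarrow> osp_f a | GG a \<Rightarrow> osp_g a)"
    for h :: "'r osp_gen"
  have car: "\<gamma> h \<in> carrier osp" for h by (cases h) (simp_all add: \<gamma>_def osp_gen_in)
  have deg: "\<gamma> h \<in> part osp p" if "h \<in> gen_part p" for h p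
    using that osp_gen_part[of _ p] osp_gen_part(3,4)[of _ "1 + p"]
    by (auto simp: gen_part_def \<gamma>_def osp_gen_in add_ac)
  have rel: "O.term_val \<gamma> s = O.term_val \<gamma> t" if "osp_rel s t" for s t
    using that
  proof cases
    case (gen_add X a b) then show ?thesis by (auto simp: \<gamma>_def osp_gen_linear)
  next
    case (gen_scale X c a) then show ?thesis by (auto simp: \<gamma>_def osp_gen_linear)
  qed (simp_all add: \<gamma>_def osp_gen_linear osp_rel_zero osp_rel_homogeneous(5-8) osp_rel_triple(1) osp_rel_triple(4) add_ac mult_ac)
  obtain \<theta> where "\<theta> \<in> lie_hom hat_osp osp" "\<And>t. \<theta> (cl t) = O.term_val \<gamma> t"
    unfolding hat_osp_def by (rule O.presented_hom[of \<gamma> gen_part osp_rel]) (use car deg rel in auto)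
  then show ?thesis
    by (intro exI[of _ \<theta>]) (simp add: hat_v_def hat_w_def hat_f_def hat_g_def \<gamma>_def)
qed

lemma psi_hom: "psi \<in> lie_hom hat_osp osp"
  and psi_gen [simp]: "psi (hat_v a) = osp_v a" "psi (hat_w a) = osp_w a" "psi (hat_f a) = osp_f a" "psi (hat_g a) = osp_g a"
  using someI_ex[OF psi_exists] unfolding psi_def[symmetric] by auto

sublocale psi: lie_homomorphism hat_osp osp psi
  by unfold_locales (rule psi_hom)

lemma psi_part: "x \<in> part hat_osp p \<Longrightarrow> psi x \<in> mat_part p" "x \<in> carrier hat_osp \<Longrightarrow> psi x \<in> osp_set"
  using psi.hom_part psi.hom_closed by auto

lemma psi_h: "psi (hat_h a b) = mat_bracket (osp_f a) (osp_g b)"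
  unfolding hat_h_def by (simp add: psi.hom_bracket)

lemma psi_surj: "psi ` carrier hat_osp = osp_set"
proof (intro equalityI subsetI)
  fix X assume "X \<in> osp_set"
  then show "X \<in> psi ` carrier hat_osp"
  proof (rule osp_set_generated[rotated 6])
    show "submodule (psi ` carrier hat_osp) type_ring mat_lie"
    proof (rule M.submoduleI')
      show "\<zero>\<^bsub>mat_lie\<^esub> \<in> psi ` carrier hat_osp"
        using psi.hom_zero by (metis Hat.M.zero_closed imageI mat_lie_simps(2) osp_simps(2))
      fix X Y c assume "X \<in> psi ` carrier hat_osp"
      then obtain x where x: "x \<in> carrier hat_osp" "X = psi x" by blast
      show "c \<odot>\<^bsub>mat_lie\<^esub> X \<in> psi ` carrier hat_osp"
        using psi.hom_smult[OF x(1), of c] x by (metis Hat.smult_in imageI osp_simps(6))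
      assume "Y \<in> psi ` carrier hat_osp"
      then obtain y where y: "y \<in> carrier hat_osp" "Y = psi y" by blast
      show "X \<oplus>\<^bsub>mat_lie\<^esub> Y \<in> psi ` carrier hat_osp"
        using psi.hom_add[OF x(1) y(1)] x y by (metis Hat.M.add.m_closed imageI mat_lie_simps(3) osp_simps(3))
    qed simp
  qed (metis imageI hat_gen_carrier psi_gen psi_h)+
qed (use psi_part in blast)

subsection \<open>The spanning set\<close>

definition hat_span :: "('k, 'r osp_gen) lie_term set set"
  where "hat_span = lin_span hat_osp (\<Union>k. spanning k)"

lemma spanning_homogeneous: "x \<in> spanning k \<Longrightarrow> \<exists>p. x \<in> part hat_osp p"
  by (cases k) (auto intro: hat_gen_part hat_h_part)

lemma spanning_carrier: "x \<in> spanning k \<Longrightarrow> x \<in> carrier hat_osp"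
  by (cases k) auto

lemma hat_span_submodule: "submodule hat_span type_ring hat_osp"
  unfolding hat_span_def by (rule Hat.lin_span_submodule) (use spanning_carrier in blast)

lemmas hat_spanD = Hat.submodule_zero[OF hat_span_submodule] Hat.submoduleE(3-5)[OF hat_span_submodule]

lemma hat_span_msg: "x \<in> hat_span \<Longrightarrow> msg hat_osp p x \<in> hat_span"
  by (simp add: msg_def hat_spanD)

lemma spanning_in: "x \<in> spanning k \<Longrightarrow> x \<in> hat_span"
  unfolding hat_span_def by (rule Hat.lin_span_incl) blast

lemma hat_span_induct [consumes 1, case_names spanning zero add smult]:
  assumes "x \<in> hat_span" "\<And>x k. x \<in> spanning k \<Longrightarrow> P x" "P \<zero>\<^bsub>hat_osp\<^esub>"
    "\<And>x y. \<lbrakk>x \<in> carrier hat_osp; y \<in> carrier hat_osp; P x; P y\<rbrakk> \<Longrightarrow> P (x \<oplus>\<^bsub>hat_osp\<^esub> y)"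
    "\<And>c x. \<lbrakk>x \<in> carrier hat_osp; P x\<rbrakk> \<Longrightarrow> P (c \<odot>\<^bsub>hat_osp\<^esub> x)"
  shows "P x"
  using assms(1) unfolding hat_span_def
  by (rule Hat.lin_span_induct) (use assms(2-) spanning_carrier in auto)

lemma hat_span_gen:
  "a \<in> H p \<Longrightarrow> hat_v a \<in> hat_span" "a \<in> H p \<Longrightarrow> hat_w a \<in> hat_span"
  "a \<in> H p \<Longrightarrow> hat_f a \<in> hat_span" "a \<in> H p \<Longrightarrow> hat_g a \<in> hat_span"
  "\<lbrakk>a \<in> H p; b \<in> H q\<rbrakk> \<Longrightarrow> hat_h a b \<in> hat_span"
  by (rule spanning_in[of _ KV], force) (rule spanning_in[of _ KW], force, rule spanning_in[of _ KF], force,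
    rule spanning_in[of _ KG], force, rule spanning_in[of _ KH], force)

text \<open>The elements whose adjoint action preserves the span. By the Leibniz rule brackets of
  homogeneous elements of \<open>stab\<close> stay in it, so it exhausts \<open>hat_osp\<close> once
  it contains all \<open>hat_f\<close> and \<open>hat_g\<close>.\<close>

definition stab :: "('k, 'r osp_gen) lie_term set set"
  where "stab = {x \<in> carrier hat_osp. \<forall>s\<in>hat_span. bracket hat_osp x s \<in> hat_span}"

lemma hat_span_carrier: "s \<in> hat_span \<Longrightarrow> s \<in> carrier hat_osp"
  using Hat.submoduleE(1)[OF hat_span_submodule] by blast

lemma stabI:
  assumes "x \<in> carrier hat_osp" "\<And>s k. s \<in> spanning k \<Longrightarrow> bracket hat_osp x s \<in> hat_span"
  shows "x \<in> stab"
proof -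
  have "bracket hat_osp x s \<in> hat_span" if "s \<in> hat_span" for s
    using that by (induction rule: hat_span_induct)
      (use assms in \<open>auto simp: Hat.bracket_add_right Hat.bracket_smult_right hat_spanD\<close>)
  with assms(1) show ?thesis by (simp add: stab_def)
qed

lemma bracket_swap_span:
  assumes "x \<in> part hat_osp p" "y \<in> part hat_osp q" "bracket hat_osp y x \<in> hat_span"
  shows "bracket hat_osp x y \<in> hat_span"
  using Hat.super_skew[OF assms(1,2)] assms(3) by (simp add: hat_span_msg hat_spanD)

text \<open>The bracket of \<open>hat_f a\<close> or \<open>hat_g a\<close> with a spanning element
  is, up to skew-symmetry, either an element \<open>hat_h\<close> or the left-hand side of a
  defining relation.\<close>

lemma stab_fg:
  assumes a: "a \<in> H p"
  shows "hat_f a \<in> stab" "hat_g a \<in> stab"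
proof -
  note pa = hat_gen_part[OF a]
  have d: "b \<in> H q \<Longrightarrow> tr b * bar a \<in> H (q + p)" "b \<in> H q \<Longrightarrow> bar a * b \<in> H (p + q)"
    "b \<in> H q \<Longrightarrow> bar a * tr b \<in> H (p + q)" "b \<in> H q \<Longrightarrow> a * bar b \<in> H (p + q)" for b q
    using a by (auto intro: mult_deg)
  have d3: "\<exists>e. b * c * a - bar (b * c) * a - sg i (a * c * b) \<in> H e"
     "\<exists>e. a * b * c - a * bar (b * c) - sg i (c * b * a) \<in> H e" if "b \<in> H q" "c \<in> H r" for b c q r i
  proof -
    show "\<exists>e. b * c * a - bar (b * c) * a - sg i (a * c * b) \<in> H e"
      using mult_deg3[OF that a HOL.refl] mult_deg[OF bar_deg[OF mult_deg[OF that]] a]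
        mult_deg3[OF a that(2,1), of "q + r + p"] by (intro exI[of _ "q + r + p"]) (auto simp: add_ac)
    show "\<exists>e. a * b * c - a * bar (b * c) - sg i (c * b * a) \<in> H e"
      using mult_deg3[OF a that HOL.refl] mult_deg[OF a bar_deg[OF mult_deg[OF that]]]
        mult_deg3[OF that(2,1) a, of "p + q + r"] by (intro exI[of _ "p + q + r"]) (auto simp: add_ac)
  qed
  show "hat_f a \<in> stab"
  proof (rule stabI)
    fix s k assume s: "s \<in> spanning k"
    show "bracket hat_osp (hat_f a) s \<in> hat_span"
    proof (cases k)
      case KH
      then obtain b c q r where bc: "b \<in> H q" "c \<in> H r" "s = hat_h b c" using s by auto
      show ?thesis unfolding bc(3)
        using d3(1)[OF bc(1,2)] by (intro bracket_swap_span[OF pa(3) hat_h_part[OF bc(1,2)]])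
          (use hat_relations(7)[OF bc(1,2) a] hat_span_gen(3) in auto)
    next
      case KV
      then obtain b q where b: "b \<in> H q" "s = hat_v b" using s by auto
      show ?thesis unfolding b(2)
        by (intro bracket_swap_span[OF pa(3) hat_gen_part(1)[OF b(1)]])
          (use hat_relations(3)[OF b(1) a] hat_span_gen(4)[OF sg_in[OF d(1)[OF b(1)]]] in auto)
    next
      case KW
      then show ?thesis using s by (auto simp: hat_relations hat_spanD)
    next
      case KF
      then obtain b q where b: "b \<in> H q" "s = hat_f b" using s by auto
      show ?thesis unfolding b(2) hat_relations(5)[OF a b(1)]
        by (rule hat_span_gen(2)[OF sg_in[OF d(2)[OF b(1)]]])
    next
      case KG
      then obtain b q where b: "b \<in> H q" "s = hat_g b" using s by auto
      show ?thesis unfolding b(2) hat_h_def[symmetric] by (rule hat_span_gen(5)[OF a b(1)])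
    qed
  qed simp
  show "hat_g a \<in> stab"
  proof (rule stabI)
    fix s k assume s: "s \<in> spanning k"
    show "bracket hat_osp (hat_g a) s \<in> hat_span"
    proof (cases k)
      case KH
      then obtain b c q r where bc: "b \<in> H q" "c \<in> H r" "s = hat_h b c" using s by auto
      show ?thesis unfolding bc(3) hat_relations(8)[OF a bc(1,2)]
        using d3(2)[OF bc(1,2)] hat_span_gen(4) by blast
    next
      case KV
      then obtain b q where b: "b \<in> H q" "s = hat_v b" using s by auto
      show ?thesis unfolding b(2)
        by (intro bracket_swap_span[OF pa(4) hat_gen_part(1)[OF b(1)]]) (simp add: hat_relations hat_spanD)
    next
      case KW
      then obtain b q where b: "b \<in> H q" "s = hat_w b" using s by auto
      show ?thesis unfolding b(2) hat_relations(4)[OF a b(1)]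
        by (rule hat_span_gen(3)[OF H_intros(3)[OF sg_in[OF d(3)[OF b(1)]]]])
    next
      case KF
      then obtain b q where b: "b \<in> H q" "s = hat_f b" using s by auto
      show ?thesis unfolding b(2)
        by (intro bracket_swap_span[OF pa(4) hat_gen_part(3)[OF b(1)]])
          (use hat_span_gen(5)[OF b(1) a] in \<open>simp add: hat_h_def\<close>)
    next
      case KG
      then obtain b q where b: "b \<in> H q" "s = hat_g b" using s by auto
      show ?thesis unfolding b(2) hat_relations(6)[OF a b(1)]
        by (rule hat_span_gen(1)[OF H_intros(3)[OF sg_in[OF d(4)[OF b(1)]]]])
    qed
  qed simp
qed

lemma stab_bracket:
  assumes x: "x \<in> part hat_osp p" "x \<in> stab" and y: "y \<in> part hat_osp q" "y \<in> stab"
  shows "bracket hat_osp x y \<in> stab"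
proof (rule stabI)
  show "bracket hat_osp x y \<in> carrier hat_osp" using x y by (simp add: Hat.bracket_closed Hat.part_carrier)
  fix s k assume s: "s \<in> spanning k"
  then obtain r where r: "s \<in> part hat_osp r" using spanning_homogeneous by blast
  have sp: "bracket hat_osp x (bracket hat_osp y s) \<in> hat_span" "bracket hat_osp y (bracket hat_osp x s) \<in> hat_span"
    using x(2) y(2) spanning_in[OF s] by (auto simp: stab_def)
  have c: "bracket hat_osp (bracket hat_osp x y) s \<in> carrier hat_osp"
    "bracket hat_osp y (bracket hat_osp x s) \<in> carrier hat_osp"
    using x(1) y(1) r by (simp_all add: Hat.bracket_closed Hat.part_carrier)
  have "bracket hat_osp (bracket hat_osp x y) s = bracket hat_osp x (bracket hat_osp y s)
      \<oplus>\<^bsub>hat_osp\<^esub> \<ominus>\<^bsub>hat_osp\<^esub> msg hat_osp (p * q) (bracket hat_osp y (bracket hat_osp x s))"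
    unfolding Hat.leibniz[OF x(1) y(1) r] using c by (simp add: Hat.M.a_assoc Hat.M.r_neg)
  then show "bracket hat_osp (bracket hat_osp x y) s \<in> hat_span"
    using sp by (simp add: hat_span_msg hat_spanD)
qed

text \<open>The two claims are proved together: a bracket lies in the span because its left factor
  is in \<open>stab\<close> and its right factor is in the span.\<close>

lemma hat_deg_span: "lie_deg gen_part p t \<Longrightarrow> cl t \<in> stab \<and> cl t \<in> hat_span"
proof (induction rule: lie_deg.induct)
  case (1 g p)
  then show ?case
  proof (cases rule: gen_part_cases)
    case (V a)
    have "hat_v a \<in> stab" unfolding hat_v_eq[OF V(1)]
      by (intro stab_bracket[OF hat_gen_part(4) _ hat_gen_part(4)] stab_fg(2)) (use V in auto)
    then show ?thesis using V hat_span_gen by auto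
  next
    case (W a)
    have "hat_w a \<in> stab" unfolding hat_w_eq[OF W(1)]
      by (intro stab_bracket[OF hat_gen_part(3) _ hat_gen_part(3)] stab_fg(1)) (use W in auto)
    then show ?thesis using W hat_span_gen by auto
  next
    case (F a)
    then show ?thesis using stab_fg hat_span_gen by auto
  next
    case (G a)
    then show ?thesis using stab_fg hat_span_gen by auto
  qed
next
  case (2 p)
  then show ?case using hat_spanD(1) hat_span_carrier
    by (auto simp: stab_def simp flip: hat_ops(2))
next
  case (3 p s t)
  then show ?case using hat_span_carrier
    by (auto simp: stab_def Hat.bracket_add_left hat_spanD simp flip: hat_ops(4))
next
  case (4 p t c)
  then show ?case using hat_span_carrier
    by (auto simp: stab_def Hat.bracket_smult_left hat_spanD simp flip: hat_ops(6))
next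
  case (5 p s q t)
  have "cl s \<in> part hat_osp p" "cl t \<in> part hat_osp q" using 5(1,2) by (auto simp: hat_ops(3))
  then show ?case using 5(3,4) stab_bracket[of "cl s" p "cl t" q] by (auto simp: stab_def simp flip: hat_ops(5))
qed

lemma hat_span_eq: "x \<in> carrier hat_osp \<Longrightarrow> x \<in> hat_span"
proof (induction rule: Hat.homogeneous_induct)
  case (homogeneous x p)
  then show ?case using hat_deg_span by (auto simp: hat_ops(3))
qed (simp add: hat_spanD)

lemmas hat_induct = hat_span_eq[THEN hat_span_induct, consumes 1, case_names spanning zero add smult]


subsection \<open>The center of the universal extension\<close>

definition cls :: "'r \<Rightarrow> 'r set" where "cls a = I3 +>\<^bsub>alg_module scl\<^esub> a"

lemma cls_eq: "cls a = {i + a | i. i \<in> I3}"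
  by (auto simp: cls_def a_r_coset_def')

lemma cls_self: "a \<in> cls a"
  unfolding cls_eq using I3D(1) by force

lemma cls_eq_iff: "cls a = cls b \<longleftrightarrow> a - b \<in> I3"
proof
  assume "cls a = cls b"
  then have "a \<in> cls b" using cls_self by metis
  then show "a - b \<in> I3" by (auto simp: cls_eq)
next
  assume ab: "a - b \<in> I3"
  have "cls a \<subseteq> cls b" if "a - b \<in> I3" for a b
  proof
    fix x assume "x \<in> cls a"
    then obtain i where "i \<in> I3" "x = i + a" by (auto simp: cls_eq)
    then have "i + (a - b) \<in> I3" "x = (i + (a - b)) + b" using I3D(2)[OF _ that] by simp_all
    then show "x \<in> cls b" unfolding cls_eq by blast
  qed
  from this[OF ab] this[of b a] ab I3D(3)[OF ab] show "cls a = cls b" by auto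
qed

lemma cls_zero: "cls 0 = I3"
  by (auto simp: cls_eq)

lemma R_mod_carrier: "carrier R_mod_I3 = range cls"
  by (auto simp: R_mod_I3_def quot_module_def A_RCOSETS_def' cls_def)

lemma R_mod_zero: "\<zero>\<^bsub>R_mod_I3\<^esub> = cls 0"
  by (simp add: R_mod_I3_def quot_module_def cls_zero)

lemma R_mod_add: "cls a \<oplus>\<^bsub>R_mod_I3\<^esub> cls b = cls (a + b)"
proof -
  have "cls a \<oplus>\<^bsub>R_mod_I3\<^esub> cls b = {x + y | x y. x \<in> cls a \<and> y \<in> cls b}"
    by (auto simp: R_mod_I3_def quot_module_def set_add_def')
  also have "\<dots> = cls (a + b)"
  proof (intro equalityI subsetI)
    fix z assume "z \<in> {x + y | x y. x \<in> cls a \<and> y \<in> cls b}"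
    then obtain i j where ij: "i \<in> I3" "j \<in> I3" "z = (i + a) + (j + b)" by (auto simp: cls_eq)
    then have "i + j \<in> I3" "z = (i + j) + (a + b)" using I3D(2) by (simp_all add: algebra_simps)
    then show "z \<in> cls (a + b)" unfolding cls_eq by blast
  next
    fix z assume "z \<in> cls (a + b)"
    then obtain i where "i \<in> I3" "z = (i + a) + b" by (auto simp: cls_eq add.assoc)
    then show "z \<in> {x + y | x y. x \<in> cls a \<and> y \<in> cls b}"
      using cls_self[of b] unfolding cls_eq[of a] by blast
  qed
  finally show ?thesis .
qed

lemma R_mod_smult: "c \<odot>\<^bsub>R_mod_I3\<^esub> cls a = cls (scl c a)"
proof -
  have "c \<odot>\<^bsub>R_mod_I3\<^esub> cls a = (\<Union>b\<in>cls a. cls (scl c b))"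
    by (simp add: R_mod_I3_def quot_module_def cls_def)
  also have "\<dots> = (\<Union>b\<in>cls a. cls (scl c a))"
  proof (rule SUP_cong[OF HOL.refl])
    fix b assume "b \<in> cls a"
    then have "b - a \<in> I3" by (auto simp: cls_eq)
    then show "cls (scl c b) = cls (scl c a)" unfolding cls_eq_iff using I3D(5)[of "b - a" c] by (simp add: scl_diff)
  qed
  also have "\<dots> = cls (scl c a)" using cls_self by blast
  finally show ?thesis .
qed

definition zc :: "'r \<Rightarrow> 'r \<Rightarrow> 'r set \<times> 'r set" where "zc a b = (cls a, cls b)"

lemma z_carrier: "carrier z_module = {zc a b | a b. True}"
  by (auto simp: z_module_def R_mod_carrier zc_def)

lemma zc_in [simp]: "zc a b \<in> carrier z_module"
  by (auto simp: z_carrier)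

lemma z_zero: "\<zero>\<^bsub>z_module\<^esub> = zc 0 0"
  and z_add: "zc a b \<oplus>\<^bsub>z_module\<^esub> zc a' b' = zc (a + a') (b + b')"
  and z_smult: "c \<odot>\<^bsub>z_module\<^esub> zc a b = zc (scl c a) (scl c b)"
  by (simp_all add: z_module_def zc_def R_mod_zero R_mod_add R_mod_smult)

lemma zc_eq_iff: "zc a b = zc a' b' \<longleftrightarrow> a - a' \<in> I3 \<and> b - b' \<in> I3"
  by (simp add: zc_def cls_eq_iff)

lemma z_cases: "x \<in> carrier z_module \<Longrightarrow> (\<And>a b. x = zc a b \<Longrightarrow> P) \<Longrightarrow> P"
  by (auto simp: z_carrier)

lemma z_module_module: "Module.module type_ring z_module"
  by (rule kmoduleI; (elim z_cases)?; simp add: z_zero z_add z_smult scl_simps algebra_simps)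

sublocale Z: kmodule z_module
  using z_module_module by (simp add: kmodule_def)

lemma z_neg: "\<ominus>\<^bsub>z_module\<^esub> zc a b = zc (- a) (- b)"
  using Z.smult_minus1[of "zc a b"] by (simp add: z_smult)

lemma z_msg: "msg z_module p (zc a b) = zc (sg p a) (sg p b)"
  by (simp add: msg_def sg_def z_neg)

lemma pi_eq: "pi1 a = zc a 0" "pi2 a = zc 0 a"
  by (simp_all add: pi1_def pi2_def zc_def R_mod_zero cls_def)

lemma z_part_eq: "z_part p = {zc a b | a b. a \<in> H (1 + p) \<and> b \<in> H (1 + p)}"
  by (simp add: z_part_def pi_eq z_add)

lemma z_graded: "z2_graded z_module z_part"
proof (rule Z.z2_gradedI)
  show "submodule (z_part p) type_ring z_module" for p
  proof (rule Z.submoduleI')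
    show "\<zero>\<^bsub>z_module\<^esub> \<in> z_part p" unfolding z_zero z_part_eq by blast
    fix x y c assume "x \<in> z_part p"
    then obtain a b where x: "x = zc a b" "a \<in> H (1 + p)" "b \<in> H (1 + p)" by (auto simp: z_part_eq)
    show "c \<odot>\<^bsub>z_module\<^esub> x \<in> z_part p" using x unfolding z_part_eq by (auto simp: z_smult)
    assume "y \<in> z_part p"
    then obtain a' b' where "y = zc a' b'" "a' \<in> H (1 + p)" "b' \<in> H (1 + p)" by (auto simp: z_part_eq)
    then show "x \<oplus>\<^bsub>z_module\<^esub> y \<in> z_part p" using x unfolding z_part_eq by (auto simp: z_add)
  qed (auto simp: z_part_eq)
next
  fix x assume "x \<in> carrier z_module"
  then obtain a b where x: "x = zc a b" by (auto simp: z_carrier)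
  have "x = zc (hcomp 1 a) (hcomp 1 b) \<oplus>\<^bsub>z_module\<^esub> zc (hcomp 0 a) (hcomp 0 b)"
    using hcomp_sum[of a] hcomp_sum[of b] by (simp add: x z_add add.commute)
  moreover have "zc (hcomp 1 a) (hcomp 1 b) \<in> z_part 0" "zc (hcomp 0 a) (hcomp 0 b) \<in> z_part 1"
    unfolding z_part_eq by auto
  ultimately show "\<exists>x0\<in>z_part 0. \<exists>x1\<in>z_part 1. x = x0 \<oplus>\<^bsub>z_module\<^esub> x1" by blast
next
  fix x assume "x \<in> z_part 0" "x \<in> z_part 1"
  then obtain a b where 1: "x = zc a b" "a \<in> H 1" "b \<in> H 1" unfolding z_part_eq by auto
  from \<open>x \<in> z_part 1\<close> obtain a' b' where 2: "x = zc a' b'" "a' \<in> H 0" "b' \<in> H 0" unfolding z_part_eq by auto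
  note e = 1(1) 2(1) 1(2,3) 2(2,3)
  \<comment> \<open>\<open>I3\<close> contains the components of its elements, and \<open>a\<close>
    is odd while \<open>a'\<close> is even.\<close>
  have "hcomp 1 (a - a') \<in> I3" "hcomp 1 (b - b') \<in> I3"
    using e(1,2) zc_eq_iff[of a b a' b'] I3_hcomp by auto
  then have "a \<in> I3" "b \<in> I3" using e by (simp_all add: hcomp_diff)
  then show "x = \<zero>\<^bsub>z_module\<^esub>" using zc_eq_iff[of a b 0 0] by (simp add: e(1) z_zero)
qed

subsection \<open>The cocycle on \<open>hat_osp\<close>\<close>

definition beta_mat :: "('k, 'r osp_gen) lie_term set \<Rightarrow> ('k, 'r osp_gen) lie_term set \<Rightarrow> 'r set \<times> 'r set"
  where "beta_mat x y = zc (raw1 (psi x) (psi y)) (raw2 (psi x) (psi y))"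

text \<open>Each of the four entries read by \<open>raw1\<close> and \<open>raw2\<close> can be
  nonzero for a single kind only, which explains the vanishing of \<open>beta\<close> on all other
  pairs of kinds.\<close>

lemma spanning_entries:
  assumes "x \<in> spanning k"
  shows "k \<noteq> KV \<Longrightarrow> psi x $ 2 $ 3 = 0" "k \<noteq> KG \<Longrightarrow> psi x $ 2 $ 1 = 0"
    "k \<noteq> KW \<Longrightarrow> psi x $ 3 $ 2 = 0" "k \<noteq> KF \<Longrightarrow> psi x $ 3 $ 1 = 0"
    "\<exists>p. psi x \<in> mat_part p"
proof -
  show "k \<noteq> KV \<Longrightarrow> psi x $ 2 $ 3 = 0" "k \<noteq> KG \<Longrightarrow> psi x $ 2 $ 1 = 0"
    "k \<noteq> KW \<Longrightarrow> psi x $ 3 $ 2 = 0" "k \<noteq> KF \<Longrightarrow> psi x $ 3 $ 1 = 0"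
    using assms by (cases k; auto simp: psi_h osp_fg)+
  show "\<exists>p. psi x \<in> mat_part p" using spanning_homogeneous[OF assms] psi_part by blast
qed

lemma beta_mat_zero:
  assumes "(i, j) \<notin> {(KV, KG), (KG, KV), (KF, KW), (KW, KF)}" "x \<in> spanning i" "y \<in> spanning j"
  shows "beta_mat x y = zc 0 0"
proof -
  note ex = spanning_entries[OF assms(2)] and ey = spanning_entries[OF assms(3)]
  obtain p q where h: "psi x \<in> mat_part p" "psi y \<in> mat_part q" using ex(5) ey(5) by blast
  have "raw1 (psi x) (psi y) = 0" "raw1 (tau (psi x)) (tau (psi y)) = 0"
    unfolding raw1_homogeneous[OF h] raw1_homogeneous[OF h[THEN tau_part]]
    using ex(1-4) ey(1-4) assms(1) by (cases i; cases j; simp)+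
  then show ?thesis by (simp add: beta_mat_def raw2_def rho_simps)
qed

lemma beta_mat_gen:
  assumes a: "a \<in> H p" and b: "b \<in> H q"
  shows "beta_mat (hat_v a) (hat_g b) = pi1 (tr a * b)"
    "beta_mat (hat_g b) (hat_v a) = \<ominus>\<^bsub>z_module\<^esub> msg z_module (p * (1 + q)) (pi1 (tr a * b))"
    "beta_mat (hat_f a) (hat_w b) = pi2 (a * tr b)"
    "beta_mat (hat_w b) (hat_f a) = \<ominus>\<^bsub>z_module\<^esub> msg z_module ((1 + p) * q) (pi2 (a * tr b))"
proof -
  note g = raw1_gen[OF a b]
  note s = raw1_skew[OF osp_gen_part(4)[OF b] osp_gen_part(1)[OF a]] raw2_skew[OF osp_gen_part(4)[OF b] osp_gen_part(1)[OF a]]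
    raw1_skew[OF osp_gen_part(2)[OF b] osp_gen_part(3)[OF a]] raw2_skew[OF osp_gen_part(2)[OF b] osp_gen_part(3)[OF a]]
  show "beta_mat (hat_v a) (hat_g b) = pi1 (tr a * b)"
    "beta_mat (hat_f a) (hat_w b) = pi2 (a * tr b)"
    by (simp_all add: beta_mat_def g pi_eq)
  show "beta_mat (hat_g b) (hat_v a) = \<ominus>\<^bsub>z_module\<^esub> msg z_module (p * (1 + q)) (pi1 (tr a * b))"
    "beta_mat (hat_w b) (hat_f a) = \<ominus>\<^bsub>z_module\<^esub> msg z_module ((1 + p) * q) (pi2 (a * tr b))"
    by (simp_all add: beta_mat_def s g pi_eq z_msg z_neg mult.commute add.commute)
qed

lemma beta_mat_bilinear:
  assumes "x \<in> carrier hat_osp" "y \<in> carrier hat_osp"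
  shows "beta_mat (x \<oplus>\<^bsub>hat_osp\<^esub> y) z = beta_mat x z \<oplus>\<^bsub>z_module\<^esub> beta_mat y z"
    "beta_mat z (x \<oplus>\<^bsub>hat_osp\<^esub> y) = beta_mat z x \<oplus>\<^bsub>z_module\<^esub> beta_mat z y"
    "beta_mat (c \<odot>\<^bsub>hat_osp\<^esub> x) z = c \<odot>\<^bsub>z_module\<^esub> beta_mat x z"
    "beta_mat z (c \<odot>\<^bsub>hat_osp\<^esub> x) = c \<odot>\<^bsub>z_module\<^esub> beta_mat z x"
  using assms by (simp_all add: beta_mat_def psi.hom_add psi.hom_smult raw1_add raw2_add raw1_smult raw2_smult z_add z_smult)

lemma is_beta_beta_mat: "is_beta beta_mat"
  unfolding is_beta_def using beta_mat_gen beta_mat_zero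
  by (intro conjI allI ballI impI) (simp_all add: beta_mat_bilinear z_zero, simp_all add: beta_mat_def)

text \<open>\<open>beta\<close> is picked by \<open>SOME\<close>; uniqueness on the carrier
  identifies it with the explicit \<open>beta_mat\<close>. Bilinearity reduces the claim to the
  spanning set, first in the second and then in the first argument.\<close>

lemma is_beta_unique:
  assumes "is_beta \<beta>" "is_beta \<beta>'" and x: "x \<in> carrier hat_osp" and y: "y \<in> carrier hat_osp"
  shows "\<beta> x y = \<beta>' x y"
proof -
  have lin: "\<gamma> (x \<oplus>\<^bsub>hat_osp\<^esub> y) z = \<gamma> x z \<oplus>\<^bsub>z_module\<^esub> \<gamma> y z" "\<gamma> z (x \<oplus>\<^bsub>hat_osp\<^esub> y) = \<gamma> z x \<oplus>\<^bsub>z_module\<^esub> \<gamma> z y"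
    "\<gamma> (c \<odot>\<^bsub>hat_osp\<^esub> x) z = c \<odot>\<^bsub>z_module\<^esub> \<gamma> x z" "\<gamma> z (c \<odot>\<^bsub>hat_osp\<^esub> x) = c \<odot>\<^bsub>z_module\<^esub> \<gamma> z x" "\<gamma> x z \<in> carrier z_module"
    if "is_beta \<gamma>" "x \<in> carrier hat_osp" "y \<in> carrier hat_osp" "z \<in> carrier hat_osp" for \<gamma> x y z c
    using that unfolding is_beta_def by blast+
  have vanish: "\<gamma> \<zero>\<^bsub>hat_osp\<^esub> z = \<zero>\<^bsub>z_module\<^esub>" "\<gamma> z \<zero>\<^bsub>hat_osp\<^esub> = \<zero>\<^bsub>z_module\<^esub>"
    if "is_beta \<gamma>" "z \<in> carrier hat_osp" for \<gamma> z
    using lin(3)[OF that(1) Hat.M.zero_closed Hat.M.zero_closed that(2), of 0]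
      lin(4)[OF that(1) Hat.M.zero_closed Hat.M.zero_closed that(2), of 0]
      lin(5)[OF that(1) Hat.M.zero_closed Hat.M.zero_closed that(2)]
      lin(5)[OF that Hat.M.zero_closed Hat.M.zero_closed] by simp_all
  have sp: "\<gamma> x y = (if (i, j) = (KV, KG) \<or> (i, j) = (KG, KV) \<or> (i, j) = (KF, KW) \<or> (i, j) = (KW, KF) then \<gamma> x y else \<zero>\<^bsub>z_module\<^esub>)"
    if "is_beta \<gamma>" "x \<in> spanning i" "y \<in> spanning j" for \<gamma> i j x y
    using that unfolding is_beta_def by auto
  have val: "\<gamma> (hat_v a) (hat_g b) = pi1 (tr a * b)"
       "\<gamma> (hat_g b) (hat_v a) = \<ominus>\<^bsub>z_module\<^esub> msg z_module (p * (1 + q)) (pi1 (tr a * b))"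
       "\<gamma> (hat_f a) (hat_w b) = pi2 (a * tr b)"
       "\<gamma> (hat_w b) (hat_f a) = \<ominus>\<^bsub>z_module\<^esub> msg z_module ((1 + p) * q) (pi2 (a * tr b))"
    if "is_beta \<gamma>" "a \<in> H p" "b \<in> H q" for \<gamma> a b p q
    using that unfolding is_beta_def by blast+
  have base: "\<beta> x y = \<beta>' x y" if s: "x \<in> spanning i" "y \<in> spanning j" for x y i j
  proof (cases "(i, j) = (KV, KG) \<or> (i, j) = (KG, KV) \<or> (i, j) = (KF, KW) \<or> (i, j) = (KW, KF)")
    case False
    then show ?thesis using sp[OF assms(1) s] sp[OF assms(2) s] by (simp only: if_False)
  next
    case True
    then consider "i = KV" "j = KG" | "i = KG" "j = KV" | "i = KF" "j = KW" | "i = KW" "j = KF" by blast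
    then show ?thesis
    proof cases
      case 1
      then obtain a b p q where "x = hat_v a" "y = hat_g b" "a \<in> H p" "b \<in> H q" using s by auto
      then show ?thesis using val(1)[OF assms(1)] val(1)[OF assms(2)] by simp
    next
      case 2
      then obtain a b p q where "x = hat_g b" "y = hat_v a" "a \<in> H p" "b \<in> H q" using s by auto
      then show ?thesis using val(2)[OF assms(1)] val(2)[OF assms(2)] by simp
    next
      case 3
      then obtain a b p q where "x = hat_f a" "y = hat_w b" "a \<in> H p" "b \<in> H q" using s by auto
      then show ?thesis using val(3)[OF assms(1)] val(3)[OF assms(2)] by simp
    next
      case 4
      then obtain a b p q where "x = hat_w b" "y = hat_f a" "a \<in> H p" "b \<in> H q" using s by auto
      then show ?thesis using val(4)[OF assms(1)] val(4)[OF assms(2)] by simp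
    qed
  qed
  have left: "\<beta> x y = \<beta>' x y" if s: "x \<in> spanning i" for x i
    using y
  proof (induction rule: hat_induct)
    case (spanning y k)
    then show ?case using base s by blast
  next
    case zero
    show ?case using vanish(2)[OF assms(1) spanning_carrier[OF s]] vanish(2)[OF assms(2) spanning_carrier[OF s]] by simp
  next
    case (add y z)
    then show ?case using lin(2)[OF assms(1)] lin(2)[OF assms(2)] spanning_carrier[OF s] by simp
  next
    case (smult c y)
    then show ?case using lin(4)[OF assms(1) smult(1) smult(1)] lin(4)[OF assms(2) smult(1) smult(1)] spanning_carrier[OF s] by simp
  qed
  from x show ?thesis
  proof (induction rule: hat_induct)
    case (spanning x k)
    then show ?case using left by blast
  next
    case zero
    show ?case using vanish(1)[OF assms(1) y] vanish(1)[OF assms(2) y] by simp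
  next
    case (add x z)
    then show ?case using lin(1)[OF assms(1)] lin(1)[OF assms(2)] y by simp
  next
    case (smult c x)
    then show ?case using lin(3)[OF assms(1) smult(1) smult(1)] lin(3)[OF assms(2) smult(1) smult(1)] y by simp
  qed
qed

lemma beta_eq: "\<lbrakk>x \<in> carrier hat_osp; y \<in> carrier hat_osp\<rbrakk> \<Longrightarrow> beta x y = beta_mat x y"
  by (rule is_beta_unique[OF _ is_beta_beta_mat]) (auto simp: beta_def intro: someI[of is_beta, OF is_beta_beta_mat])

lemma beta_mat_cocycle:
  assumes "x \<in> part hat_osp p" "y \<in> part hat_osp q" "z \<in> part hat_osp r"
  shows "msg z_module (p * r) (beta_mat (bracket hat_osp x y) z) \<oplus>\<^bsub>z_module\<^esub>
    msg z_module (q * p) (beta_mat (bracket hat_osp y z) x) \<oplus>\<^bsub>z_module\<^esub>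
    msg z_module (r * q) (beta_mat (bracket hat_osp z x) y) = \<zero>\<^bsub>z_module\<^esub>"
proof -
  note c = assms[THEN Hat.part_carrier]
  note h = psi_part(1)[OF assms(1)] psi_part(2)[OF c(1)] psi_part(1)[OF assms(2)] psi_part(2)[OF c(2)]
    psi_part(1)[OF assms(3)] psi_part(2)[OF c(3)]
  show ?thesis
    using raw1_cocycle[OF h] raw2_cocycle[OF h]
    by (simp add: beta_mat_def psi.hom_bracket c z_msg z_add z_zero zc_eq_iff)
qed

subsection \<open>The Lie superalgebra \<open>uosp\<close>\<close>

lemma uosp_simps [simp]:
  "carrier uosp = carrier hat_osp \<times> carrier z_module" "\<zero>\<^bsub>uosp\<^esub> = (\<zero>\<^bsub>hat_osp\<^esub>, \<zero>\<^bsub>z_module\<^esub>)"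
  "(x, c) \<oplus>\<^bsub>uosp\<^esub> (y, d) = (x \<oplus>\<^bsub>hat_osp\<^esub> y, c \<oplus>\<^bsub>z_module\<^esub> d)"
  "k \<odot>\<^bsub>uosp\<^esub> (x, c) = (k \<odot>\<^bsub>hat_osp\<^esub> x, k \<odot>\<^bsub>z_module\<^esub> c)"
  "\<lbrakk>x \<in> carrier hat_osp; y \<in> carrier hat_osp\<rbrakk> \<Longrightarrow> bracket uosp (x, c) (y, d) = (bracket hat_osp x y, beta_mat x y)"
  "part uosp p = part hat_osp p \<times> z_part p"
  by (simp_all add: uosp_def beta_eq)

lemma uosp_module: "Module.module type_ring uosp"
  by (rule kmoduleI) (auto simp: Hat.M.a_ac Z.M.a_ac Hat.smult_mult Z.smult_mult Hat.smult_add_l Z.smult_add_l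
      Hat.smult_add_r Z.smult_add_r Hat.smult_minus1 Z.smult_minus1 Hat.M.r_neg Z.M.r_neg)

sublocale U: kmodule uosp
  using uosp_module by (simp add: kmodule_def)

lemma uosp_neg: "\<lbrakk>x \<in> carrier hat_osp; c \<in> carrier z_module\<rbrakk> \<Longrightarrow> \<ominus>\<^bsub>uosp\<^esub> (x, c) = (\<ominus>\<^bsub>hat_osp\<^esub> x, \<ominus>\<^bsub>z_module\<^esub> c)"
  using U.smult_minus1[of "(x, c)"] by (simp add: Hat.smult_minus1 Z.smult_minus1)

lemma uosp_msg: "\<lbrakk>x \<in> carrier hat_osp; c \<in> carrier z_module\<rbrakk> \<Longrightarrow> msg uosp p (x, c) = (msg hat_osp p x, msg z_module p c)"
  by (simp add: msg_def uosp_neg)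

lemma uosp_graded: "z2_graded uosp (part uosp)"
proof (rule U.z2_gradedI)
  show "submodule (part uosp p) type_ring uosp" for p
    using Z.submodule_zero[OF Z.graded_submodule[OF z_graded, of p]] Z.submoduleE[OF Z.graded_submodule[OF z_graded, of p]]
    by (intro U.submoduleI') (auto simp: Hat.part_zero Hat.part_add Hat.part_smult Hat.part_carrier)
next
  fix x assume "x \<in> carrier uosp"
  then obtain y c where x: "x = (y, c)" "y \<in> carrier hat_osp" "c \<in> carrier z_module" by auto
  obtain y0 y1 where y: "y0 \<in> part hat_osp 0" "y1 \<in> part hat_osp 1" "y = y0 \<oplus>\<^bsub>hat_osp\<^esub> y1" using Hat.part_sum[OF x(2)] .
  obtain c0 c1 where c: "c0 \<in> z_part 0" "c1 \<in> z_part 1" "c = c0 \<oplus>\<^bsub>z_module\<^esub> c1" using Z.graded_sum[OF z_graded x(3)] .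
  show "\<exists>x0\<in>part uosp 0. \<exists>x1\<in>part uosp 1. x = x0 \<oplus>\<^bsub>uosp\<^esub> x1"
    by (intro bexI[of _ "(y0, c0)"] bexI[of _ "(y1, c1)"]) (use x y c in auto)
next
  fix x assume x: "x \<in> part uosp 0" "x \<in> part uosp 1"
  then show "x = \<zero>\<^bsub>uosp\<^esub>" using Hat.part_inter Z.graded_inter[OF z_graded] by auto
qed

lemma uosp_lie_superalgebra: "lie_superalgebra uosp"
proof (intro lie_superalgebra.intro lie_superalgebra_axioms.intro uosp_module uosp_graded)
  have bc: "beta_mat x y \<in> carrier z_module" for x y by (simp add: beta_mat_def)
  note hc = Hat.bracket_closed
  fix x y z p q r assume "x \<in> part uosp p" "y \<in> part uosp q" "z \<in> part uosp r"
  then obtain a b c a' b' c' where e: "x = (a, a')" "y = (b, b')" "z = (c, c')"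
    and h: "a \<in> part hat_osp p" "b \<in> part hat_osp q" "c \<in> part hat_osp r" by auto
  note car = h[THEN Hat.part_carrier]
  show "msg uosp (p * r) (bracket uosp (bracket uosp x y) z) \<oplus>\<^bsub>uosp\<^esub>
      msg uosp (q * p) (bracket uosp (bracket uosp y z) x) \<oplus>\<^bsub>uosp\<^esub>
      msg uosp (r * q) (bracket uosp (bracket uosp z x) y) = \<zero>\<^bsub>uosp\<^esub>"
    using Hat.super_jacobi[OF h] beta_mat_cocycle[OF h]
    by (simp add: e car hc bc uosp_msg)
next
  have bc: "beta_mat x y \<in> carrier z_module" for x y by (simp add: beta_mat_def)
  fix x y p q assume "x \<in> part uosp p" "y \<in> part uosp q"
  then obtain a b a' b' where e: "x = (a, a')" "y = (b, b')"
    and h: "a \<in> part hat_osp p" "b \<in> part hat_osp q" by auto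
  note car = h[THEN Hat.part_carrier] and m = psi_part(1)[OF h(1)] psi_part(1)[OF h(2)]
  have "beta_mat a b \<in> z_part (p + q)"
    unfolding beta_mat_def z_part_eq using raw1_deg[OF m] raw2_deg[OF m] by blast
  then show "bracket uosp x y \<in> part uosp (p + q)"
    using Hat.bracket_even[OF h] by (simp add: e car)
  show "bracket uosp x y = \<ominus>\<^bsub>uosp\<^esub> msg uosp (p * q) (bracket uosp y x)"
    using Hat.super_skew[OF h] raw1_skew[OF m] raw2_skew[OF m]
    by (simp add: e car Hat.bracket_closed bc uosp_msg uosp_neg) (simp add: beta_mat_def z_msg z_neg)
next
  have bc: "beta_mat x y \<in> carrier z_module" for x y by (simp add: beta_mat_def)
  fix x y z c assume "x \<in> carrier uosp" "y \<in> carrier uosp" "z \<in> carrier uosp"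
  then show "bracket uosp (x \<oplus>\<^bsub>uosp\<^esub> y) z = bracket uosp x z \<oplus>\<^bsub>uosp\<^esub> bracket uosp y z"
    "bracket uosp x (y \<oplus>\<^bsub>uosp\<^esub> z) = bracket uosp x y \<oplus>\<^bsub>uosp\<^esub> bracket uosp x z"
    by (auto simp: Hat.bracket_add_left Hat.bracket_add_right beta_mat_bilinear)
next
  have bc: "beta_mat x y \<in> carrier z_module" for x y by (simp add: beta_mat_def)
  fix x y c assume "x \<in> carrier uosp" "y \<in> carrier uosp"
  then show "bracket uosp x y \<in> carrier uosp" "bracket uosp (c \<odot>\<^bsub>uosp\<^esub> x) y = c \<odot>\<^bsub>uosp\<^esub> bracket uosp x y"
    "bracket uosp x (c \<odot>\<^bsub>uosp\<^esub> y) = c \<odot>\<^bsub>uosp\<^esub> bracket uosp x y"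
    by (auto simp: Hat.bracket_smult_left Hat.bracket_smult_right Hat.bracket_closed bc beta_mat_bilinear[where y = x for x])
qed

sublocale U: lie_superalgebra uosp
  by (rule uosp_lie_superalgebra)

text \<open>
  Modulo its diagonal part an element of \<open>hat_osp\<close> is determined by its matrix, and the action of
  the diagonal part on the generators \<open>f\<close>, \<open>g\<close> only depends on the matrix.
\<close>

definition diag_act :: "('k, 'r osp_gen) lie_term set \<Rightarrow> bool"
  where "diag_act h \<longleftrightarrow> h \<in> carrier hat_osp \<and> (\<exists>u w. psi h = dg u w) \<and>
    (\<forall>e r. e \<in> H r \<longrightarrow>
      bracket hat_osp h (hat_f e) = hat_f (mat_bracket (psi h) (osp_f e) $ 1 $ 2) \<and>
      bracket hat_osp h (hat_g e) = hat_g (mat_bracket (psi h) (osp_g e) $ 2 $ 1))"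

lemma mat_bracket_zero [simp]: "mat_bracket 0 X = 0" "mat_bracket X 0 = 0"
  by (simp_all add: mat_bracket_expand mat_mult_simps)

lemma diag_act_zero: "diag_act \<zero>\<^bsub>hat_osp\<^esub>"
proof -
  have "0 = dg 0 0" by (simp add: mat_eq_iff)
  then have "\<exists>u w. 0 = dg u w" by blast
  then show ?thesis by (simp add: diag_act_def)
qed

lemma diag_actD:
  assumes "diag_act h"
  shows "h \<in> carrier hat_osp" "\<exists>u w. psi h = dg u w"
    "e \<in> H r \<Longrightarrow> bracket hat_osp h (hat_f e) = hat_f (mat_bracket (psi h) (osp_f e) $ 1 $ 2)"
    "e \<in> H r \<Longrightarrow> bracket hat_osp h (hat_g e) = hat_g (mat_bracket (psi h) (osp_g e) $ 2 $ 1)"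
  using assms unfolding diag_act_def by blast+

lemma diag_act_add:
  assumes "diag_act h" "diag_act k"
  shows "diag_act (h \<oplus>\<^bsub>hat_osp\<^esub> k)"
proof -
  note h = diag_actD[OF assms(1)] and k = diag_actD[OF assms(2)]
  obtain u w u' w' where "psi h = dg u w" "psi k = dg u' w'" using h(2) k(2) by blast
  then have "psi (h \<oplus>\<^bsub>hat_osp\<^esub> k) = dg (u + u') (w + w')"
    using h(1) k(1) by (simp add: psi.hom_add dg_linear)
  then have "\<exists>u w. psi (h \<oplus>\<^bsub>hat_osp\<^esub> k) = dg u w" by blast
  moreover have "bracket hat_osp (h \<oplus>\<^bsub>hat_osp\<^esub> k) (hat_f e) = hat_f (mat_bracket (psi (h \<oplus>\<^bsub>hat_osp\<^esub> k)) (osp_f e) $ 1 $ 2)"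
    "bracket hat_osp (h \<oplus>\<^bsub>hat_osp\<^esub> k) (hat_g e) = hat_g (mat_bracket (psi (h \<oplus>\<^bsub>hat_osp\<^esub> k)) (osp_g e) $ 2 $ 1)"
    if "e \<in> H r" for e r
    using h(1) k(1) h(3,4)[OF that] k(3,4)[OF that]
    by (simp_all add: psi.hom_add Hat.bracket_add_left mat_bracket_add hat_add)
  ultimately show ?thesis using h(1) k(1) unfolding diag_act_def by blast
qed

lemma diag_act_smult:
  assumes "diag_act h"
  shows "diag_act (c \<odot>\<^bsub>hat_osp\<^esub> h)"
proof -
  note h = diag_actD[OF assms]
  obtain u w where "psi h = dg u w" using h(2) by blast
  then have "psi (c \<odot>\<^bsub>hat_osp\<^esub> h) = dg (scl c u) (scl c w)"
    using h(1) by (simp add: psi.hom_smult dg_linear)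
  then have "\<exists>u w. psi (c \<odot>\<^bsub>hat_osp\<^esub> h) = dg u w" by blast
  moreover have "bracket hat_osp (c \<odot>\<^bsub>hat_osp\<^esub> h) (hat_f e) = hat_f (mat_bracket (psi (c \<odot>\<^bsub>hat_osp\<^esub> h)) (osp_f e) $ 1 $ 2)"
    "bracket hat_osp (c \<odot>\<^bsub>hat_osp\<^esub> h) (hat_g e) = hat_g (mat_bracket (psi (c \<odot>\<^bsub>hat_osp\<^esub> h)) (osp_g e) $ 2 $ 1)"
    if "e \<in> H r" for e r
    using h(1) h(3,4)[OF that]
    by (simp_all add: psi.hom_smult Hat.bracket_smult_left mat_bracket_smult hat_scl)
  ultimately show ?thesis using h(1) unfolding diag_act_def by blast
qed

lemma hat_g_sg: "hat_g (sg p a) = msg hat_osp p (hat_g a)"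
  by (cases p) (simp_all add: msg_def hat_neg)

lemma diag_act_h:
  assumes ab: "a \<in> H p" "b \<in> H q"
  shows "diag_act (hat_h a b)"
proof -
  have "bracket hat_osp (hat_h a b) (hat_f e) = hat_f (mat_bracket (psi (hat_h a b)) (osp_f e) $ 1 $ 2)"
    "bracket hat_osp (hat_h a b) (hat_g e) = hat_g (mat_bracket (psi (hat_h a b)) (osp_g e) $ 2 $ 1)"
    if e: "e \<in> H r" for e r
  proof -
    show "bracket hat_osp (hat_h a b) (hat_f e) = hat_f (mat_bracket (psi (hat_h a b)) (osp_f e) $ 1 $ 2)"
      unfolding psi_h osp_rel_triple(1)[OF ab e] hat_relations(7)[OF ab e] by simp
    have "bracket hat_osp (hat_h a b) (hat_g e) =
        \<ominus>\<^bsub>hat_osp\<^esub> msg hat_osp ((p + q) * (1 + r)) (bracket hat_osp (hat_g e) (hat_h a b))"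
      by (rule Hat.super_skew[OF hat_h_part[OF ab] hat_gen_part(4)[OF e]])
    also have "\<dots> = hat_g (- sg ((p + q) * (1 + r)) (e * a * b - e * bar (a * b) - sg (r * p + p * q + q * r) (b * a * e)))"
      unfolding hat_relations(8)[OF e ab] hat_neg(4) hat_g_sg ..
    also have "- sg ((p + q) * (1 + r)) (e * a * b - e * bar (a * b) - sg (r * p + p * q + q * r) (b * a * e)) =
       mat_bracket (psi (hat_h a b)) (osp_g e) $ 2 $ 1"
      unfolding psi_h osp_rel_triple(2)[OF ab e]
      by (cases p; cases q; cases r) (simp_all add: algebra_simps)
    finally show "bracket hat_osp (hat_h a b) (hat_g e) = hat_g (mat_bracket (psi (hat_h a b)) (osp_g e) $ 2 $ 1)" .
  qed
  moreover have "\<exists>u w. psi (hat_h a b) = dg u w" unfolding psi_h osp_fg[OF ab] by blast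
  moreover have "hat_h a b \<in> carrier hat_osp" by simp
  ultimately show ?thesis unfolding diag_act_def by blast
qed

text \<open>Terms of the kinds \<open>KV\<close>, \<open>KW\<close>, \<open>KF\<close>,
  \<open>KG\<close> are merged by linearity in their parameter. Sums of elements
  \<open>hat_h\<close> have no such single parameter and are remembered only through
  \<open>diag_act\<close>.\<close>

lemma hat_diagonal:
  assumes "x \<in> carrier hat_osp"
  shows "\<exists>h a b c d. diag_act h \<and>
    x = h \<oplus>\<^bsub>hat_osp\<^esub> (hat_v a \<oplus>\<^bsub>hat_osp\<^esub> (hat_w b \<oplus>\<^bsub>hat_osp\<^esub> (hat_f c \<oplus>\<^bsub>hat_osp\<^esub> hat_g d)))"
    (is "\<exists>h a b c d. diag_act h \<and> x = ?s h a b c d")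
  using assms
proof (induction rule: hat_induct)
  case zero
  have "\<zero>\<^bsub>hat_osp\<^esub> = ?s \<zero>\<^bsub>hat_osp\<^esub> 0 0 0 0" by simp
  then show ?case using diag_act_zero by blast
next
  case (add x y)
  from add(3) obtain h a b c d where x: "diag_act h" "x = ?s h a b c d" by blast
  from add(4) obtain h' a' b' c' d' where y: "diag_act h'" "y = ?s h' a' b' c' d'" by blast
  have "h \<in> carrier hat_osp" "h' \<in> carrier hat_osp" using x(1) y(1) by (simp_all add: diag_act_def)
  then have "x \<oplus>\<^bsub>hat_osp\<^esub> y = ?s (h \<oplus>\<^bsub>hat_osp\<^esub> h') (a + a') (b + b') (c + c') (d + d')"
    unfolding x(2) y(2) by (simp add: hat_add Hat.M.a_ac)
  then show ?case using diag_act_add[OF x(1) y(1)] by blast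
next
  case (smult k x)
  from smult(2) obtain h a b c d where x: "diag_act h" "x = ?s h a b c d" by blast
  have "h \<in> carrier hat_osp" using x(1) by (simp add: diag_act_def)
  then have "k \<odot>\<^bsub>hat_osp\<^esub> x = ?s (k \<odot>\<^bsub>hat_osp\<^esub> h) (scl k a) (scl k b) (scl k c) (scl k d)"
    unfolding x(2) by (simp add: hat_scl Hat.smult_add_r)
  then show ?case using diag_act_smult[OF x(1)] by blast
next
  case (spanning x k)
  have *: ?case if "diag_act h" "x = ?s h a b c d" for h a b c d
    using that by blast
  show ?case
  proof (cases k)
    case KV
    then obtain a where "x = hat_v a" using spanning by auto
    then show ?thesis using *[OF diag_act_zero, of a 0 0 0] by simp
  next
    case KW
    then obtain a where "x = hat_w a" using spanning by auto
    then show ?thesis using *[OF diag_act_zero, of 0 a 0 0] by simp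
  next
    case KF
    then obtain a where "x = hat_f a" using spanning by auto
    then show ?thesis using *[OF diag_act_zero, of 0 0 a 0] by simp
  next
    case KG
    then obtain a where "x = hat_g a" using spanning by auto
    then show ?thesis using *[OF diag_act_zero, of 0 0 0 a] by simp
  next
    case KH
    then obtain a b p q where x: "x = hat_h a b" and ab: "a \<in> H p" "b \<in> H q" using spanning by auto
    then show ?thesis using *[OF diag_act_h[OF ab], of 0 0 0 0] by simp
  qed
qed

text \<open>The matrix determines \<open>c\<close>, \<open>d\<close>, \<open>tr a\<close> and
  \<open>tr b\<close>. If \<open>tr a = 0\<close>, then
  \<open>hat_v a = hat_v (bar a) = - hat_v a\<close>, so it vanishes, and likewise for
  \<open>hat_w b\<close>. There remains \<open>h\<close>, which acts on the generators through its
  matrix, here 0.\<close>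

lemma psi_kernel_gen:
  assumes x: "x \<in> carrier hat_osp" "psi x = 0" and e: "e \<in> H r"
  shows "bracket hat_osp x (hat_f e) = \<zero>\<^bsub>hat_osp\<^esub>" "bracket hat_osp x (hat_g e) = \<zero>\<^bsub>hat_osp\<^esub>"
proof -
  obtain h a b c d where D: "diag_act h"
    and xe: "x = h \<oplus>\<^bsub>hat_osp\<^esub> (hat_v a \<oplus>\<^bsub>hat_osp\<^esub> (hat_w b \<oplus>\<^bsub>hat_osp\<^esub> (hat_f c \<oplus>\<^bsub>hat_osp\<^esub> hat_g d)))"
    using hat_diagonal[OF x(1)] by blast
  then obtain u w where h: "h \<in> carrier hat_osp" "psi h = dg u w" unfolding diag_act_def by blast
  have px: "dg u w + (osp_v a + (osp_w b + (osp_f c + osp_g d))) = 0"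
    using x(2) h unfolding xe by (simp add: psi.hom_add)
  have t: "tr a = 0" "tr b = 0" "c = 0" "d = 0" "u = 0" "w = 0"
    using arg_cong[OF px, of "\<lambda>X. X $ 2 $ 3"] arg_cong[OF px, of "\<lambda>X. X $ 3 $ 2"] arg_cong[OF px, of "\<lambda>X. X $ 1 $ 2"]
      arg_cong[OF px, of "\<lambda>X. X $ 2 $ 1"] arg_cong[OF px, of "\<lambda>X. X $ 1 $ 1"] arg_cong[OF px, of "\<lambda>X. X $ 2 $ 2"] by simp_all
  have ba: "bar a = - a" "bar b = - b" using t by (simp_all add: tr_def add_eq_0_iff)
  have half: "hf \<odot>\<^bsub>hat_osp\<^esub> (y \<oplus>\<^bsub>hat_osp\<^esub> y) = y" if "y \<in> carrier hat_osp" for y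
    using that by (simp add: Hat.smult_add_r hf flip: Hat.smult_add_l)
  have "hat_v a \<oplus>\<^bsub>hat_osp\<^esub> hat_v a = hat_v (a + bar a)" "hat_w b \<oplus>\<^bsub>hat_osp\<^esub> hat_w b = hat_w (b + bar b)"
    by (simp_all add: hat_add hat_relations(9,10))
  then have vw: "hat_v a \<oplus>\<^bsub>hat_osp\<^esub> hat_v a = \<zero>\<^bsub>hat_osp\<^esub>" "hat_w b \<oplus>\<^bsub>hat_osp\<^esub> hat_w b = \<zero>\<^bsub>hat_osp\<^esub>"
    unfolding ba by simp_all
  have "hat_v a = \<zero>\<^bsub>hat_osp\<^esub>" "hat_w b = \<zero>\<^bsub>hat_osp\<^esub>"
    by (rule HOL.trans[OF half[OF hat_gen_carrier(1), of a, unfolded vw, symmetric] Hat.smult_zero],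
      rule HOL.trans[OF half[OF hat_gen_carrier(2), of b, unfolded vw, symmetric] Hat.smult_zero])
  then have "x = h" using h(1) t by (simp add: xe)
  then have "psi h = 0" using x(2) by simp
  then show "bracket hat_osp x (hat_f e) = \<zero>\<^bsub>hat_osp\<^esub>" "bracket hat_osp x (hat_g e) = \<zero>\<^bsub>hat_osp\<^esub>"
    using D e unfolding \<open>x = h\<close> diag_act_def by auto
qed

text \<open>The Leibniz rule makes the centralizer of a homogeneous element stable under homogeneous
  brackets, and \<open>hat_f\<close>, \<open>hat_g\<close> generate.\<close>

lemma centralizer_deg:
  assumes x: "x \<in> part hat_osp p" "psi x = 0"
  shows "lie_deg gen_part q t \<Longrightarrow> bracket hat_osp x (cl t) = \<zero>\<^bsub>hat_osp\<^esub>"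
proof (induction rule: lie_deg.induct)
  note xc = Hat.part_carrier[OF x(1)]
  have br: "bracket hat_osp x (bracket hat_osp y z) = \<zero>\<^bsub>hat_osp\<^esub>"
    if "y \<in> part hat_osp q" "z \<in> part hat_osp r" "bracket hat_osp x y = \<zero>\<^bsub>hat_osp\<^esub>" "bracket hat_osp x z = \<zero>\<^bsub>hat_osp\<^esub>" for y z q r
    using Hat.leibniz[OF x(1) that(1,2)] that(3,4) that(1,2)[THEN Hat.part_carrier] by simp
  {
    case (1 g q)
    then show ?case
    proof (cases rule: gen_part_cases)
      case (V a)
      show ?thesis unfolding V(2) hat_v_eq[OF V(1)]
        by (rule br[OF hat_gen_part(4) hat_gen_part(4)]; (rule psi_kernel_gen[OF xc x(2)])?) (use V in auto)
    next
      case (W a)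
      show ?thesis unfolding W(2) hat_w_eq[OF W(1)]
        by (rule br[OF hat_gen_part(3) hat_gen_part(3)]; (rule psi_kernel_gen[OF xc x(2)])?) (use W in auto)
    qed (simp_all add: psi_kernel_gen[OF xc x(2)])
  next
    case (2 p)
    then show ?case using xc by (simp flip: hat_ops(2))
  next
    case (3 p s t)
    then show ?case using xc by (simp add: Hat.bracket_add_right flip: hat_ops(4))
  next
    case (4 p t c)
    then show ?case using xc by (simp add: Hat.bracket_smult_right flip: hat_ops(6))
  next
    case (5 q s r t)
    have "cl s \<in> part hat_osp q" "cl t \<in> part hat_osp r" using 5(1,2) by (auto simp: hat_ops(3))
    then show ?case using 5(3,4) br[of "cl s" q "cl t" r] by (simp flip: hat_ops(5))
  }
qed

text \<open>As \<open>psi\<close> respects degrees, its kernel contains both components of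
  \<open>x\<close>, which reduces the claim to homogeneous elements.\<close>

lemma psi_kernel_central:
  assumes x: "x \<in> carrier hat_osp" "psi x = 0" and y: "y \<in> carrier hat_osp"
  shows "bracket hat_osp x y = \<zero>\<^bsub>hat_osp\<^esub>"
proof -
  obtain x0 x1 where x01: "x0 \<in> part hat_osp 0" "x1 \<in> part hat_osp 1" "x = x0 \<oplus>\<^bsub>hat_osp\<^esub> x1" using Hat.part_sum[OF x(1)] .
  note c = x01(1,2)[THEN Hat.part_carrier]
  have "psi x0 + psi x1 = 0" using x(2) c by (simp add: x01(3) psi.hom_add)
  then have "mat_hcomp 0 (psi x0 + psi x1) = 0" "mat_hcomp 1 (psi x0 + psi x1) = 0" by simp_all
  then have z: "psi x0 = 0" "psi x1 = 0"
    using psi_part(1)[OF x01(1)] psi_part(1)[OF x01(2)] mat_hcomp_other[of "psi x1" 0] mat_hcomp_other[of "psi x0" 1]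
    by (simp_all add: mat_hcomp_simps mat_hcomp_id)
  from y show ?thesis
  proof (induction rule: Hat.homogeneous_induct)
    case (homogeneous y p)
    then obtain t where t: "y = cl t" "lie_deg gen_part p t" by (auto simp: hat_ops(3))
    have "bracket hat_osp x0 y = \<zero>\<^bsub>hat_osp\<^esub>" "bracket hat_osp x1 y = \<zero>\<^bsub>hat_osp\<^esub>"
      unfolding t(1) using centralizer_deg[OF x01(1) z(1) t(2)] centralizer_deg[OF x01(2) z(2) t(2)] by blast+
    then show ?case using c Hat.part_carrier[OF homogeneous] by (simp add: x01(3) Hat.bracket_add_left)
  qed (use x(1) in \<open>simp add: Hat.bracket_add_right\<close>)
qed

text \<open>A composite of central extensions need not be central. Here the kernel consists of the
  pairs \<open>(x, c)\<close> with \<open>psi x = 0\<close>; besides the bracket of \<open>x\<close>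
  in \<open>hat_osp\<close>, also the value of \<open>beta\<close> vanishes, because it depends on
  \<open>x\<close> only through \<open>psi x\<close>.\<close>

lemma uosp_central_extension: "central_extension uosp osp (psi \<circ> psi')"
  unfolding central_extension_def
proof (intro conjI uosp_lie_superalgebra osp_lie_superalgebra)
  show "psi \<circ> psi' \<in> lie_hom uosp osp"
    by (rule lie_homI) (auto simp: psi'_def psi.hom_add psi.hom_smult psi.hom_bracket psi_part simp del: osp_simps,
      auto simp: psi_part Hat.part_carrier)
  show "(psi \<circ> psi') ` carrier uosp = carrier osp"
  proof -
    have "psi' ` carrier uosp = carrier hat_osp"
      using Z.M.zero_closed by (force simp: psi'_def)
    then show ?thesis using psi_surj unfolding image_comp[symmetric] by simp
  qed
  show "{x \<in> carrier uosp. (psi \<circ> psi') x = \<zero>\<^bsub>osp\<^esub>} \<subseteq> lie_center uosp"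
  proof
    fix z assume "z \<in> {x \<in> carrier uosp. (psi \<circ> psi') x = \<zero>\<^bsub>osp\<^esub>}"
    then obtain x c where x: "z = (x, c)" "x \<in> carrier hat_osp" "c \<in> carrier z_module" "psi x = 0"
      by (auto simp: psi'_def)
    have "beta_mat x y = \<zero>\<^bsub>z_module\<^esub>" for y
      using raw1_smult(1)[of 0 0 "psi y"] raw2_smult(1)[of 0 0 "psi y"] M.smult_0[of 0]
      by (simp add: beta_mat_def x(4) z_zero)
    then show "z \<in> lie_center uosp" using x psi_kernel_central[OF x(2,4)] by (auto simp: lie_center_def)
  qed
qed

end

section \<open>Eigenspaces in a central extension of \<open>osp\<close>\<close>

lemma (in superinvolution_half) extension_lift_part:
  assumes ext: "central_extension E osp \<phi>" and X: "X \<in> osp_set" "X \<in> mat_part p"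
  shows "\<exists>x\<in>part E p. \<phi> x = X"
proof -
  interpret phi: lie_homomorphism E osp \<phi>
    using ext by (simp add: lie_homomorphism_def lie_homomorphism_axioms_def central_extension_def)
  have "X \<in> \<phi> ` carrier E" using ext X(1) unfolding central_extension_def by simp
  then obtain x where x: "x \<in> carrier E" "\<phi> x = X" by blast
  obtain x0 x1 where s: "x0 \<in> part E 0" "x1 \<in> part E 1" "x = x0 \<oplus>\<^bsub>E\<^esub> x1" using phi.L.part_sum[OF x(1)] .
  then have X': "X = \<phi> x0 + \<phi> x1"
    using x phi.hom_add[OF phi.L.part_carrier[OF s(1)] phi.L.part_carrier[OF s(2)]] by simp
  have h: "\<phi> x0 \<in> mat_part 0" "\<phi> x1 \<in> mat_part 1" using phi.hom_part[OF s(1)] phi.hom_part[OF s(2)] by simp_all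
  have "mat_hcomp 0 X = \<phi> x0" "mat_hcomp 1 X = \<phi> x1"
    unfolding X' using h mat_hcomp_other[of "\<phi> x1" 0] mat_hcomp_other[of "\<phi> x0" 1]
    by (simp_all add: mat_hcomp_simps mat_hcomp_id)
  then have "mat_hcomp p X = \<phi> (if p = 0 then x0 else x1)" by (cases p) simp_all
  moreover have "(if p = 0 then x0 else x1) \<in> part E p" using s by (cases p) simp_all
  ultimately show ?thesis using mat_hcomp_id[OF X(2)] by metis
qed

text \<open>The lift \<open>hh\<close> is a parameter rather than a fixed choice, so that the locale
  can be instantiated once more with \<open>tau\<close> after \<phi> and the negative of
  \<open>hh\<close>.\<close>

locale osp_extension = superinvolution_half scl H bar + E: lie_superalgebra E
  for scl :: "'k::{comm_ring,monoid_mult} \<Rightarrow> 'r::{ring,monoid_mult} \<Rightarrow> 'r" and H bar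
    and E :: "('k, 'e) lie_salg" +
  fixes \<phi> :: "'e \<Rightarrow> 'r^3^3" and hh :: 'e
  assumes ext: "central_extension E osp \<phi>"
    and hh: "hh \<in> part E 0" "\<phi> hh = h0"
begin

sublocale phi: lie_homomorphism E osp \<phi>
  using ext by unfold_locales (simp add: central_extension_def)

lemma phi_simps:
  "\<lbrakk>x \<in> carrier E; y \<in> carrier E\<rbrakk> \<Longrightarrow> \<phi> (x \<oplus>\<^bsub>E\<^esub> y) = \<phi> x + \<phi> y"
  "x \<in> carrier E \<Longrightarrow> \<phi> (c \<odot>\<^bsub>E\<^esub> x) = c \<odot>\<^bsub>mat_lie\<^esub> \<phi> x"
  "\<lbrakk>x \<in> carrier E; y \<in> carrier E\<rbrakk> \<Longrightarrow> \<phi> (bracket E x y) = mat_bracket (\<phi> x) (\<phi> y)"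
  "\<phi> \<zero>\<^bsub>E\<^esub> = 0" "x \<in> carrier E \<Longrightarrow> \<phi> x \<in> osp_set" "x \<in> part E p \<Longrightarrow> \<phi> x \<in> mat_part p"
  "x \<in> carrier E \<Longrightarrow> \<phi> (\<ominus>\<^bsub>E\<^esub> x) = - \<phi> x"
  using phi.hom_closed[of x] by (simp_all add: phi.hom_add phi.hom_smult phi.hom_bracket phi.hom_zero[simplified] phi.hom_neg)
    (use phi.hom_part in fastforce)

lemma hh_carrier [simp]: "hh \<in> carrier E"
  using hh(1) by (rule E.part_carrier)

lemma ker_central: "\<lbrakk>x \<in> carrier E; \<phi> x = 0\<rbrakk> \<Longrightarrow> x \<in> lie_center E"
  using ext unfolding central_extension_def by auto

lemma ker_diff:
  assumes "x \<in> carrier E" "y \<in> carrier E" "\<phi> x = \<phi> y"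
  obtains z where "z \<in> lie_center E" "z \<in> carrier E" "x = y \<oplus>\<^bsub>E\<^esub> z"
proof
  let ?z = "\<ominus>\<^bsub>E\<^esub> y \<oplus>\<^bsub>E\<^esub> x"
  show "?z \<in> lie_center E" by (rule ker_central) (use assms in \<open>simp_all add: phi_simps\<close>)
  show "x = y \<oplus>\<^bsub>E\<^esub> ?z" using assms by (simp add: E.M.r_neg2)
qed (use assms in simp)

lemma lift_carrier:
  assumes "X \<in> osp_set"
  shows "\<exists>x\<in>carrier E. \<phi> x = X"
proof -
  have "X \<in> \<phi> ` carrier E" using ext assms unfolding central_extension_def by simp
  then show ?thesis by blast
qed

lemma lift_part: "\<lbrakk>X \<in> osp_set; X \<in> mat_part p\<rbrakk> \<Longrightarrow> \<exists>x\<in>part E p. \<phi> x = X"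
  by (rule extension_lift_part[OF ext])

text \<open>Eigenspaces of \<open>ad hh\<close>: on those with invertible eigenvalue the extension is injective.\<close>

definition Wt :: "'k \<Rightarrow> 'e set"
  where "Wt k = {x \<in> carrier E. bracket E hh x = k \<odot>\<^bsub>E\<^esub> x}"

lemma Wt_carrier: "x \<in> Wt k \<Longrightarrow> x \<in> carrier E"
  by (simp add: Wt_def)

lemma Wt_add: "\<lbrakk>x \<in> Wt k; y \<in> Wt k\<rbrakk> \<Longrightarrow> x \<oplus>\<^bsub>E\<^esub> y \<in> Wt k"
  by (simp add: Wt_def E.bracket_add_right E.smult_add_r)

lemma Wt_smult: "x \<in> Wt k \<Longrightarrow> c \<odot>\<^bsub>E\<^esub> x \<in> Wt k"
  using E.smult_mult[of x c k] E.smult_mult[of x k c]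
  by (simp add: Wt_def E.bracket_smult_right mult.commute)

lemma Wt_neg: "x \<in> Wt k \<Longrightarrow> \<ominus>\<^bsub>E\<^esub> x \<in> Wt k"
  using Wt_smult[of x k "- 1"] by (simp add: E.smult_minus1 Wt_carrier)

lemma Wt_zero: "\<zero>\<^bsub>E\<^esub> \<in> Wt k"
  by (simp add: Wt_def)

lemma ad_hh_derivation:
  assumes "x \<in> carrier E" "y \<in> carrier E"
  shows "bracket E hh (bracket E x y) = bracket E (bracket E hh x) y \<oplus>\<^bsub>E\<^esub> bracket E x (bracket E hh y)"
  using assms
proof (induction x rule: E.homogeneous_induct)
  case (homogeneous x p)
  note x = homogeneous(1)
  from homogeneous(2) show ?case
  proof (induction y rule: E.homogeneous_induct)
    case (homogeneous y q)
    have "bracket E x (bracket E hh y) \<in> carrier E"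
      using x homogeneous by (simp add: E.bracket_closed E.part_carrier)
    then show ?case using E.leibniz[OF hh(1) x homogeneous] by (simp add: msg_def)
  qed (use x in \<open>simp add: E.bracket_add_right E.bracket_closed E.part_carrier E.M.a_ac\<close>)
qed (simp add: E.bracket_add_right E.bracket_add_left E.bracket_closed E.M.a_ac)

lemma Wt_bracket: "\<lbrakk>x \<in> Wt j; y \<in> Wt k; l = j + k\<rbrakk> \<Longrightarrow> bracket E x y \<in> Wt l"
  using ad_hh_derivation[of x y]
  by (simp add: Wt_def E.bracket_smult_left E.bracket_smult_right E.bracket_closed E.smult_add_l)

text \<open>The difference of \<open>x\<close> and \<open>y\<close> is central, hence annihilated by
  \<open>ad hh\<close>; on the other hand \<open>ad hh\<close> multiplies it by the unit
  \<open>k\<close>.\<close>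

lemma Wt_inj:
  assumes "u * k = 1" "x \<in> Wt k" "y \<in> Wt k" "\<phi> x = \<phi> y"
  shows "x = y"
proof -
  note c = assms(2,3)[THEN Wt_carrier]
  let ?z = "x \<oplus>\<^bsub>E\<^esub> \<ominus>\<^bsub>E\<^esub> y"
  have z: "?z \<in> Wt k" using assms(2,3) by (intro Wt_add Wt_neg)
  have "?z \<in> lie_center E" by (rule ker_central) (use c assms(4) in \<open>simp_all add: phi_simps\<close>)
  then have "k \<odot>\<^bsub>E\<^esub> ?z = \<zero>\<^bsub>E\<^esub>" using z E.center_right[of ?z hh] by (simp add: Wt_def)
  then have "?z = \<zero>\<^bsub>E\<^esub>" by (intro E.unit_smult_cancel[OF assms(1) Wt_carrier[OF z]])
  then show ?thesis unfolding E.a_eq_iff_diff[OF c] .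
qed

text \<open>For any lift \<open>x'\<close> one has \<open>[hh, x'] = k x' + z\<close> with
  \<open>z\<close> central. A further bracket with \<open>hh\<close> kills \<open>z\<close>, so
  \<open>[hh, x']\<close> is an exact eigenvector, and \<open>u\<close> corrects its image.\<close>

lemma Wt_lift:
  assumes u: "u * k = 1" and X: "X \<in> osp_set" "mat_bracket h0 X = k \<odot>\<^bsub>mat_lie\<^esub> X"
    and x': "x' \<in> carrier E" "\<phi> x' = X"
  shows "u \<odot>\<^bsub>E\<^esub> bracket E hh x' \<in> Wt k" "\<phi> (u \<odot>\<^bsub>E\<^esub> bracket E hh x') = X"
proof -
  let ?y = "bracket E hh x'"
  have y: "?y \<in> carrier E" using x' by (simp add: E.bracket_closed)
  have py: "\<phi> ?y = \<phi> (k \<odot>\<^bsub>E\<^esub> x')" using x' X by (simp add: phi_simps hh)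
  obtain z where z: "z \<in> lie_center E" "z \<in> carrier E" "?y = k \<odot>\<^bsub>E\<^esub> x' \<oplus>\<^bsub>E\<^esub> z"
    using ker_diff[OF y _ py] x' by auto
  have "bracket E hh ?y = bracket E hh (k \<odot>\<^bsub>E\<^esub> x' \<oplus>\<^bsub>E\<^esub> z)" using z(3) by simp
  also have "\<dots> = k \<odot>\<^bsub>E\<^esub> ?y"
    using x' z(1,2) by (simp add: E.bracket_add_right E.bracket_smult_right E.center_right E.bracket_closed)
  finally show "u \<odot>\<^bsub>E\<^esub> ?y \<in> Wt k" using y by (intro Wt_smult) (simp add: Wt_def)
  have "\<phi> (u \<odot>\<^bsub>E\<^esub> ?y) = (u * k) \<odot>\<^bsub>mat_lie\<^esub> X"
    using y x' by (simp add: phi_simps py M.smult_mult)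
  then show "\<phi> (u \<odot>\<^bsub>E\<^esub> ?y) = X" using u M.smult_1[of X] by simp
qed

definition lft :: "'k \<Rightarrow> 'r^3^3 \<Rightarrow> 'e"
  where "lft k X = (THE x. x \<in> Wt k \<and> \<phi> x = X)"

lemma lft_eqI: "\<lbrakk>u * k = 1; x \<in> Wt k; \<phi> x = X\<rbrakk> \<Longrightarrow> lft k X = x"
  unfolding lft_def by (rule the_equality) (auto intro: Wt_inj)

lemma lft:
  assumes u: "u * k = 1" and X: "X \<in> osp_set" "mat_bracket h0 X = k \<odot>\<^bsub>mat_lie\<^esub> X"
  shows "lft k X \<in> Wt k" "\<phi> (lft k X) = X" "X \<in> mat_part p \<Longrightarrow> lft k X \<in> part E p"
proof -
  obtain x where x: "x \<in> carrier E" "\<phi> x = X" using lift_carrier[OF X(1)] by blast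
  note l = Wt_lift[OF u X x]
  show "lft k X \<in> Wt k" "\<phi> (lft k X) = X" using lft_eqI[OF u l] l by auto
  assume p: "X \<in> mat_part p"
  then obtain x where x: "x \<in> part E p" "\<phi> x = X" using lift_part[OF X(1)] by blast
  note l = Wt_lift[OF u X E.part_carrier[OF x(1)] x(2)]
  have "u \<odot>\<^bsub>E\<^esub> bracket E hh x \<in> part E p"
    using E.bracket_even[OF hh(1) x(1)] by (simp add: E.part_smult)
  then show "lft k X \<in> part E p" using lft_eqI[OF u l] by simp
qed

section \<open>Eigenvector lifts of the generators\<close>

definition "EV a = lft (1 + 1) (osp_v a)"
definition "EW a = lft (- 1 - 1) (osp_w a)"
definition "EF a = lft (- 1) (osp_f a)"
definition "EG a = lft 1 (osp_g a)"

text \<open>Inverses of the weights 2, -2, -1 and 1; the last two serve \<open>[v,v]\<close> and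
  \<open>[w,w]\<close>, whose weights are 4 and -4.\<close>

lemma units: "hf * (1 + 1) = (1::'k)" "- hf * (- 1 - 1) = (1::'k)" "- 1 * - 1 = (1::'k)" "1 * 1 = (1::'k)"
  "(hf * hf) * ((1 + 1) + (1 + 1)) = (1::'k)" "(- (hf * hf)) * ((- 1 - 1) + (- 1 - 1)) = (1::'k)"
proof -
  show "hf * (1 + 1) = (1::'k)" by (rule hf)
  have "(hf * hf) * ((1 + 1) * (1 + 1)) = (hf * (1 + 1)) * (hf * (1 + 1))" by (simp only: ac_simps)
  then have 1: "(hf * hf) * ((1 + 1) * (1 + 1)) = (1::'k)" by (simp add: hf)
  then show "(hf * hf) * ((1 + 1) + (1 + 1)) = (1::'k)" by (simp add: algebra_simps)
  from 1 show "(- (hf * hf)) * ((- 1 - 1) + (- 1 - 1)) = (1::'k)" by (simp add: algebra_simps)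
  show "- hf * (- 1 - 1) = (1::'k)" using hf(2) by (simp add: algebra_simps)
qed simp_all

lemma osp_weights:
  "mat_bracket h0 (osp_v a) = (1 + 1) \<odot>\<^bsub>mat_lie\<^esub> osp_v a" "mat_bracket h0 (osp_w a) = (- 1 - 1) \<odot>\<^bsub>mat_lie\<^esub> osp_w a"
  "mat_bracket h0 (osp_f a) = (- 1) \<odot>\<^bsub>mat_lie\<^esub> osp_f a" "mat_bracket h0 (osp_g a) = 1 \<odot>\<^bsub>mat_lie\<^esub> osp_g a"
  unfolding h0_gen using scl_simps(1)[of "- 1" "- 1"] by (simp_all add: mat_eq_iff scl_simps)

lemma EV: "EV a \<in> Wt (1 + 1)" "\<phi> (EV a) = osp_v a" "a \<in> H p \<Longrightarrow> EV a \<in> part E p"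
  and EW: "EW a \<in> Wt (- 1 - 1)" "\<phi> (EW a) = osp_w a" "a \<in> H p \<Longrightarrow> EW a \<in> part E p"
  and EF: "EF a \<in> Wt (- 1)" "\<phi> (EF a) = osp_f a" "a \<in> H p \<Longrightarrow> EF a \<in> part E (p + 1)"
  and EG: "EG a \<in> Wt 1" "\<phi> (EG a) = osp_g a" "a \<in> H p \<Longrightarrow> EG a \<in> part E (p + 1)"
  unfolding EV_def EW_def EF_def EG_def
  by (rule lft[OF units(1)] lft[OF units(2)] lft[OF units(3)] lft[OF units(4)] osp_gen_in osp_weights osp_gen_part; assumption?)+

lemmas E_phi [simp] = EV(2) EW(2) EF(2) EG(2)

lemma E_carrier [simp]: "EV a \<in> carrier E" "EW a \<in> carrier E" "EF a \<in> carrier E" "EG a \<in> carrier E"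
  by (rule Wt_carrier[OF EV(1)] Wt_carrier[OF EW(1)] Wt_carrier[OF EF(1)] Wt_carrier[OF EG(1)])+

lemma E_add:
  "EV (a + b) = EV a \<oplus>\<^bsub>E\<^esub> EV b" "EW (a + b) = EW a \<oplus>\<^bsub>E\<^esub> EW b"
  "EF (a + b) = EF a \<oplus>\<^bsub>E\<^esub> EF b" "EG (a + b) = EG a \<oplus>\<^bsub>E\<^esub> EG b"
  by (rule Wt_inj[OF units(1)] Wt_inj[OF units(2)] Wt_inj[OF units(3)] Wt_inj[OF units(4)];
      simp add: phi_simps osp_gen_linear Wt_add EV(1) EW(1) EF(1) EG(1))+

lemma E_scl:
  "EV (scl c a) = c \<odot>\<^bsub>E\<^esub> EV a" "EW (scl c a) = c \<odot>\<^bsub>E\<^esub> EW a"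
  "EF (scl c a) = c \<odot>\<^bsub>E\<^esub> EF a" "EG (scl c a) = c \<odot>\<^bsub>E\<^esub> EG a"
  by (rule Wt_inj[OF units(1)] Wt_inj[OF units(2)] Wt_inj[OF units(3)] Wt_inj[OF units(4)];
      simp add: phi_simps osp_gen_linear Wt_smult EV(1) EW(1) EF(1) EG(1))+

lemma E_bar: "EV (bar a) = EV a" "EW (bar a) = EW a"
  by (simp_all add: EV_def EW_def osp_gen_linear)

lemma E_sg: "EG (sg p a) = msg E p (EG a)"
  using E_scl(4)[of "- 1" a] by (cases p) (simp_all add: msg_def E.smult_minus1)

lemma E_zero: "bracket E (EV a) (EV b) = \<zero>\<^bsub>E\<^esub>" "bracket E (EW a) (EW b) = \<zero>\<^bsub>E\<^esub>"
proof -
  show "bracket E (EV a) (EV b) = \<zero>\<^bsub>E\<^esub>"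
    by (rule Wt_inj[OF units(5) Wt_bracket[OF EV(1) EV(1)] Wt_zero]) (simp_all add: phi_simps osp_rel_zero)
  show "bracket E (EW a) (EW b) = \<zero>\<^bsub>E\<^esub>"
    by (rule Wt_inj[OF units(6) Wt_bracket[OF EW(1) EW(1)] Wt_zero]) (simp_all add: phi_simps osp_rel_zero)
qed

lemma E_rel2:
  assumes a: "a \<in> H p" and b: "b \<in> H q"
  shows "bracket E (EV a) (EF b) = EG (sg q (tr a * bar b))"
    "bracket E (EG a) (EW b) = EF (- sg p (bar a * tr b))"
    "bracket E (EF a) (EF b) = EW (sg p (bar a * b))"
    "bracket E (EG a) (EG b) = EV (- sg q (a * bar b))"
proof -
  note r = osp_rel_homogeneous[OF a b]
  show "bracket E (EV a) (EF b) = EG (sg q (tr a * bar b))"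
    by (rule Wt_inj[OF units(4) Wt_bracket[OF EV(1) EF(1)] EG(1)]) (simp_all add: phi_simps r)
  show "bracket E (EG a) (EW b) = EF (- sg p (bar a * tr b))"
    by (rule Wt_inj[OF units(3) Wt_bracket[OF EG(1) EW(1)] EF(1)]) (simp_all add: phi_simps r)
  show "bracket E (EF a) (EF b) = EW (sg p (bar a * b))"
    by (rule Wt_inj[OF units(2) Wt_bracket[OF EF(1) EF(1)] EW(1)]) (simp_all add: phi_simps r)
  show "bracket E (EG a) (EG b) = EV (- sg q (a * bar b))"
    by (rule Wt_inj[OF units(1) Wt_bracket[OF EG(1) EG(1)] EV(1)]) (simp_all add: phi_simps r)
qed

text \<open>The second and third formulas are not defining relations. They give the action of a
  diagonal element on \<open>[EV 1, EG c]\<close>, from which a part of \<open>chi_I3\<close> is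
  derived.\<close>

lemma E_rel3:
  assumes a: "a \<in> H p" and b: "b \<in> H q" and c: "c \<in> H r"
  shows "bracket E (bracket E (EF a) (EG b)) (EF c) =
      EF (a * b * c - bar (a * b) * c - sg (p * q + q * r + r * p) (c * b * a))"
    "bracket E (bracket E (EF a) (EG b)) (EG c) =
      EG (sg (p * q + p + q) (b * a) * c - sg ((p + q) * r + p + q) (c * (a * b - bar (a * b))))"
    "bracket E (bracket E (EF a) (EG b)) (EV c) = EV (sg (p * q + p + q) (b * a) * tr c)"
    "bracket E (EG c) (bracket E (EF a) (EG b)) =
      EG (c * a * b - c * bar (a * b) - sg (r * p + p * q + q * r) (b * a * c))"
proof -
  note r = osp_rel_triple[OF a b c]
  have h: "bracket E (EF a) (EG b) \<in> Wt 0" by (rule Wt_bracket[OF EF(1) EG(1)]) simp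
  note hc = Wt_carrier[OF h]
  show "bracket E (bracket E (EF a) (EG b)) (EF c) =
      EF (a * b * c - bar (a * b) * c - sg (p * q + q * r + r * p) (c * b * a))"
    by (rule Wt_inj[OF units(3) Wt_bracket[OF h EF(1)] EF(1)]) (simp_all add: phi_simps hc r)
  show "bracket E (bracket E (EF a) (EG b)) (EG c) =
      EG (sg (p * q + p + q) (b * a) * c - sg ((p + q) * r + p + q) (c * (a * b - bar (a * b))))"
    by (rule Wt_inj[OF units(4) Wt_bracket[OF h EG(1)] EG(1)]) (simp_all only: phi_simps hc r E_carrier E_phi add_0_left)
  show "bracket E (bracket E (EF a) (EG b)) (EV c) = EV (sg (p * q + p + q) (b * a) * tr c)"
    by (rule Wt_inj[OF units(1) Wt_bracket[OF h EV(1)] EV(1)]) (simp_all only: phi_simps hc r E_carrier E_phi add_0_left)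
  show "bracket E (EG c) (bracket E (EF a) (EG b)) =
      EG (c * a * b - c * bar (a * b) - sg (r * p + p * q + q * r) (b * a * c))"
    by (rule Wt_inj[OF units(4) Wt_bracket[OF EG(1) h] EG(1)]) (simp_all only: phi_simps hc r E_carrier E_phi add_0_right)
qed

text \<open>The factor \<open>1/2\<close> compensates \<open>tr 1 = 2\<close> in \<open>[v(a), g(b)] = chi (tr a * b)\<close>.\<close>

definition chi :: "'r \<Rightarrow> 'e" where "chi r = hf \<odot>\<^bsub>E\<^esub> bracket E (EV 1) (EG r)"

lemma VG_center: "bracket E (EV a) (EG b) \<in> lie_center E"
  by (rule ker_central) (simp_all add: E.bracket_closed phi_simps osp_rel_zero)

lemma chi_carrier [simp]: "chi r \<in> carrier E"
  by (simp add: chi_def E.bracket_closed)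

lemma chi_phi [simp]: "\<phi> (chi r) = 0"
  by (simp add: chi_def E.bracket_closed phi_simps osp_rel_zero mat_eq_iff)

lemma chi_linear: "chi (r + s) = chi r \<oplus>\<^bsub>E\<^esub> chi s" "chi (scl c r) = c \<odot>\<^bsub>E\<^esub> chi r"
  by (simp_all add: chi_def E_add E_scl E.bracket_add_right E.bracket_smult_right E.bracket_closed E.smult_add_r mult.commute
      flip: E.smult_mult)

lemma chi_zero [simp]: "chi 0 = \<zero>\<^bsub>E\<^esub>"
  using chi_linear(2)[of 0 0] by simp

lemma chi_sg: "chi (sg p r) = msg E p (chi r)"
  using chi_linear(2)[of "- 1" r] by (cases p) (simp_all add: msg_def E.smult_minus1)

lemma chi_neg: "chi (- r) = \<ominus>\<^bsub>E\<^esub> chi r"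
  using chi_sg[of 1 r] by (simp add: msg_def)

lemma chi_part: "r \<in> H p \<Longrightarrow> chi r \<in> part E (1 + p)"
  using E.part_smult[OF E.bracket_even[OF EV(3)[OF one_H0] EG(3), of r p], of hf]
  by (simp add: chi_def add.commute)

lemma E_half: "x \<in> carrier E \<Longrightarrow> hf \<odot>\<^bsub>E\<^esub> (x \<oplus>\<^bsub>E\<^esub> x) = x"
  by (simp add: E.smult_add_r hf flip: E.smult_add_l)

text \<open>Because \<open>[v,v] = 0\<close>, the operators \<open>ad (EV a)\<close> and
  \<open>ad (EV c)\<close> supercommute. Applied to \<open>EF (bar b)\<close>, the inner brackets
  are \<open>EG (tr c * b)\<close> and \<open>EG (tr a * b)\<close> up to a common sign.\<close>

lemma VG_swap:
  assumes a: "a \<in> H p" and c: "c \<in> H r" and b: "b \<in> H q"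
  shows "bracket E (EV a) (EG (tr c * b)) = msg E (p * r) (bracket E (EV c) (EG (tr a * b)))"
proof -
  note l = E.leibniz[OF EV(3)[OF a] EV(3)[OF c] EF(3)[OF bar_deg[OF b]]]
  have "msg E q (bracket E (EV a) (EG (tr c * b))) = msg E q (msg E (p * r) (bracket E (EV c) (EG (tr a * b))))"
    using l unfolding E_rel2(1)[OF c bar_deg[OF b]] E_rel2(1)[OF a bar_deg[OF b]] E_zero
    by (simp add: E_sg E.br_msg E.bracket_closed E.msg_msg add.commute)
  then have "msg E q (msg E q (bracket E (EV a) (EG (tr c * b)))) =
      msg E q (msg E q (msg E (p * r) (bracket E (EV c) (EG (tr a * b)))))" by simp
  then show ?thesis by (simp add: E.msg_msg E.bracket_closed del: bit_add_self(2)) (simp add: msg_def)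
qed

text \<open>The case \<open>c = 1\<close> of \<open>VG_swap\<close>, divided by
  \<open>tr 1 = 2\<close>: all brackets \<open>[v,g]\<close> are governed by one linear map in one
  variable.\<close>

lemma VG_chi:
  assumes a: "a \<in> H p" and b: "b \<in> H q"
  shows "bracket E (EV a) (EG b) = chi (tr a * b)"
proof -
  have "bracket E (EV a) (EG b) \<oplus>\<^bsub>E\<^esub> bracket E (EV a) (EG b) = bracket E (EV 1) (EG (tr a * b))"
    using VG_swap[OF a one_H0 b]
    by (simp add: tr_simps distrib_right E_add E.bracket_add_right msg_def)
  then show ?thesis using E_half[of "bracket E (EV a) (EG b)"] by (simp add: chi_def E.bracket_closed)
qed

definition "Ker = {r. chi r = \<zero>\<^bsub>E\<^esub>}"

lemma Ker_submodule: "submodule Ker type_ring (alg_module scl)"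
  by (rule submodule_algI) (auto simp: Ker_def chi_linear)

lemmas KerD = submodule_algD[OF Ker_submodule]

text \<open>The premises of \<open>I3_subset\<close> translate into facts about \<open>E\<close>:
  \<open>three\<close> is the weight 3 acting on a central element, \<open>trc\<close> is
  \<open>VG_swap\<close>, \<open>G\<close> is the Jacobi identity for three lifts \<open>EG\<close>,
  and \<open>W\<close> is the action of \<open>[EF a, EG b]\<close> on
  \<open>[EV 1, EG c]\<close>.\<close>

lemma chi_I3: "r \<in> I3 \<Longrightarrow> chi r = \<zero>\<^bsub>E\<^esub>"
proof -
  have "I3 \<subseteq> Ker"
  proof (rule I3_subset[OF Ker_submodule])
    fix a p
    \<comment> \<open>This bracket is central, hence annihilated by \<open>ad hh\<close>, which on
      the other hand multiplies it by its weight 3.\<close>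
    have w: "bracket E (EV 1) (EG a) \<in> Wt ((1 + 1) + 1)" by (rule Wt_bracket[OF EV(1) EG(1) HOL.refl])
    have "((1 + 1) + 1) \<odot>\<^bsub>E\<^esub> bracket E (EV 1) (EG a) = \<zero>\<^bsub>E\<^esub>"
      using w E.center_right[OF VG_center, of hh 1 a] by (simp add: Wt_def)
    then have "((1 + 1) + 1) \<odot>\<^bsub>E\<^esub> chi a = \<zero>\<^bsub>E\<^esub>"
      unfolding chi_def by (simp add: E.bracket_closed mult.commute flip: E.smult_mult)
        (simp add: E.smult_mult E.bracket_closed mult.commute)
    then show "a + a + a \<in> Ker" by (simp add: Ker_def chi_linear E.smult_add_l)
  next
    fix a b c p q r assume a: "a \<in> H p" and b: "b \<in> H q" and c: "c \<in> H r"
    have "chi (tr a * tr b * c) = chi (sg (p * q) (tr b * tr a * c))"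
      using VG_swap[OF a b c] VG_chi[OF a mult_deg[OF tr_deg[OF b] c]] VG_chi[OF b mult_deg[OF tr_deg[OF a] c]]
      by (simp add: chi_sg mult.assoc)
    then show "tr a * tr b * c - sg (p * q) (tr b * tr a * c) \<in> Ker"
      using chi_linear(1)[of "tr a * tr b * c" "- sg (p * q) (tr b * tr a * c)"]
      by (simp add: Ker_def chi_neg E.M.r_neg)
  next
    fix a b c p q r assume a: "a \<in> H p" and b: "b \<in> H q" and c: "c \<in> H r"
    have *: "bracket E (bracket E (EG a) (EG b)) (EG c) = chi (- sg q ((a * bar b + sg (p * q) (b * bar a)) * c))"
      if a: "a \<in> H p" and b: "b \<in> H q" and c: "c \<in> H r" for a b c p q r
    proof -
      have 1: "- sg q (a * bar b) \<in> H (p + q)" using mult_deg[OF a bar_deg[OF b]] by simp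
      have "tr (a * bar b) = a * bar b + sg (p * q) (b * bar a)"
        using bar_mult[OF a bar_deg[OF b]] by (simp add: tr_def)
      then have 2: "tr (- sg q (a * bar b)) * c = - sg q ((a * bar b + sg (p * q) (b * bar a)) * c)"
        by (cases q) (simp_all add: tr_simps algebra_simps)
      show ?thesis unfolding E_rel2(4)[OF a b] VG_chi[OF 1 c] 2 ..
    qed
    let ?x = "(a * bar b + sg (p * q) (b * bar a)) * c" and ?y = "(b * bar c + sg (q * r) (c * bar b)) * a"
      and ?z = "(c * bar a + sg (r * p) (a * bar c)) * b"
    have "chi (sg ((p + 1) * (r + 1)) (- sg q ?x) + sg ((q + 1) * (p + 1)) (- sg r ?y) + sg ((r + 1) * (q + 1)) (- sg p ?z)) = \<zero>\<^bsub>E\<^esub>"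
      using E.super_jacobi[OF EG(3)[OF a] EG(3)[OF b] EG(3)[OF c]]
      unfolding *[OF a b c] *[OF b c a] *[OF c a b] by (simp only: chi_linear chi_sg)
    also have "sg ((p + 1) * (r + 1)) (- sg q ?x) + sg ((q + 1) * (p + 1)) (- sg r ?y) + sg ((r + 1) * (q + 1)) (- sg p ?z)
        = sg (p + q + r) (sg (p * r) ?x + sg (q * p) ?y + sg (r * q) ?z)"
      by (cases p; cases q; cases r) (simp_all add: algebra_simps)
    finally have "sg (p + q + r) (sg (p * r) ?x + sg (q * p) ?y + sg (r * q) ?z) \<in> Ker" by (simp add: Ker_def)
    then show "sg (p * r) ?x + sg (q * p) ?y + sg (r * q) ?z \<in> Ker" by (simp only: KerD(8))
  next
    fix a b c p q r assume a: "a \<in> H p" and b: "b \<in> H q" and c: "c \<in> H r"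
    let ?d = "sg (p * q + p + q) (b * a)" and ?y = "sg (p * q + p + q) (b * a) * c - sg ((p + q) * r + p + q) (c * (a * b - bar (a * b)))"
    let ?h = "bracket E (EF a) (EG b)"
    have d: "?d \<in> H (p + q)" using mult_deg[OF b a] by (simp add: add.commute)
    have h: "?h \<in> part E (p + q)" using E.bracket_even[OF EF(3)[OF a] EG(3)[OF b]] by (simp add: add_ac)
    have "a * b - bar (a * b) \<in> H (p + q)" using mult_deg[OF a b] by auto
    then have "c * (a * b - bar (a * b)) \<in> H (p + q + r)" using mult_deg[OF c] by (metis add.commute)
    from H_intros(4)[OF mult_deg[OF d c] H_intros(6)[OF this]] have y: "?y \<in> H (p + q + r)" .
    have dt: "?d * tr 1 \<in> H (p + q)" using mult_deg[OF d tr_deg[OF one_H0]] by simp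
    \<comment> \<open>Centrality gives zero, the Leibniz rule a sum of two values of
      \<open>chi\<close>. Both contain the factor \<open>tr 1 = 2\<close>, which is removed by
      \<open>hf\<close> below.\<close>
    have "bracket E ?h (bracket E (EV 1) (EG c)) = \<zero>\<^bsub>E\<^esub>"
      by (rule E.center_right[OF VG_center]) (simp add: E.bracket_closed)
    then have "chi (tr (?d * tr 1) * c) \<oplus>\<^bsub>E\<^esub> chi (tr 1 * ?y) = \<zero>\<^bsub>E\<^esub>"
      using E.leibniz[OF h EV(3)[OF one_H0] EG(3)[OF c]]
      unfolding E_rel3(2)[OF a b c] E_rel3(3)[OF a b one_H0] VG_chi[OF dt c] VG_chi[OF one_H0 y]
      by (simp add: msg_def)
    then have "tr (?d * tr 1) * c + tr 1 * ?y \<in> Ker" by (simp add: Ker_def chi_linear)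
    from KerD(5)[OF this, of hf] have "scl hf (tr (?d * tr 1) * c + tr 1 * ?y) \<in> Ker" .
    also have "tr (?d * tr 1) * c + tr 1 * ?y = (tr ?d * c + ?y) + (tr ?d * c + ?y)"
      by (simp add: tr_simps(8) distrib_left distrib_right tr_simps(1) add_ac)
    finally show "tr ?d * c + ?y \<in> Ker" by (simp only: scl_hf)
  qed
  then show "r \<in> I3 \<Longrightarrow> chi r = \<zero>\<^bsub>E\<^esub>" by (auto simp: Ker_def)
qed

end

text \<open>
  Composing with \<open>tau\<close> gives another central extension, in which \<open>F\<close>, \<open>W\<close> take the place of
  \<open>G\<close>, \<open>V\<close>.
\<close>

lemma (in osp_extension) tau_extension: "osp_extension scl H bar E (\<lambda>x. tau (\<phi> x)) (\<ominus>\<^bsub>E\<^esub> hh)"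
proof unfold_locales
  have "(\<lambda>x. tau (\<phi> x)) \<in> lie_hom E osp"
    by (rule lie_homI) (use tau_osp_set tau_part phi_simps phi.hom_part in \<open>auto simp: tau_linear tau_bracket\<close>)
  moreover have "(\<lambda>x. tau (\<phi> x)) ` carrier E = osp_set"
  proof (intro equalityI subsetI)
    fix X assume X: "X \<in> osp_set"
    \<comment> \<open>The fourth power of \<open>tau\<close> is the identity, so the cube of
      \<open>tau\<close> yields a preimage of \<open>X\<close>.\<close>
    then have "tau (tau (tau X)) \<in> osp_set" by (intro tau_osp_set)
    then obtain x where "x \<in> carrier E" "\<phi> x = tau (tau (tau X))" using lift_carrier by blast
    then show "X \<in> (\<lambda>x. tau (\<phi> x)) ` carrier E" using tau4[of X] by (intro image_eqI[of _ _ x]) simp_all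
  qed (use tau_osp_set phi_simps(5) in auto)
  moreover have "\<phi> x = 0" if "tau (\<phi> x) = 0" for x
    using that tau4[of "\<phi> x"] by (simp add: tau_linear)
  ultimately show "central_extension E osp (\<lambda>x. tau (\<phi> x))"
    using ker_central E.lie_superalgebra_axioms osp_lie_superalgebra unfolding central_extension_def by auto
  show "\<ominus>\<^bsub>E\<^esub> hh \<in> part E 0" using hh(1) by (rule E.part_neg)
  \<comment> \<open>\<open>tau\<close> maps \<open>h0\<close> to \<open>- h0\<close>, hence the sign
    of the lift.\<close>
  show "tau (\<phi> (\<ominus>\<^bsub>E\<^esub> hh)) = h0" by (simp add: phi_simps hh tau_linear tau_gen)
qed

lemma (in superinvolution_half) raw1_zero:
  assumes "X $ 2 $ 3 = 0 \<or> Y $ 2 $ 1 = 0" "Y $ 2 $ 3 = 0 \<or> X $ 2 $ 1 = 0"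
  shows "raw1 X Y = 0"
  using assms by (auto simp: raw1_def m1_def)

text \<open>Same content as \<open>osp_extension\<close>; the instance with \<open>tau\<close> is
  attached here because attaching it to \<open>osp_extension\<close> itself would repeat without
  end.\<close>

locale osp_extension_pair = osp_extension scl H bar E \<phi> hh
  for scl :: "'k::{comm_ring,monoid_mult} \<Rightarrow> 'r::{ring,monoid_mult} \<Rightarrow> 'r" and H bar
    and E :: "('k, 'e) lie_salg" and \<phi> hh

sublocale osp_extension_pair \<subseteq> T: osp_extension scl H bar E "\<lambda>x. tau (\<phi> x)" "\<ominus>\<^bsub>E\<^esub> hh"
  by (rule tau_extension)

section \<open>Construction of the homomorphism from \<open>uosp\<close>\<close>

context osp_extension_pair
begin

lemma T_Wt: "x \<in> T.Wt k \<Longrightarrow> x \<in> Wt (- k)"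
proof -
  assume x: "x \<in> T.Wt k"
  then have c: "x \<in> carrier E" by (rule T.Wt_carrier)
  have "\<ominus>\<^bsub>E\<^esub> bracket E hh x = k \<odot>\<^bsub>E\<^esub> x" using x c unfolding T.Wt_def by (simp add: E.br_neg)
  then have "\<ominus>\<^bsub>E\<^esub> (\<ominus>\<^bsub>E\<^esub> bracket E hh x) = \<ominus>\<^bsub>E\<^esub> (k \<odot>\<^bsub>E\<^esub> x)" by (rule arg_cong)
  then show "x \<in> Wt (- k)" using c unfolding Wt_def by (simp add: E.smult_uminus E.bracket_closed)
qed

lemma tau_inj: "tau X = tau Y \<Longrightarrow> X = Y"
  by (metis tau4)

text \<open>Both sides have weight -2 and the same image, so by the uniqueness of eigenvector lifts
  what is known about \<open>T.EV\<close> carries over to \<open>EW\<close>.\<close>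

lemma EW_T: "EW a = \<ominus>\<^bsub>E\<^esub> T.EV a"
proof (rule Wt_inj[OF units(2) EW(1) Wt_neg])
  show "T.EV a \<in> Wt (- 1 - 1)" using T_Wt[OF T.EV(1)[of a]] by simp
  show "\<phi> (EW a) = \<phi> (\<ominus>\<^bsub>E\<^esub> T.EV a)"
    by (rule tau_inj) (simp add: phi_simps tau_linear tau_gen)
qed

lemma EF_T: "EF a = T.EG (rho (bar a))"
proof (rule Wt_inj[OF units(3) EF(1)])
  show "T.EG (rho (bar a)) \<in> Wt (- 1)" using T_Wt[OF T.EG(1)] by simp
  show "\<phi> (EF a) = \<phi> (T.EG (rho (bar a)))"
    by (rule tau_inj) (simp add: tau_gen)
qed

text \<open>This is \<open>VG_chi\<close> for the instance with \<open>tau\<close>, with the two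
  arguments interchanged by skew-symmetry.\<close>

lemma FW_chi:
  assumes a: "a \<in> H p" and b: "b \<in> H q"
  shows "bracket E (EF a) (EW b) = T.chi (sg ((p + 1) * q) (tr b * rho (bar a)))"
proof -
  have ra: "rho (bar a) \<in> H p" using a by (simp add: rho_homogeneous)
  have "bracket E (EF a) (EW b) = \<ominus>\<^bsub>E\<^esub> bracket E (T.EG (rho (bar a))) (T.EV b)"
    by (simp add: EW_T EF_T E.br_neg)
  also have "\<dots> = msg E ((p + 1) * q) (bracket E (T.EV b) (T.EG (rho (bar a))))"
    using E.super_skew[OF T.EG(3)[OF ra] T.EV(3)[OF b]] by (simp add: E.bracket_closed)
  also have "\<dots> = T.chi (sg ((p + 1) * q) (tr b * rho (bar a)))"
    by (simp only: T.VG_chi[OF b ra] T.chi_sg)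
  finally show ?thesis .
qed

text \<open>
  The brackets \<open>[v,g]\<close> and \<open>[f,w]\<close> are the only relations that may fail in \<open>E\<close>; subtracting the pullback
  of the cocycle from the bracket makes all relations hold.
\<close>

definition alpha :: "'e \<Rightarrow> 'e \<Rightarrow> 'e"
  where "alpha x y = chi (- raw1 (\<phi> x) (\<phi> y)) \<oplus>\<^bsub>E\<^esub> T.chi (- raw1 (tau (\<phi> x)) (tau (\<phi> y)))"

lemma alpha_carrier [simp]: "alpha x y \<in> carrier E"
  by (simp add: alpha_def)

lemma alpha_phi [simp]: "\<phi> (alpha x y) = 0"
proof -
  have "\<phi> (T.chi r) = 0" for r
    using T.chi_phi[of r] tau4[of "\<phi> (T.chi r)"] by (simp add: tau_linear)
  then show ?thesis by (simp add: alpha_def phi_simps)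
qed

lemma alpha_add:
  assumes "x \<in> carrier E" "y \<in> carrier E"
  shows "alpha (x \<oplus>\<^bsub>E\<^esub> y) z = alpha x z \<oplus>\<^bsub>E\<^esub> alpha y z" "alpha z (x \<oplus>\<^bsub>E\<^esub> y) = alpha z x \<oplus>\<^bsub>E\<^esub> alpha z y"
proof -
  have e: "- (a + b) = - b + - a" for a b :: 'r by simp
  show "alpha (x \<oplus>\<^bsub>E\<^esub> y) z = alpha x z \<oplus>\<^bsub>E\<^esub> alpha y z" "alpha z (x \<oplus>\<^bsub>E\<^esub> y) = alpha z x \<oplus>\<^bsub>E\<^esub> alpha z y"
    unfolding alpha_def phi_simps(1)[OF assms] tau_linear raw1_add e chi_linear T.chi_linear
    by (simp_all add: E.M.a_ac)
qed

lemma alpha_smult: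
  assumes "x \<in> carrier E"
  shows "alpha (c \<odot>\<^bsub>E\<^esub> x) z = c \<odot>\<^bsub>E\<^esub> alpha x z" "alpha z (c \<odot>\<^bsub>E\<^esub> x) = c \<odot>\<^bsub>E\<^esub> alpha z x"
  unfolding alpha_def phi_simps(2)[OF assms] tau_linear raw1_smult scl_neg[symmetric] chi_linear T.chi_linear
  by (simp_all add: E.smult_add_r)

text \<open>The cocycle sums of \<open>raw1\<close>, formed with \<phi> and with \<open>tau\<close>
  after \<phi>, lie in \<open>I3\<close>, where \<open>chi\<close> and \<open>T.chi\<close> vanish.
  The values of \<open>alpha\<close> lie in the kernel of \<phi>, so they are central and
  \<open>alpha\<close> annihilates them.\<close>

lemma E'_lie_superalgebra: "lie_superalgebra (E\<lparr>bracket := \<lambda>x y. bracket E x y \<oplus>\<^bsub>E\<^esub> alpha x y\<rparr>)"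
proof (rule E.cocycle_bracket)
  fix x y assume "x \<in> carrier E" "y \<in> carrier E"
  show "alpha x y \<in> lie_center E" by (rule ker_central) simp_all
next
  fix x y p q assume xy: "x \<in> part E p" "y \<in> part E q"
  note h = phi_simps(6)[OF xy(1)] phi_simps(6)[OF xy(2)]
  show "alpha x y \<in> part E (p + q)"
    unfolding alpha_def
    using E.part_add[OF chi_part[OF H_intros(3)[OF raw1_deg[OF h]]] T.chi_part[OF H_intros(3)[OF raw1_deg[OF h[THEN tau_part]]]]]
    by simp
  show "alpha x y = \<ominus>\<^bsub>E\<^esub> msg E (p * q) (alpha y x)"
    unfolding alpha_def raw1_skew[OF h] raw1_skew[OF h[THEN tau_part]]
    by (simp add: chi_sg T.chi_sg chi_neg T.chi_neg E.msg_add E.msg_neg E.M.minus_add)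
next
  fix x y z p q r assume xyz: "x \<in> part E p" "y \<in> part E q" "z \<in> part E r"
  note c = xyz[THEN E.part_carrier]
  note h = phi_simps(6)[OF xyz(1)] phi_simps(5)[OF c(1)] phi_simps(6)[OF xyz(2)] phi_simps(5)[OF c(2)]
    phi_simps(6)[OF xyz(3)] phi_simps(5)[OF c(3)]
  let ?S = "\<lambda>f. sg (p * r) (raw1 (mat_bracket (f x) (f y)) (f z)) + sg (q * p) (raw1 (mat_bracket (f y) (f z)) (f x))
    + sg (r * q) (raw1 (mat_bracket (f z) (f x)) (f y))"
  have "?S \<phi> \<in> I3" "?S (\<lambda>x. tau (\<phi> x)) \<in> I3"
    using raw1_cocycle[OF h] raw1_cocycle[OF tau_part tau_osp_set tau_part tau_osp_set tau_part tau_osp_set, OF h] by simp_all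
  then have z: "chi (- ?S \<phi>) = \<zero>\<^bsub>E\<^esub>" "T.chi (- ?S (\<lambda>x. tau (\<phi> x))) = \<zero>\<^bsub>E\<^esub>"
    using chi_I3 T.chi_I3 by (simp_all only: I3D(7))
  have e: "- ?S f = sg (p * r) (- raw1 (mat_bracket (f x) (f y)) (f z)) + sg (q * p) (- raw1 (mat_bracket (f y) (f z)) (f x))
    + sg (r * q) (- raw1 (mat_bracket (f z) (f x)) (f y))" for f
    by (cases p; cases q; cases r) simp_all
  show "msg E (p * r) (alpha (bracket E x y) z) \<oplus>\<^bsub>E\<^esub> msg E (q * p) (alpha (bracket E y z) x) \<oplus>\<^bsub>E\<^esub>
      msg E (r * q) (alpha (bracket E z x) y) = \<zero>\<^bsub>E\<^esub>"
  proof -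
    have "msg E (p * r) (alpha (bracket E x y) z) \<oplus>\<^bsub>E\<^esub> msg E (q * p) (alpha (bracket E y z) x) \<oplus>\<^bsub>E\<^esub>
      msg E (r * q) (alpha (bracket E z x) y) = chi (- ?S \<phi>) \<oplus>\<^bsub>E\<^esub> T.chi (- ?S (\<lambda>x. tau (\<phi> x)))"
      unfolding alpha_def e[of \<phi>] e[of "\<lambda>x. tau (\<phi> x)"] phi_simps(3)[OF c(1,2)] phi_simps(3)[OF c(2,3)] phi_simps(3)[OF c(3,1)] tau_bracket
        chi_linear T.chi_linear chi_sg T.chi_sg
      by (simp add: E.msg_add E.M.a_ac)
    then show ?thesis unfolding z by simp
  qed
next
  fix x y z assume "x \<in> carrier E" "y \<in> carrier E" "z \<in> carrier E"
  have "raw1 0 X = 0" for X by (rule raw1_zero) simp_all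
  then show "alpha (alpha x y) z = \<zero>\<^bsub>E\<^esub>" unfolding alpha_def[of "alpha x y"] by (simp add: tau_linear)
qed (simp_all add: alpha_add alpha_smult)

abbreviation "E' \<equiv> E\<lparr>bracket := \<lambda>x y. bracket E x y \<oplus>\<^bsub>E\<^esub> alpha x y\<rparr>"

sublocale E': lie_superalgebra E'
  by (rule E'_lie_superalgebra)

lemma phi_E': "\<phi> \<in> lie_hom E' osp"
  by (rule lie_homI) (simp_all add: phi_simps E.bracket_closed, simp_all add: phi_simps E.part_carrier)

lemma alpha_zero:
  assumes "\<phi> x $ 2 $ 3 = 0 \<or> \<phi> y $ 2 $ 1 = 0" "\<phi> y $ 2 $ 3 = 0 \<or> \<phi> x $ 2 $ 1 = 0"
    "\<phi> x $ 3 $ 2 = 0 \<or> \<phi> y $ 3 $ 1 = 0" "\<phi> y $ 3 $ 2 = 0 \<or> \<phi> x $ 3 $ 1 = 0"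
  shows "alpha x y = \<zero>\<^bsub>E\<^esub>"
proof -
  have "raw1 (\<phi> x) (\<phi> y) = 0" "raw1 (tau (\<phi> x)) (tau (\<phi> y)) = 0"
    by (rule raw1_zero; use assms in simp)+
  then show ?thesis by (simp add: alpha_def)
qed

lemma bilinear_zero:
  assumes "\<And>a b p q. \<lbrakk>a \<in> H p; b \<in> H q\<rbrakk> \<Longrightarrow> B (F a) (G b) = \<zero>\<^bsub>E\<^esub>"
    "\<And>a b. F (a + b) = F a \<oplus>\<^bsub>E\<^esub> F b" "\<And>a b. G (a + b) = G a \<oplus>\<^bsub>E\<^esub> G b"
    "\<And>a. F a \<in> carrier E" "\<And>a. G a \<in> carrier E"
    "\<And>x y z. \<lbrakk>x \<in> carrier E; y \<in> carrier E; z \<in> carrier E\<rbrakk> \<Longrightarrow> B (x \<oplus>\<^bsub>E\<^esub> y) z = B x z \<oplus>\<^bsub>E\<^esub> B y z"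
    "\<And>x y z. \<lbrakk>x \<in> carrier E; y \<in> carrier E; z \<in> carrier E\<rbrakk> \<Longrightarrow> B z (x \<oplus>\<^bsub>E\<^esub> y) = B z x \<oplus>\<^bsub>E\<^esub> B z y"
  shows "B (F a) (G b) = \<zero>\<^bsub>E\<^esub>"
proof (rule H_cases_add[where a = a])
  fix a p assume a: "a \<in> H p"
  show "B (F a) (G b) = \<zero>\<^bsub>E\<^esub>"
    by (rule H_cases_add[where a = b]) (simp_all add: assms(1)[OF a] assms(3,4,5,7))
qed (simp add: assms(2,4,5,6))

lemma E'_rel_vg: "bracket E' (EV a) (EG b) = \<zero>\<^bsub>E\<^esub>"
proof (rule bilinear_zero[where B = "bracket E'"])
  fix a b p q assume a: "a \<in> H p" and b: "b \<in> H q"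
  have "raw1 (tau (osp_v a)) (tau (osp_g b)) = 0" by (rule raw1_zero) simp_all
  then show "bracket E' (EV a) (EG b) = \<zero>\<^bsub>E\<^esub>"
    by (simp add: alpha_def VG_chi[OF a b] raw1_gen(1)[OF a b] chi_neg E.M.r_neg)
qed (simp_all add: E_add E.bracket_add_left E.bracket_add_right alpha_add E.bracket_closed E.M.a_ac)

lemma E'_rel_fw: "bracket E' (EF a) (EW b) = \<zero>\<^bsub>E\<^esub>"
proof (rule bilinear_zero[where B = "bracket E'"])
  fix a b p q assume a: "a \<in> H p" and b: "b \<in> H q"
  have "raw1 (osp_f a) (osp_w b) = 0" by (rule raw1_zero) simp_all
  moreover have "raw1 (tau (osp_f a)) (tau (osp_w b)) = sg ((p + 1) * q) (tr b * rho (bar a))"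
    unfolding raw1_homogeneous[OF tau_part[OF osp_gen_part(3)[OF a]] tau_part[OF osp_gen_part(2)[OF b]]]
    by (simp add: sg_def)
  ultimately show "bracket E' (EF a) (EW b) = \<zero>\<^bsub>E\<^esub>"
    by (simp add: alpha_def FW_chi[OF a b] T.chi_neg E.M.r_neg)
qed (simp_all add: E_add E.bracket_add_left E.bracket_add_right alpha_add E.bracket_closed E.M.a_ac)

text \<open>\<open>alpha\<close> only sees the pairs of entries (2,3), (2,1) and (3,2), (3,1). On
  all pairs of generators listed here it leaves the bracket of \<open>E\<close> unchanged, so the
  relations already known for \<open>E\<close> persist.\<close>

lemma alpha_gen:
  "alpha (EV a) (EV b) = \<zero>\<^bsub>E\<^esub>" "alpha (EW a) (EW b) = \<zero>\<^bsub>E\<^esub>" "alpha (EV a) (EF b) = \<zero>\<^bsub>E\<^esub>"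
  "alpha (EG a) (EW b) = \<zero>\<^bsub>E\<^esub>" "alpha (EF a) (EF b) = \<zero>\<^bsub>E\<^esub>" "alpha (EG a) (EG b) = \<zero>\<^bsub>E\<^esub>"
  "alpha (EF a) (EG b) = \<zero>\<^bsub>E\<^esub>"
  by (simp_all add: alpha_zero)

lemma alpha_FG:
  assumes "a \<in> H p" "b \<in> H q"
  shows "alpha (bracket E (EF a) (EG b)) (EF c) = \<zero>\<^bsub>E\<^esub>" "alpha (EG c) (bracket E (EF a) (EG b)) = \<zero>\<^bsub>E\<^esub>"
  by (simp_all add: alpha_zero phi_simps osp_fg[OF assms])

lemma theta_exists:
  obtains \<theta> where "\<theta> \<in> lie_hom hat_osp E'" "\<And>x. x \<in> carrier hat_osp \<Longrightarrow> \<phi> (\<theta> x) = psi x"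
proof -
  define \<gamma> where "\<gamma> h = (case h of GV a \<Rightarrow> EV a | GW a \<Rightarrow> EW a | GF a \<Rightarrow> EF a | GG a \<Rightarrow> EG a)"
    for h :: "'r osp_gen"
  have car: "\<gamma> h \<in> carrier E'" for h by (cases h) (simp_all add: \<gamma>_def)
  have deg: "\<gamma> h \<in> part E' p" if "h \<in> gen_part p" for h p
    using that EV(3)[of _ p] EW(3)[of _ p] EF(3)[of _ "1 + p"] EG(3)[of _ "1 + p"]
    by (auto simp: gen_part_def \<gamma>_def add_ac)
  have rel: "E'.term_val \<gamma> s = E'.term_val \<gamma> t" if "osp_rel s t" for s t
    using that
  proof cases
    case (gen_add X a b) then show ?thesis by (auto simp: \<gamma>_def E_add)
  next
    case (gen_scale X c a) then show ?thesis by (auto simp: \<gamma>_def E_scl)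
  next
    case (fgf a p b q c r)
    then show ?thesis using alpha_FG(1)[OF fgf(3,4)] E_rel3(1)[OF fgf(3-5)]
      by (simp add: \<gamma>_def alpha_gen E.bracket_closed)
  next
    case (gfg a p b q c r)
    then show ?thesis using alpha_FG(2)[OF gfg(4,5)] E_rel3(4)[OF gfg(4,5,3)]
      by (simp add: \<gamma>_def alpha_gen E.bracket_closed add_ac mult_ac)
  qed (simp_all add: \<gamma>_def E_bar alpha_gen E'_rel_vg[simplified] E'_rel_fw[simplified] E_zero E_rel2 E.bracket_closed)
  obtain \<theta> where \<theta>: "\<theta> \<in> lie_hom hat_osp E'" "\<And>t. \<theta> (cl t) = E'.term_val \<gamma> t"
    unfolding hat_osp_def by (rule E'.presented_hom[of \<gamma> gen_part osp_rel]) (use car deg rel in auto)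
  have "(\<phi> \<circ> \<theta>) x = psi x" if "x \<in> carrier hat_osp" for x
  proof (rule presented_hom_unique[where D = gen_part and Q = osp_rel and L = osp])
    show "\<phi> \<circ> \<theta> \<in> lie_hom (presented_lie_salg gen_part osp_rel) osp"
      using lie_hom_comp[OF \<theta>(1) phi_E'] by (simp add: hat_osp_def)
    show "psi \<in> lie_hom (presented_lie_salg gen_part osp_rel) osp"
      using psi_hom by (simp add: hat_osp_def)
    show "(\<phi> \<circ> \<theta>) (cl (Gen g)) = psi (cl (Gen g))" for g
      using psi_gen[unfolded hat_v_def hat_w_def hat_f_def hat_g_def] by (cases g) (simp_all add: \<theta>(2) \<gamma>_def)
    show "(\<phi> \<circ> \<theta>) (cl Zero) = psi (cl Zero)"
      using psi.hom_zero unfolding hat_ops(2) by (simp add: \<theta>(2) phi_simps)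
    show "x \<in> carrier (presented_lie_salg gen_part osp_rel)" using that by (simp add: hat_osp_def)
  qed
  then show thesis using that \<theta>(1) by simp
qed

text \<open>The choices of representatives are immaterial, as \<open>chi\<close> and \<open>T.chi\<close> vanish on \<open>I3\<close>.\<close>

definition zeta :: "'r set \<times> 'r set \<Rightarrow> 'e"
  where "zeta z = chi (SOME a. a \<in> fst z) \<oplus>\<^bsub>E\<^esub> T.chi (rho (bar (SOME b. b \<in> snd z)))"

lemma zeta_zc: "zeta (zc a b) = chi a \<oplus>\<^bsub>E\<^esub> T.chi (rho (bar b))"
proof -
  have 1: "(SOME x. x \<in> cls a) - a \<in> I3" for a
    using someI[of "\<lambda>x. x \<in> cls a", OF cls_self] by (auto simp: cls_eq)
  have 2: "chi x = chi a" "T.chi (rho (bar x)) = T.chi (rho (bar a))" if "x - a \<in> I3" for x a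
  proof -
    show "chi x = chi a" using chi_I3[OF that] chi_linear(1)[of "x - a" a] by simp
    show "T.chi (rho (bar x)) = T.chi (rho (bar a))"
      using T.chi_I3[OF I3_rho[OF I3_bar_in[OF that]]] T.chi_linear(1)[of "rho (bar (x - a))" "rho (bar a)"]
      by (simp add: bar_diff rho_simps)
  qed
  show ?thesis unfolding zeta_def zc_def fst_conv snd_conv using 2(1)[OF 1] 2(2)[OF 1] by simp
qed

lemma zeta_carrier [simp]: "zeta z \<in> carrier E"
  by (simp add: zeta_def)

lemma zeta_phi [simp]: "\<phi> (zeta z) = 0"
proof -
  have "\<phi> (T.chi r) = 0" for r
    using T.chi_phi[of r] tau4[of "\<phi> (T.chi r)"] by (simp add: tau_linear)
  then show ?thesis by (simp add: zeta_def phi_simps)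
qed

lemma zeta_center: "zeta z \<in> lie_center E"
  by (rule ker_central) simp_all

lemma zeta_linear:
  assumes "x \<in> carrier z_module" "y \<in> carrier z_module"
  shows "zeta (x \<oplus>\<^bsub>z_module\<^esub> y) = zeta x \<oplus>\<^bsub>E\<^esub> zeta y" "zeta (c \<odot>\<^bsub>z_module\<^esub> x) = c \<odot>\<^bsub>E\<^esub> zeta x"
proof -
  obtain a b a' b' where e: "x = zc a b" "y = zc a' b'" using assms by (auto simp: z_carrier)
  show "zeta (x \<oplus>\<^bsub>z_module\<^esub> y) = zeta x \<oplus>\<^bsub>E\<^esub> zeta y"
    unfolding e z_add zeta_zc chi_linear bar_add rho_simps(1) T.chi_linear by (simp add: E.M.a_ac)
  show "zeta (c \<odot>\<^bsub>z_module\<^esub> x) = c \<odot>\<^bsub>E\<^esub> zeta x"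
    unfolding e z_smult zeta_zc chi_linear bar_scl rho_simps(2) T.chi_linear by (simp add: E.smult_add_r)
qed

lemma zeta_part: "z \<in> z_part p \<Longrightarrow> zeta z \<in> part E p"
proof -
  assume "z \<in> z_part p"
  then obtain a b where z: "z = zc a b" "a \<in> H (1 + p)" "b \<in> H (1 + p)" by (auto simp: z_part_eq)
  have "rho (bar b) \<in> H (1 + p)" using z(3) by (simp add: rho_homogeneous)
  then show ?thesis using E.part_add[OF chi_part[OF z(2)] T.chi_part] by (simp add: z(1) zeta_zc)
qed

text \<open>The map \<open>rho (bar _)\<close> in \<open>zeta\<close> undoes the
  \<open>bar (rho _)\<close> in \<open>raw2\<close>, so the second components cancel like the first
  ones.\<close>

lemma zeta_beta: "alpha x y \<oplus>\<^bsub>E\<^esub> zeta (zc (raw1 (\<phi> x) (\<phi> y)) (raw2 (\<phi> x) (\<phi> y))) = \<zero>\<^bsub>E\<^esub>"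
proof -
  have "rho (bar (bar (rho a))) = a" for a by simp
  then show ?thesis
    unfolding alpha_def zeta_zc raw2_def
    by (simp add: chi_neg T.chi_neg flip: E.M.minus_add) (simp add: E.M.l_neg)
qed

text \<open>\<theta> respects brackets only after the correction by \<open>alpha\<close>. On pairs,
  the second component of the bracket of \<open>uosp\<close> contributes \<open>zeta\<close> of the
  cocycle, the negative of \<open>alpha\<close>, and this restores the bracket of
  \<open>E\<close>.\<close>

lemma universal_hom_exists:
  "\<exists>\<eta>. \<eta> \<in> lie_hom uosp E \<and> \<eta> \<in> extensional (carrier uosp) \<and> (\<forall>x\<in>carrier uosp. \<phi> (\<eta> x) = (psi \<circ> psi') x)"
proof -
  obtain \<theta> where \<theta>: "\<theta> \<in> lie_hom hat_osp E'" "\<And>x. x \<in> carrier hat_osp \<Longrightarrow> \<phi> (\<theta> x) = psi x"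
    by (rule theta_exists) blast
  note t = lie_homD[OF \<theta>(1)]
  have tc [simp]: "x \<in> carrier hat_osp \<Longrightarrow> \<theta> x \<in> carrier E" for x using t(1)[of x] by simp
  define \<eta> where "\<eta> = restrict (\<lambda>(x, c). \<theta> x \<oplus>\<^bsub>E\<^esub> zeta c) (carrier uosp)"
  have \<eta>: "\<eta> (x, c) = \<theta> x \<oplus>\<^bsub>E\<^esub> zeta c" if "x \<in> carrier hat_osp" "c \<in> carrier z_module" for x c
    using that by (simp add: \<eta>_def)
  have "\<eta> \<in> lie_hom uosp E"
  proof (rule lie_homI)
    fix u assume "u \<in> carrier uosp"
    then obtain x c where u: "u = (x, c)" "x \<in> carrier hat_osp" "c \<in> carrier z_module" by auto
    show "\<eta> u \<in> carrier E" using u by (simp add: \<eta>)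
    show "\<eta> (k \<odot>\<^bsub>uosp\<^esub> u) = k \<odot>\<^bsub>E\<^esub> \<eta> u" for k
      using u t(3)[of x k] by (simp add: \<eta> zeta_linear E.smult_add_r)
    fix v assume "v \<in> carrier uosp"
    then obtain y d where v: "v = (y, d)" "y \<in> carrier hat_osp" "d \<in> carrier z_module" by auto
    show "\<eta> (u \<oplus>\<^bsub>uosp\<^esub> v) = \<eta> u \<oplus>\<^bsub>E\<^esub> \<eta> v"
      using u v t(2)[of x y] by (simp add: \<eta> zeta_linear E.M.a_ac)
    have b: "beta_mat x y \<in> carrier z_module" by (simp add: beta_mat_def)
    have "\<eta> (bracket uosp u v) = \<theta> (bracket hat_osp x y) \<oplus>\<^bsub>E\<^esub> zeta (beta_mat x y)"
      using u v b by (simp add: \<eta> Hat.bracket_closed)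
    also have "\<dots> = bracket E (\<theta> x) (\<theta> y) \<oplus>\<^bsub>E\<^esub> (alpha (\<theta> x) (\<theta> y) \<oplus>\<^bsub>E\<^esub> zeta (beta_mat x y))"
      using u v t(4)[of x y] by (simp add: E.bracket_closed E.M.a_assoc)
    also have "\<dots> = bracket E (\<theta> x) (\<theta> y)"
      using u v zeta_beta[of "\<theta> x" "\<theta> y"] by (simp add: \<theta>(2) beta_mat_def E.bracket_closed)
    also have "\<dots> = bracket E (\<eta> u) (\<eta> v)"
      using u v zeta_center by (simp add: \<eta> E.bracket_add_left E.bracket_add_right E.bracket_closed E.center_right E.centerI_left)
    finally show "\<eta> (bracket uosp u v) = bracket E (\<eta> u) (\<eta> v)" .
  next
    fix u p assume "u \<in> part uosp p"
    then obtain x c where u: "u = (x, c)" "x \<in> part hat_osp p" "c \<in> z_part p" by auto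
    have "\<theta> x \<in> part E p" using t(5)[OF u(2)] by simp
    then show "\<eta> u \<in> part E p"
      using u Hat.part_carrier[OF u(2)] Z.graded_carrier[OF z_graded u(3)] zeta_part[OF u(3)]
      by (simp add: \<eta> E.part_add)
  qed
  moreover have "\<eta> \<in> extensional (carrier uosp)" by (simp add: \<eta>_def)
  moreover have "\<phi> (\<eta> u) = (psi \<circ> psi') u" if "u \<in> carrier uosp" for u
    using that by (auto simp: \<eta> phi_simps \<theta>(2) psi'_def simp del: uosp_simps(2-))
  ultimately show ?thesis by blast
qed

end

subsection \<open>Uniqueness\<close>

context superinvolution_half
begin

text \<open>The spanning elements of \<open>hat_osp\<close> are brackets of pairs on which
  \<open>beta\<close> vanishes, so they are reached without a central component. The centre is
  reached by \<open>[v,g]\<close> and \<open>[f,w]\<close>, which vanish in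
  \<open>hat_osp\<close>.\<close>

lemma uosp_perfect:
  assumes N: "submodule N type_ring uosp"
    and br: "\<And>x y. \<lbrakk>x \<in> carrier uosp; y \<in> carrier uosp\<rbrakk> \<Longrightarrow> bracket uosp x y \<in> N"
    and u: "u \<in> carrier uosp"
  shows "u \<in> N"
proof -
  let ?z = "\<zero>\<^bsub>z_module\<^esub>"
  note ND = U.submodule_zero[OF N] U.submoduleE(4,5)[OF N]
  have br': "(bracket hat_osp x y, beta_mat x y) \<in> N" if "x \<in> carrier hat_osp" "y \<in> carrier hat_osp" for x y
    using br[of "(x, ?z)" "(y, ?z)"] that by simp
  have sp: "(bracket hat_osp x y, ?z) \<in> N"
    if "x \<in> spanning i" "y \<in> spanning j" "(i, j) \<notin> {(KV, KG), (KG, KV), (KF, KW), (KW, KF)}" for x y i j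
    using br'[of x y] beta_mat_zero[OF that(3,1,2)] that spanning_carrier by (auto simp: z_zero)
  have hat: "(x, ?z) \<in> N" if "x \<in> carrier hat_osp" for x
    using that
  proof (induction rule: hat_induct)
    case (spanning x k)
    have h1: "hat_h 1 1 \<in> spanning KH" using one_H0 by auto
    show ?case
    proof (cases k)
      case KH
      then obtain a b p q where "x = hat_h a b" "a \<in> H p" "b \<in> H q" using spanning by auto
      then show ?thesis using sp[of "hat_f a" KF "hat_g b" KG] by (auto simp: hat_h_def)
    next
      case KV
      then obtain a p where a: "x = hat_v a" "a \<in> H p" using spanning by auto
      then have "hat_g (- a) \<in> spanning KG" "hat_g 1 \<in> spanning KG" using one_H0 by auto
      then show ?thesis using sp[of "hat_g (- a)" KG "hat_g 1" KG] by (simp add: a(1) hat_v_eq[OF a(2)])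
    next
      case KW
      then obtain a p where a: "x = hat_w a" "a \<in> H p" using spanning by auto
      then have "hat_f a \<in> spanning KF" "hat_f 1 \<in> spanning KF" using one_H0 by auto
      then show ?thesis using sp[of "hat_f 1" KF "hat_f a" KF] by (simp add: a(1) hat_w_eq[OF a(2)])
    next
      case KF
      then obtain a p where a: "x = hat_f a" "a \<in> H p" using spanning by auto
      then have "hat_f (- a) \<in> spanning KF" by auto
      \<comment> \<open>For \<open>a = b = 1\<close> the relation \<open>fgf\<close> has the
        coefficient \<open>1 - 1 - 1 = - 1\<close>, hence the argument \<open>- a\<close>.\<close>
      moreover have "bracket hat_osp (hat_h 1 1) (hat_f (- a)) = hat_f a"
        using hat_relations(7)[OF one_H0 one_H0, of "- a" p] a(2) by simp
      ultimately show ?thesis using sp[OF h1, of "hat_f (- a)" KF] by (simp add: a(1))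
    next
      case KG
      then obtain a p where a: "x = hat_g a" "a \<in> H p" using spanning by auto
      then have "hat_g (- a) \<in> spanning KG" by auto
      moreover have "bracket hat_osp (hat_g (- a)) (hat_h 1 1) = hat_g a"
        using hat_relations(8)[OF _ one_H0 one_H0, of "- a" p] a(2) by simp
      ultimately show ?thesis using sp[OF _ h1, of "hat_g (- a)" KG] by (simp add: a(1))
    qed
  next
    case zero
    then show ?case using ND(1) by simp
  next
    case (add x y)
    then show ?case using ND(3)[of "(x, ?z)" "(y, ?z)"] by simp
  next
    case (smult c x)
    then show ?case using ND(2)[of c "(x, ?z)"] by simp
  qed
  have c1: "(\<zero>\<^bsub>hat_osp\<^esub>, zc a 0) \<in> N" for a
  proof (rule H_cases_add[where a = a])
    fix a p assume a: "a \<in> H p"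
    \<comment> \<open>The central component of \<open>[v(1), g(b)]\<close> is the class of
      \<open>tr 1 * b = 2 b\<close>, so half of \<open>a\<close> is inserted.\<close>
    then have b: "scl hf a \<in> H p" by auto
    show "(\<zero>\<^bsub>hat_osp\<^esub>, zc a 0) \<in> N"
      using br'[of "hat_v 1" "hat_g (scl hf a)"] beta_mat_gen(1)[OF one_H0 b]
      by (simp add: hat_relations pi_eq tr_simps distrib_right scl_hf)
  next
    fix a b assume "(\<zero>\<^bsub>hat_osp\<^esub>, zc a 0) \<in> N" "(\<zero>\<^bsub>hat_osp\<^esub>, zc b 0) \<in> N"
    from ND(3)[OF this] show "(\<zero>\<^bsub>hat_osp\<^esub>, zc (a + b) 0) \<in> N" by (simp add: z_add)
  qed
  have c2: "(\<zero>\<^bsub>hat_osp\<^esub>, zc 0 a) \<in> N" for a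
  proof (rule H_cases_add[where a = a])
    fix a p assume a: "a \<in> H p"
    then have b: "scl hf a \<in> H p" by auto
    show "(\<zero>\<^bsub>hat_osp\<^esub>, zc 0 a) \<in> N"
      using br'[of "hat_f (scl hf a)" "hat_w 1"] beta_mat_gen(3)[OF b one_H0]
      by (simp add: hat_relations pi_eq tr_simps distrib_left scl_hf)
  next
    fix a b assume "(\<zero>\<^bsub>hat_osp\<^esub>, zc 0 a) \<in> N" "(\<zero>\<^bsub>hat_osp\<^esub>, zc 0 b) \<in> N"
    from ND(3)[OF this] show "(\<zero>\<^bsub>hat_osp\<^esub>, zc 0 (a + b)) \<in> N" by (simp add: z_add)
  qed
  obtain x a b where x: "u = (x, zc a b)" "x \<in> carrier hat_osp" using u by (auto simp: z_carrier)
  from ND(3)[OF hat[OF x(2)] ND(3)[OF c1[of a] c2[of b]]] show ?thesis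
    using x by (simp add: z_add)
qed

text \<open>Two such homomorphisms differ pointwise by central elements, which disappear in
  brackets. They therefore agree on all brackets, and these span \<open>uosp\<close>.\<close>

lemma universal_hom_unique:
  assumes ext: "central_extension E osp \<phi>"
    and e: "\<eta> \<in> lie_hom uosp E" "\<eta>' \<in> lie_hom uosp E"
    and p: "\<And>x. x \<in> carrier uosp \<Longrightarrow> \<phi> (\<eta> x) = \<phi> (\<eta>' x)" and u: "u \<in> carrier uosp"
  shows "\<eta> u = \<eta>' u"
proof -
  interpret phi: lie_homomorphism E osp \<phi>
    using ext by (simp add: lie_homomorphism_def lie_homomorphism_axioms_def central_extension_def)
  interpret e: lie_homomorphism uosp E \<eta> by unfold_locales (rule e)
  interpret e': lie_homomorphism uosp E \<eta>' by unfold_locales (rule e)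
  have "u \<in> {x \<in> carrier uosp. \<eta> x = \<eta>' x}"
  proof (rule uosp_perfect[OF _ _ u])
    show "submodule {x \<in> carrier uosp. \<eta> x = \<eta>' x} type_ring uosp"
      by (rule U.submoduleI')
        (auto simp: e.hom_add e'.hom_add e.hom_smult e'.hom_smult e.hom_zero e'.hom_zero simp del: uosp_simps)
  next
    fix x y assume x: "x \<in> carrier uosp" and y: "y \<in> carrier uosp"
    have d: "\<exists>z. z \<in> lie_center E \<and> z \<in> carrier E \<and> \<eta> x = \<eta>' x \<oplus>\<^bsub>E\<^esub> z" if x: "x \<in> carrier uosp" for x
    proof (intro exI conjI)
      note c = e.hom_closed[OF x] e'.hom_closed[OF x]
      let ?z = "\<ominus>\<^bsub>E\<^esub> \<eta>' x \<oplus>\<^bsub>E\<^esub> \<eta> x"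
      have "\<phi> ?z = 0"
        using c p[OF x] phi.hom_closed[OF c(2)] by (simp add: phi.hom_add phi.hom_neg)
      then show "?z \<in> lie_center E" using ext c unfolding central_extension_def by auto
      show "?z \<in> carrier E" "\<eta> x = \<eta>' x \<oplus>\<^bsub>E\<^esub> ?z" using c by (simp_all add: phi.L.M.r_neg2)
    qed
    obtain z w where z: "z \<in> lie_center E" "z \<in> carrier E" "\<eta> x = \<eta>' x \<oplus>\<^bsub>E\<^esub> z"
      and w: "w \<in> lie_center E" "w \<in> carrier E" "\<eta> y = \<eta>' y \<oplus>\<^bsub>E\<^esub> w" using d[OF x] d[OF y] by blast
    have "bracket E (\<eta> x) (\<eta> y) = bracket E (\<eta>' x) (\<eta>' y)"
      unfolding z(3) w(3) using z(1,2) w(1,2) e'.hom_closed[OF x] e'.hom_closed[OF y]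
      by (simp add: phi.L.bracket_add_left phi.L.bracket_add_right phi.L.bracket_closed phi.L.center_right phi.L.centerI_left)
    then show "bracket uosp x y \<in> {x \<in> carrier uosp. \<eta> x = \<eta>' x}"
      using x y by (simp add: e.hom_bracket e'.hom_bracket U.bracket_closed del: uosp_simps)
  qed
  then show ?thesis by simp
qed

theorem uosp_universal: "universal_central_extension TYPE('e) uosp osp (psi \<circ> psi')"
  unfolding universal_central_extension_def
proof (intro conjI allI impI uosp_central_extension)
  fix E :: "('k, 'e) lie_salg" and \<phi> assume ext: "central_extension E osp \<phi>"
  obtain hh where hh: "hh \<in> part E 0" "\<phi> hh = h0"
    using extension_lift_part[OF ext osp_gen_in(5) h0_part] by blast
  interpret osp_extension_pair scl H bar E \<phi> hh
    using ext hh by (auto simp: osp_extension_pair_def osp_extension_def osp_extension_axioms_def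
        central_extension_def intro: superinvolution_half_axioms)
  obtain \<eta> where \<eta>: "\<eta> \<in> lie_hom uosp E" "\<eta> \<in> extensional (carrier uosp)"
    "\<forall>x\<in>carrier uosp. \<phi> (\<eta> x) = (psi \<circ> psi') x"
    using universal_hom_exists by blast
  show "\<exists>!\<phi>'. \<phi>' \<in> lie_hom uosp E \<and> \<phi>' \<in> extensional (carrier uosp) \<and>
      (\<forall>x\<in>carrier uosp. \<phi> (\<phi>' x) = (psi \<circ> psi') x)"
  proof (rule ex1I)
    fix \<eta>' assume \<eta>': "\<eta>' \<in> lie_hom uosp E \<and> \<eta>' \<in> extensional (carrier uosp) \<and>
      (\<forall>x\<in>carrier uosp. \<phi> (\<eta>' x) = (psi \<circ> psi') x)"
    show "\<eta>' = \<eta>"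
    proof (rule extensionalityI[of _ "carrier uosp"])
      fix x assume "x \<in> carrier uosp"
      then show "\<eta>' x = \<eta> x"
        using universal_hom_unique[OF ext, of \<eta>' \<eta> x] \<eta> \<eta>' by auto
    qed (use \<eta> \<eta>' in blast)+
  qed (use \<eta> in blast)
qed

end

theorem theorem7p12:
  fixes scl :: "'k::{comm_ring,monoid_mult} \<Rightarrow> 'r::{ring,monoid_mult} \<Rightarrow> 'r"
    and H :: "bit \<Rightarrow> 'r set"
    and bar :: "'r \<Rightarrow> 'r"
  assumes "\<exists>u::'k. (1 + 1) * u = 1"
    and "superinvolution scl H bar"
  shows "universal_central_extension TYPE('e)
           (superinvolution.uosp scl H bar) (superinvolution.osp scl H bar)
           (superinvolution.psi scl H bar \<circ> superinvolution.psi')"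
proof -
  interpret superinvolution_half scl H bar
    using assms by (simp add: superinvolution_half_def superinvolution_half_axioms_def)
  show ?thesis by (rule uosp_universal)
qed

end
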